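(* Let $R$ be a finite local principal ideal ring of type $(a,e,f,p)$, let $\pi$ be a uniformizer of $R$, and put $a_0=\lceil a/e\rceil$. Then: (1) $R$ is the homomorphic image of a discrete valuation ring $D$ of an algebraic number field. In effect, there exist field extensions $\mathbb{Q}\subseteq K=\mathbb{Q}[X]/(h(X))\subseteq L=K[Y]/(\tilde g(Y))$, where $h\in\mathbb{Z}[X]$ is monic of degree $f$ and irreducible mod $p$, and $\tilde g\in\mathcal{O}_K[Y]$ is monic of degree $e$ and $p$-Eisenstein, such that $[K:\mathbb{Q}]=f$, $p$ is inert in $\mathcal{O}_K$, $[L:K]=e$, and $p\mathcal{O}_K$ is totally ramified in $\mathcal{O}_L$; and for $D$ one can take the discrete valuation ring $\mathcal{O}_{L,\mathfrak{P}_L}$ (the localization of $\mathcal{O}_L$ at $\mathfrak{P}_L$), where $\mathfrak{P}_L$ is the unique prime of $\mathcal{O}_L$ lying over $p$. One has $R\cong D/\mathfrak{P}_L^{a}D=D/(\overline{Y}^{\,a})$, where $\overline{Y}\in L$ is the class of $Y$. The ramification index and residue degree of the extension $L/\mathbb{Q}$ with respect to $p$ are $e$ and $f$, i.e. they match those of $R$. (2) For every monic polynomial $\hat h\in\mathbb{Z}[X]$ of degree $f$ that is irreducible mod $p$ there exists a ring isomorphism $$\mathbb{Z}[X,Y]/(p^{a_0},\,Y^a,\,\hat g(X,Y),\,\hat h(X))\xrightarrow{\ \sim\ }R$$ for a suitable polynomial $\hat g(X,Y)\in\mathbb{Z}[X,Y]$ which is monic of degree $e$ with respect to $Y$ and has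 a $p$-Eisenstein image in $(\mathbb{Z}[X]/(\hat h))[Y]$. Given a zero $\hat b$ of $\hat h$ in $R$, the isomorphism (for a suitable such $\hat g$) is defined by $\overline{X}\mapsto\hat b$ and $\overline{Y}\mapsto\pi$.
   Context: All rings are commutative with 1. For a finite local principal ideal ring $R$ with maximal ideal $\mathfrak{p}$: $k=R/\mathfrak{p}$ is the residue field, $p$ is the characteristic of $k$, $f=[k:\mathbb{F}_p]$ is the residue degree; $a$ is the nilpotency index, the least positive integer with $\mathfrak{p}^a=0$; for $0\ne r\in R$, $\mathrm{ord}_{\mathfrak{p}}(r)=n$ iff $r\in\mathfrak{p}^n\setminus\mathfrak{p}^{n+1}$, and $\mathrm{ord}_{\mathfrak{p}}(0)=a$; $e=\mathrm{ord}_{\mathfrak{p}}(p)$ is the ramification index. The type of $R$ is $(a,e,f,p)$. A uniformizer of $R$ is a generator $\pi$ of $\mathfrak{p}$. For a number field $K$, $\mathcal{O}_K$ is its ring of integers; $p$ is inert in $\mathcal{O}_K$ if $p\mathcal{O}_K$ is a prime ideal. For a ring $A$ in which $p$ generates a prime ideal ($A=\mathcal{O}_K$ with $p$ inert, or $A=\mathbb{Z}[X]/(\hat h)$), a polynomial in $A[Y]$ is $p$-Eisenstein if it is monic, all its non-leading coefficients lie in $pA$, and its constant term does not lie in $p^2A$. *)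

theory Defs
  imports
    "HOL-Algebra.Ideal_Product"
    "HOL-Algebra.IntRing"
    "HOL-Algebra.Polynomial_Divisibility"
    Complex_Main
begin

text \<open>
  Polynomials are those of \<^theory>\<open>HOL-Algebra.Polynomials\<close>: coefficient lists, leading
  coefficient first, without leading zeros.  Powers of an ideal \<open>I\<close> of \<open>A\<close> are powers in
  \<^term>\<open>ideals_set A\<close>, so that the zeroth power is \<open>carrier A\<close>.
\<close>

abbreviation rat_ring :: "rat ring" where
  "rat_ring \<equiv> \<lparr>carrier = UNIV, monoid.mult = (*), one = 1, zero = 0, add = (+)\<rparr>"

abbreviation ideal_pow :: "('a, 'm) ring_scheme \<Rightarrow> 'a set \<Rightarrow> nat \<Rightarrow> 'a set" where
  "ideal_pow A I n \<equiv> I [^]\<^bsub>ideals_set A\<^esub> n"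

definition int_img :: "('a, 'm) ring_scheme \<Rightarrow> int \<Rightarrow> 'a" where
  "int_img A n = add_pow A n \<one>\<^bsub>A\<^esub>"

text \<open>The image of the integers; in a field of prime characteristic \<open>p\<close> it is the prime field.\<close>

definition prime_subring :: "('a, 'm) ring_scheme \<Rightarrow> 'a set" where
  "prime_subring A = range (int_img A)"

definition has_char :: "('a, 'm) ring_scheme \<Rightarrow> nat \<Rightarrow> bool" where
  "has_char A p \<longleftrightarrow> (\<forall>n. int_img A n = \<zero>\<^bsub>A\<^esub> \<longleftrightarrow> int p dvd n)"


subsection \<open>Finite local principal ideal rings\<close>

definition finite_local_PIR :: "('a, 'm) ring_scheme \<Rightarrow> bool" where
  "finite_local_PIR R \<longleftrightarrow> cring R \<and> finite (carrier R) \<and> (\<exists>!P. maximalideal P R)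
     \<and> (\<forall>I. ideal I R \<longrightarrow> principalideal I R)"

definition max_ideal :: "('a, 'm) ring_scheme \<Rightarrow> 'a set" where
  "max_ideal R = (THE P. maximalideal P R)"

definition nilpotency_index :: "('a, 'm) ring_scheme \<Rightarrow> nat" where
  "nilpotency_index R = (LEAST n. n > 0 \<and> ideal_pow R (max_ideal R) n = {\<zero>\<^bsub>R\<^esub>})"

definition ord_max :: "('a, 'm) ring_scheme \<Rightarrow> 'a \<Rightarrow> nat" where
  "ord_max R r = (if r = \<zero>\<^bsub>R\<^esub> then nilpotency_index R
     else (THE n. r \<in> ideal_pow R (max_ideal R) n - ideal_pow R (max_ideal R) (n + 1)))"

text \<open>\<open>[A/Q : \<F>\<^sub>p] = n\<close>, where \<open>\<F>\<^sub>p\<close> is the prime field of \<open>A/Q\<close>.\<close>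

definition has_residue_degree :: "('a, 'm) ring_scheme \<Rightarrow> 'a set \<Rightarrow> nat \<Rightarrow> bool" where
  "has_residue_degree A Q n \<longleftrightarrow>
     ring.dimension (A Quot Q) n (prime_subring (A Quot Q)) (carrier (A Quot Q))"

definition has_type :: "('a, 'm) ring_scheme \<Rightarrow> nat \<Rightarrow> nat \<Rightarrow> nat \<Rightarrow> nat \<Rightarrow> bool" where
  "has_type R a e f p \<longleftrightarrow>
     has_char (R Quot max_ideal R) p \<and>
     has_residue_degree R (max_ideal R) f \<and>
     a = nilpotency_index R \<and>
     e = ord_max R (int_img R (int p))"

definition uniformizer :: "('a, 'm) ring_scheme \<Rightarrow> 'a \<Rightarrow> bool" where
  "uniformizer R \<pi> \<longleftrightarrow> \<pi> \<in> carrier R \<and> PIdl\<^bsub>R\<^esub> \<pi> = max_ideal R"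


subsection \<open>Polynomials\<close>

definition monic :: "('a, 'm) ring_scheme \<Rightarrow> 'a list \<Rightarrow> bool" where
  "monic A q \<longleftrightarrow> q \<in> carrier (poly_ring A) \<and> q \<noteq> [] \<and> lead_coeff q = \<one>\<^bsub>A\<^esub>"

text \<open>The image of a polynomial over \<open>A\<close> in the polynomial ring over \<open>A/I\<close>.\<close>

definition poly_mod :: "('a, 'm) ring_scheme \<Rightarrow> 'a set \<Rightarrow> 'a list \<Rightarrow> 'a set list" where
  "poly_mod A I q = ring.normalize (A Quot I) (map (\<lambda>c. I +>\<^bsub>A\<^esub> c) q)"

definition irreducible_mod :: "nat \<Rightarrow> int list \<Rightarrow> bool" where
  "irreducible_mod p q \<longleftrightarrow>
     pirreducible\<^bsub>ZFact (int p)\<^esub> (carrier (ZFact (int p))) (poly_mod \<Z> (Idl\<^bsub>\<Z>\<^esub> {int p}) q)"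

definition eisenstein :: "('a, 'm) ring_scheme \<Rightarrow> nat \<Rightarrow> 'a list \<Rightarrow> bool" where
  "eisenstein A p q \<longleftrightarrow> monic A q \<and>
     (\<forall>i < degree q. ring.coeff A q i \<in> PIdl\<^bsub>A\<^esub> (int_img A (int p))) \<and>
     ring.coeff A q 0 \<notin> PIdl\<^bsub>A\<^esub> (int_img A (int p) [^]\<^bsub>A\<^esub> (2::nat))"

definition int_eval :: "('a, 'm) ring_scheme \<Rightarrow> int list \<Rightarrow> 'a \<Rightarrow> 'a" where
  "int_eval A q x = ring.eval A (map (int_img A) q) x"

text \<open>The class of \<open>q\<close> in \<open>F[X]/(h)\<close>, that is in \<^term>\<open>Rupt\<^bsub>F\<^esub> (carrier F) h\<close>, and the canonical
  map from \<open>F\<close> to \<open>F[X]/(h)\<close>.\<close>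

definition poly_class :: "('a, 'm) ring_scheme \<Rightarrow> 'a list \<Rightarrow> 'a list \<Rightarrow> 'a list set" where
  "poly_class F h q = (PIdl\<^bsub>poly_ring F\<^esub> h) +>\<^bsub>poly_ring F\<^esub> q"

definition const_class :: "('a, 'm) ring_scheme \<Rightarrow> 'a list \<Rightarrow> 'a \<Rightarrow> 'a list set" where
  "const_class F h c = poly_class F h (ring.poly_of_const F c)"


subsection \<open>Rings of integers, ramification, localization\<close>

definition ring_of_integers :: "('a, 'm) ring_scheme \<Rightarrow> ('a, 'm) ring_scheme" (\<open>\<O>\<close>) where
  "ring_of_integers K =
     K\<lparr>carrier := {x \<in> carrier K. \<exists>q. monic \<Z> q \<and> int_eval K q x = \<zero>\<^bsub>K\<^esub>}\<rparr>"

definition lies_over :: "('a, 'm) ring_scheme \<Rightarrow> 'a set \<Rightarrow> nat \<Rightarrow> bool" where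
  "lies_over B Q p \<longleftrightarrow> primeideal Q B \<and> {n. int_img B n \<in> Q} = {n. int p dvd n}"

definition inert :: "('a, 'm) ring_scheme \<Rightarrow> nat \<Rightarrow> bool" where
  "inert A p \<longleftrightarrow> primeideal (PIdl\<^bsub>A\<^esub> (int_img A (int p))) A"

text \<open>For an embedding \<open>\<iota>\<close> of number fields \<open>K \<rightarrow> L\<close>, a prime \<open>P\<close> of \<open>\<O> K\<close> is totally ramified
  if its extension to \<open>\<O> L\<close> is the \<open>[L:K]\<close>-th power of a prime.\<close>

definition totally_ramified ::
    "('a, 'm) ring_scheme \<Rightarrow> ('b, 'n) ring_scheme \<Rightarrow> ('a \<Rightarrow> 'b) \<Rightarrow> 'a set \<Rightarrow> bool" where
  "totally_ramified K L \<iota> P \<longleftrightarrow>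
     (\<exists>Q. primeideal Q (\<O> L) \<and>
        Idl\<^bsub>\<O> L\<^esub> (\<iota> ` P) = ideal_pow (\<O> L) Q (ring.dim L (\<iota> ` carrier K) (carrier L)))"

text \<open>The exponent of \<open>Q\<close> in the factorization of the ideal \<open>pB\<close>.\<close>

definition ramification_index :: "('a, 'm) ring_scheme \<Rightarrow> 'a set \<Rightarrow> nat \<Rightarrow> nat" where
  "ramification_index B Q p =
     (GREATEST n. PIdl\<^bsub>B\<^esub> (int_img B (int p)) \<subseteq> ideal_pow B Q n)"

text \<open>The localization of \<open>\<O> L\<close> at \<open>Q\<close>, as a subring of its field of fractions \<open>L\<close>.\<close>

definition localization_at :: "('a, 'm) ring_scheme \<Rightarrow> 'a set \<Rightarrow> ('a, 'm) ring_scheme" where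
  "localization_at L Q =
     L\<lparr>carrier := {x \<otimes>\<^bsub>L\<^esub> inv\<^bsub>L\<^esub> y | x y. x \<in> carrier (\<O> L) \<and> y \<in> carrier (\<O> L) - Q}\<rparr>"

definition discrete_valuation_ring :: "('a, 'm) ring_scheme \<Rightarrow> bool" where
  "discrete_valuation_ring D \<longleftrightarrow>
     principal_domain D \<and> (\<exists>!P. maximalideal P D) \<and> \<not> field D"


subsection \<open>The two-variable presentation\<close>

text \<open>\<open>\<int>[X,Y]\<close> is taken as \<open>\<int>[X][Y]\<close>, so that degrees, leading coefficients and monicity of
  its elements are those with respect to \<open>Y\<close>.\<close>

abbreviation ZX :: "int list ring" where
  "ZX \<equiv> poly_ring \<Z>"

abbreviation ZXY :: "int list list ring" where
  "ZXY \<equiv> poly_ring ZX"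

abbreviation ZX_to_ZXY :: "int list \<Rightarrow> int list list" where
  "ZX_to_ZXY \<equiv> ring.poly_of_const ZX"

definition presentation_ideal ::
    "nat \<Rightarrow> nat \<Rightarrow> nat \<Rightarrow> int list list \<Rightarrow> int list \<Rightarrow> int list list set" where
  "presentation_ideal p a0 a g h =
     Idl\<^bsub>ZXY\<^esub> {int_img ZXY (int (p ^ a0)), X\<^bsub>ZX\<^esub> [^]\<^bsub>ZXY\<^esub> a, g, ZX_to_ZXY h}"

text \<open>\<open>g \<in> \<int>[X,Y]\<close> is monic of degree \<open>e\<close> in \<open>Y\<close>, with \<open>p\<close>-Eisenstein image over \<open>\<int>[X]/(h)\<close>.\<close>

definition eisenstein_lift :: "nat \<Rightarrow> nat \<Rightarrow> int list \<Rightarrow> int list list \<Rightarrow> bool" where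
  "eisenstein_lift p e h g \<longleftrightarrow> monic ZX g \<and> degree g = e \<and>
     eisenstein (ZX Quot (PIdl\<^bsub>ZX\<^esub> h)) p (poly_mod ZX (PIdl\<^bsub>ZX\<^esub> h) g)"

end

theory Submission
  imports "Jordan_Normal_Form.Char_Poly" "HOL-Algebra.Multiplicative_Group" Defs
begin

text \<open>
  Let \<open>k\<close> be the residue field of \<open>R\<close>.  A generator of its multiplicative group is a root of a monic
  \<open>h \<in> \<int>[X]\<close> of degree \<open>f\<close> that is irreducible modulo \<open>p\<close>.  For every such \<open>h\<close>, a root in \<open>k\<close> is
  simple and lifts to a root \<open>b \<in> R\<close> by Hensel's lemma.  Expanding in powers of \<open>\<pi>\<close>, every element of
  \<open>R\<close> is a value at \<open>(b, \<pi>)\<close> of a polynomial in \<open>\<int>[X,Y]\<close> of degree less than \<open>e\<close> in \<open>Y\<close>; in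
  particular \<open>\<pi>^e = p U(b, \<pi>)\<close> with \<open>U(b, \<pi>)\<close> a unit.  The Eisenstein polynomial is \<open>Y^e - p U(X, Y)\<close>.

  For the number fields take complex roots \<open>x\<close> of \<open>h\<close> and \<open>y\<close> of \<open>Y^e - p U(x, Y)\<close>.  The order
  \<open>B = \<int>[x, y]\<close> need not be the ring of integers of \<open>L\<close>, but at the maximal ideal \<open>(p, y)\<close> it is a
  discrete valuation ring with uniformizer \<open>y\<close>: the localization \<open>D\<close> satisfies \<open>L = {y^n w | w unit of D}\<close>.
  Hence \<open>D\<close> contains all algebraic integers of \<open>L\<close>, and a non-multiple of \<open>y\<close> in \<open>D\<close> is invertible
  modulo \<open>p\<close> in \<open>B\<close>, which yields all statements on the primes over \<open>p\<close> without any ideal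
  factorization.  The map \<open>x \<mapsto> b\<close>, \<open>y \<mapsto> \<pi>\<close> on \<open>B\<close> extends to \<open>D\<close> and has kernel \<open>(y^a)\<close>.
\<close>

section \<open>Sums and products of algebraic integers\<close>

text \<open>Fields are never obtained from an irreducibility criterion over the rationals.
  Evaluation at complex roots embeds the quotient rings of the statement into the complex numbers as
  soon as the products \<open>x^i y^j\<close> with \<open>i < f\<close> and \<open>j < e\<close> are
  known to be independent over the rationals, and this independence is itself read off from
  divisibility by \<open>y\<close>. A quotient of a polynomial ring over a field by a monic
  polynomial that embeds in this way is a domain, hence a field. One argument covers both floors of
  the tower: \<open>K\<close> is the instance \<open>e = 1\<close>, \<open>U = 1\<close>,
  \<open>y = p\<close>, and inertness of \<open>p\<close> in \<open>K\<close> is the case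
  \<open>e = 1\<close> of the fact that \<open>p\<close> generates the \<open>e\<close>-th power of
  the prime. The order is tied to its localization by identities \<open>s t = 1 + p z\<close>. They
  keep their meaning in every ring to which the order maps: no prime over \<open>p\<close> contains
  \<open>s\<close>, and the image of \<open>s\<close> in \<open>R\<close> is a unit. Polynomials
  occur in two guises, as a type, where the computations take place, and as coefficient lists over a
  ring record, as the statement demands; homomorphisms from types to records translate.\<close>

definition zspan :: "complex set \<Rightarrow> complex set" where
  "zspan M = {\<Sum>m\<in>M. of_int (c m) * m | c. True}"

lemma zspan_0: "0 \<in> zspan M"
  unfolding zspan_def by (rule CollectI, rule exI[of _ "\<lambda>_. 0"]) simp

lemma zspan_base: "finite M \<Longrightarrow> m \<in> M \<Longrightarrow> m \<in> zspan M"
  unfolding zspan_def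
  by (rule CollectI, rule exI[of _ "\<lambda>x. if x = m then 1 else 0"]) (simp add: if_distrib[of of_int] if_distrib[of "\<lambda>t. t * _"] cong: if_cong)

lemma zspan_add: "a \<in> zspan M \<Longrightarrow> b \<in> zspan M \<Longrightarrow> a + b \<in> zspan M"
  unfolding zspan_def
proof safe
  fix c d
  show "\<exists>e. (\<Sum>m\<in>M. of_int (c m) * m) + (\<Sum>m\<in>M. of_int (d m) * m) = (\<Sum>m\<in>M. of_int (e m) * m) \<and> True"
    by (rule exI[of _ "\<lambda>m. c m + d m"]) (simp add: sum.distrib algebra_simps)
qed

lemma zspan_smult: "a \<in> zspan M \<Longrightarrow> of_int n * a \<in> zspan M"
  unfolding zspan_def
proof safe
  fix c
  show "\<exists>e. of_int n * (\<Sum>m\<in>M. of_int (c m) * m) = (\<Sum>m\<in>M. of_int (e m) * m) \<and> True"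
    by (rule exI[of _ "\<lambda>m. n * c m"]) (simp add: sum_distrib_left algebra_simps)
qed

lemma zspan_sum: "(\<And>i. i \<in> I \<Longrightarrow> a i \<in> zspan M) \<Longrightarrow> (\<Sum>i\<in>I. of_int (c i) * a i) \<in> zspan M"
  by (induction I rule: infinite_finite_induct) (auto intro: zspan_0 zspan_add zspan_smult)

lemma zspan_stable:
  assumes "\<And>m. m \<in> M \<Longrightarrow> z * m \<in> zspan M" "a \<in> zspan M"
  shows "z * a \<in> zspan M"
proof -
  obtain c where a: "a = (\<Sum>m\<in>M. of_int (c m) * m)"
    using assms(2) unfolding zspan_def by auto
  have "z * a = (\<Sum>m\<in>M. of_int (c m) * (z * m))"
    unfolding a by (simp add: sum_distrib_left algebra_simps)
  thus ?thesis using zspan_sum[of M "\<lambda>m. z * m" M c] assms(1) by simp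
qed

text \<open>Determinant trick: multiplication by \<open>z\<close> acts on the generators through an
  integer matrix, which has the vector of generators as an eigenvector, so \<open>z\<close> is a
  root of its monic characteristic polynomial. The generator \<open>m0\<close> makes that vector
  nonzero.\<close>

lemma algebraic_int_if_zspan_stable:
  assumes M: "finite M" "m0 \<in> M" "m0 \<noteq> 0" and st: "\<And>m. m \<in> M \<Longrightarrow> z * m \<in> zspan M"
  shows "algebraic_int z"
proof -
  have "\<forall>m\<in>M. \<exists>c. z * m = (\<Sum>m'\<in>M. of_int (c m') * m')"
    using st unfolding zspan_def by auto
  then obtain c where c: "\<And>m. m \<in> M \<Longrightarrow> z * m = (\<Sum>m'\<in>M. of_int (c m m') * m')"
    by metis
  obtain ms where ms: "set ms = M" "distinct ms" using M(1) finite_distinct_list by blast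
  define n where "n = length ms"
  define A where "A = mat n n (\<lambda>(i, j). c (ms ! i) (ms ! j) :: int)"
  define v where "v = vec n (\<lambda>i. ms ! i)"
  have A: "A \<in> carrier_mat n n" by (simp add: A_def)
  have sum: "(\<Sum>m'\<in>M. f m') = (\<Sum>j<n. f (ms ! j))" for f :: "complex \<Rightarrow> complex"
    unfolding ms(1)[symmetric] n_def using ms(2)
    by (metis bij_betw_nth sum.reindex_bij_betw)
  have "eigenvector (map_mat of_int A) v z"
    unfolding eigenvector_def
  proof (intro conjI)
    show "v \<in> carrier_vec (dim_row (map_mat complex_of_int A))" by (simp add: v_def A_def)
    obtain i where "i < n" "ms ! i = m0" using M(2) ms(1) unfolding n_def by (metis in_set_conv_nth)
    hence "v $ i \<noteq> 0" using M(3) by (simp add: v_def)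
    thus "v \<noteq> 0\<^sub>v (dim_row (map_mat complex_of_int A))"
      using \<open>i < n\<close> by (auto simp: A_def)
    show "map_mat complex_of_int A *\<^sub>v v = z \<cdot>\<^sub>v v"
    proof (rule eq_vecI)
      show "dim_vec (map_mat complex_of_int A *\<^sub>v v) = dim_vec (z \<cdot>\<^sub>v v)" by (simp add: A_def v_def)
      fix i assume "i < dim_vec (z \<cdot>\<^sub>v v)"
      hence i: "i < n" by (simp add: v_def)
      hence "ms ! i \<in> M" using ms(1) n_def by auto
      hence "z * ms ! i = (\<Sum>j<n. of_int (c (ms ! i) (ms ! j)) * ms ! j)"
        using c[of "ms ! i"] sum by simp
      thus "(map_mat complex_of_int A *\<^sub>v v) $ i = (z \<cdot>\<^sub>v v) $ i"
        using i by (simp add: A_def v_def scalar_prod_def atLeast0LessThan)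
    qed
  qed
  hence "eigenvalue (map_mat of_int A) z" unfolding eigenvalue_def by blast
  hence "poly (char_poly (map_mat complex_of_int A)) z = 0"
    using eigenvalue_root_char_poly[of "map_mat complex_of_int A" n z] A by simp
  hence "poly (of_int_poly (char_poly A)) z = 0"
    using of_int_hom.char_poly_hom[OF A, where 'a=complex] by simp
  moreover have "Polynomial.lead_coeff (char_poly A) = 1"
    using degree_monic_char_poly[OF A] by simp
  ultimately show ?thesis
    using algebraic_int_altdef_ipoly by blast
qed

lemma algebraic_int_iff_monic_root:
  "algebraic_int (z :: complex) \<longleftrightarrow> (\<exists>q. Polynomial.lead_coeff q = 1 \<and> poly (of_int_poly q) z = 0)"
  unfolding algebraic_int_altdef_ipoly by auto

lemma algebraic_int_power_reduce:
  assumes "algebraic_int (z :: complex)"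
  obtains n c where "n > 0" "z ^ n = (\<Sum>i<n. of_int (c i) * z ^ i)"
proof -
  obtain q :: "int poly" where q: "Polynomial.lead_coeff q = 1" "poly (of_int_poly q) z = 0"
    using assms algebraic_int_iff_monic_root by blast
  define n where "n = Polynomial.degree q"
  have "n > 0"
  proof (rule ccontr)
    assume "\<not> n > 0"
    then obtain c where "q = [:c:]" unfolding n_def by (metis degree_eq_zeroE gr0I)
    thus False using q by simp
  qed
  have "0 = (\<Sum>i\<le>n. of_int (poly.coeff q i) * z ^ i)"
    using q(2) by (simp add: poly_altdef n_def)
  also have "{..n} = insert n {..<n}" by auto
  also have "(\<Sum>i\<in>insert n {..<n}. of_int (poly.coeff q i) * z ^ i)
      = z ^ n + (\<Sum>i<n. of_int (poly.coeff q i) * z ^ i)"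
    using q(1) by (simp add: n_def)
  finally have "z ^ n = (\<Sum>i<n. of_int (- poly.coeff q i) * z ^ i)"
    by (simp add: sum_negf eq_neg_iff_add_eq_0)
  with \<open>n > 0\<close> that show ?thesis by metis
qed

text \<open>The products \<open>\<alpha> ^ i * \<beta> ^ j\<close> with \<open>i < n\<close> and
  \<open>j < m\<close> span a group stable under both numbers: the integral equations rewrite the
  powers \<open>\<alpha> ^ n\<close> and \<open>\<beta> ^ m\<close> that leave the range.\<close>

lemma algebraic_int_add_mult:
  assumes "algebraic_int (\<alpha> :: complex)" "algebraic_int \<beta>"
  shows "algebraic_int (\<alpha> + \<beta>)" "algebraic_int (\<alpha> * \<beta>)"
proof -
  obtain n c where n: "n > 0" "\<alpha> ^ n = (\<Sum>i<n. of_int (c i) * \<alpha> ^ i)"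
    using algebraic_int_power_reduce[OF assms(1)] by metis
  obtain m d where m: "m > 0" "\<beta> ^ m = (\<Sum>i<m. of_int (d i) * \<beta> ^ i)"
    using algebraic_int_power_reduce[OF assms(2)] by metis
  define M where "M = (\<lambda>(i,j). \<alpha> ^ i * \<beta> ^ j) ` ({..<n} \<times> {..<m})"
  have fin: "finite M" by (simp add: M_def)
  have M: "\<alpha> ^ i * \<beta> ^ j \<in> zspan M" if "i < n" "j < m" for i j
    using that by (intro zspan_base fin) (auto simp: M_def)
  have st1: "\<alpha> * a \<in> zspan M" if a: "a \<in> M" for a
  proof -
    obtain i j where ij: "a = \<alpha> ^ i * \<beta> ^ j" "i < n" "j < m" using a by (auto simp: M_def)
    show ?thesis
    proof (cases "Suc i < n")
      case True
      thus ?thesis using M[of "Suc i" j] ij by (simp add: mult.assoc)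
    next
      case False
      hence "n = Suc i" using ij by simp
      hence "\<alpha> * a = \<alpha> ^ n * \<beta> ^ j" using ij by simp
      also have "\<dots> = (\<Sum>i<n. of_int (c i) * (\<alpha> ^ i * \<beta> ^ j))"
        unfolding n(2) by (simp add: sum_distrib_left sum_distrib_right algebra_simps)
      finally show ?thesis using zspan_sum[of "{..<n}"] M ij by simp
    qed
  qed
  have st2: "\<beta> * a \<in> zspan M" if a: "a \<in> M" for a
  proof -
    obtain i j where ij: "a = \<alpha> ^ i * \<beta> ^ j" "i < n" "j < m" using a by (auto simp: M_def)
    show ?thesis
    proof (cases "Suc j < m")
      case True
      thus ?thesis using M[of i "Suc j"] ij by (simp add: algebra_simps)
    next
      case False
      hence "m = Suc j" using ij by simp
      hence "\<beta> * a = \<beta> ^ m * \<alpha> ^ i" using ij by simp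
      also have "\<dots> = (\<Sum>j<m. of_int (d j) * (\<alpha> ^ i * \<beta> ^ j))"
        unfolding m(2) by (simp add: sum_distrib_left sum_distrib_right algebra_simps)
      finally show ?thesis using zspan_sum[of "{..<m}"] M ij by simp
    qed
  qed
  have one: "1 \<in> M" using n(1) m(1) by (force simp: M_def)
  show "algebraic_int (\<alpha> + \<beta>)"
    by (rule algebraic_int_if_zspan_stable[OF fin one]) (auto simp: distrib_right intro: zspan_add st1 st2)
  show "algebraic_int (\<alpha> * \<beta>)"
    by (rule algebraic_int_if_zspan_stable[OF fin one]) (auto simp: mult.assoc intro: zspan_stable[OF st1] st2)
qed

section \<open>Division with remainder by monic polynomials over a commutative ring\<close>

lemma monic_division:
  fixes g F :: "'a :: comm_ring_1 poly"
  assumes "Polynomial.lead_coeff g = 1" "Polynomial.degree g > 0"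
  shows "\<exists>A r. F = g * A + r \<and> Polynomial.degree r < Polynomial.degree g"
proof -
  \<comment> \<open>Pseudo-division multiplies \<open>F\<close> by a power of the leading
    coefficient of \<open>g\<close>, which is 1 here. The outcome \<open>r = 0\<close> also
    satisfies the strict bound, because \<open>g\<close> is not constant.\<close>
  obtain A r where Ar: "pseudo_divmod F g = (A, r)" by fastforce
  have "g \<noteq> 0" using assms by auto
  from pseudo_divmod[OF this Ar] have "F = g * A + r" "r = 0 \<or> Polynomial.degree r < Polynomial.degree g"
    using assms(1) by simp_all
  thus ?thesis using assms(2) by (intro exI[of _ A] exI[of _ r]) auto
qed

section \<open>The order generated by the two roots\<close>

text \<open>Normal forms modulo a monic \<open>g\<close> of degree \<open>e\<close> in
  \<open>Y\<close> and a monic \<open>h\<close> of degree \<open>f\<close> in \<open>X\<close>.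
  Their values at the two roots are the combinations of \<open>x^i y^j\<close> with
  \<open>i < f\<close> and \<open>j < e\<close>.\<close>

definition reduced :: "nat \<Rightarrow> nat \<Rightarrow> 'a :: comm_ring_1 poly poly \<Rightarrow> bool" where
  "reduced f e F \<longleftrightarrow> Polynomial.degree F < e \<and> (\<forall>j. Polynomial.degree (poly.coeff F j) < f)"

lemma reduced_division:
  fixes g F :: "'a :: comm_ring_1 poly poly"
  assumes g: "Polynomial.lead_coeff g = 1" "Polynomial.degree g = e" "e > 0"
    and h: "Polynomial.lead_coeff h = 1" "Polynomial.degree h = f" "f > 0"
  shows "\<exists>A B r. F = g * A + [:h:] * B + r \<and> reduced f e r"
proof -
  obtain A r where A: "F = g * A + r" "Polynomial.degree r < e"
    using monic_division[OF g(1)] g by blast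
  \<comment> \<open>Vanishing coefficients have to stay zero, since otherwise the reduction modulo
    \<open>h\<close> could raise the degree in \<open>Y\<close> again.\<close>
  have "\<exists>B r'. r = [:h:] * B + r' \<and> (\<forall>j. poly.coeff r j = 0 \<longrightarrow> poly.coeff r' j = 0)
      \<and> (\<forall>j. Polynomial.degree (poly.coeff r' j) < f)"
  proof (induction r)
    case 0
    show ?case by (rule exI[of _ 0], rule exI[of _ 0]) (simp add: h)
  next
    case (pCons a r)
    then obtain B r' where B: "r = [:h:] * B + r'" "\<And>j. poly.coeff r j = 0 \<Longrightarrow> poly.coeff r' j = 0"
      "\<And>j. Polynomial.degree (poly.coeff r' j) < f" by blast
    obtain b c where b: "a = h * b + c" "Polynomial.degree c < f" "a = 0 \<Longrightarrow> c = 0"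
    proof (cases "a = 0")
      case True
      thus ?thesis using that[of 0 0] h by simp
    next
      case False
      moreover obtain b c where "a = h * b + c" "Polynomial.degree c < f"
        using monic_division[OF h(1), of a] h(2,3) by auto
      ultimately show ?thesis using that by blast
    qed
    have "pCons a r = [:h:] * pCons b B + pCons c r'"
      unfolding b(1) by (subst B(1)) simp
    moreover have "\<forall>j. poly.coeff (pCons a r) j = 0 \<longrightarrow> poly.coeff (pCons c r') j = 0"
      using B(2) b(3) by (auto simp: coeff_pCons split: nat.splits)
    moreover have "\<forall>j. Polynomial.degree (poly.coeff (pCons c r') j) < f"
      using B(3) b(2) by (auto simp: coeff_pCons split: nat.splits)
    ultimately show ?case by blast
  qed
  then obtain B r' where r': "r = [:h:] * B + r'" "\<forall>j. poly.coeff r j = 0 \<longrightarrow> poly.coeff r' j = 0"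
      "\<forall>j. Polynomial.degree (poly.coeff r' j) < f" by blast
  have "Polynomial.degree r' \<le> Polynomial.degree r"
    using r'(2) by (intro degree_le) (simp add: coeff_eq_0)
  thus ?thesis using r' using A unfolding reduced_def by (intro exI[of _ A] exI[of _ B] exI[of _ r']) auto
qed

text \<open>The coefficient map is a parameter because integer polynomials, for the order, and
  rational ones, for the field, are evaluated at the same point.\<close>

definition eval2 :: "('c :: comm_ring_1 \<Rightarrow> complex) \<Rightarrow> complex \<Rightarrow> complex \<Rightarrow> 'c poly poly \<Rightarrow> complex" where
  "eval2 \<iota> x y F = poly (map_poly (\<lambda>q. poly (map_poly \<iota> q) x) F) y"

lemma eval2_hom:
  assumes "comm_ring_hom \<iota>"
  shows "comm_ring_hom (eval2 \<iota> x y)"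
proof -
  interpret comm_ring_hom \<iota> by fact
  interpret a: map_poly_comm_ring_hom \<iota> ..
  define e where "e = (\<lambda>q. poly (map_poly \<iota> q) x)"
  interpret e: comm_ring_hom e
    by unfold_locales (auto simp: e_def a.hom_add a.hom_mult)
  interpret b: map_poly_comm_ring_hom e ..
  show ?thesis
    unfolding eval2_def e_def[symmetric] by unfold_locales (auto simp: b.hom_add b.hom_mult)
qed

lemma eval2_pCons:
  assumes "comm_ring_hom \<iota>"
  shows "eval2 \<iota> x y (pCons a F) = poly (map_poly \<iota> a) x + y * eval2 \<iota> x y F"
proof -
  interpret comm_ring_hom \<iota> by fact
  show ?thesis by (simp add: eval2_def Polynomial.map_poly_pCons)
qed

lemma eval2_0: "eval2 \<iota> x y 0 = 0"
  by (simp add: eval2_def)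

section \<open>The ideal (p, h) of Z[X]\<close>

definition ph_ideal :: "nat \<Rightarrow> int poly \<Rightarrow> int poly set" where
  "ph_ideal p h = {Polynomial.smult (int p) s + h * t | s t. True}"

text \<open>Gauss's lemma: a monic \<open>h\<close> has content 1 and contents multiply, so
  \<open>c\<close> divides the content of \<open>t\<close>.\<close>

lemma smult_eq_monic_multD:
  fixes h t s :: "int poly"
  assumes h: "Polynomial.lead_coeff h = 1" and eq: "Polynomial.smult c s = h * t"
  shows "\<exists>t'. t = Polynomial.smult c t'"
proof -
  have "content h dvd 1" using h content_dvd_coeff[of h "Polynomial.degree h"] by simp
  hence "content h = 1" by (metis content_1 content_dvd_contentI is_unit_normalize normalize_content one_dvd)
  hence "content (h * t) = content t" by (simp add: content_mult)
  moreover have "[:c:] dvd h * t" unfolding eq[symmetric] by (intro dvdI[of _ _ s]) simp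
  ultimately have "[:c:] dvd t" by (simp add: const_poly_dvd_iff_dvd_content)
  then obtain t' where "t = [:c:] * t'" by (rule dvdE)
  thus ?thesis by (intro exI[of _ t']) simp
qed

text \<open>Once \<open>s\<close> is replaced by its remainder modulo \<open>h\<close>, what is left
  over is a multiple of the monic \<open>h\<close> of smaller degree than \<open>h\<close>, hence
  zero.\<close>

lemma ph_ideal_small_degree:
  assumes h: "Polynomial.lead_coeff h = 1" "Polynomial.degree h > 0"
    and q: "q \<in> ph_ideal p h" "Polynomial.degree q < Polynomial.degree h"
  shows "\<exists>s. q = Polynomial.smult (int p) s"
proof -
  obtain s t where st: "q = Polynomial.smult (int p) s + h * t"
    using q(1) unfolding ph_ideal_def by blast
  obtain A r where r: "s = h * A + r" "Polynomial.degree r < Polynomial.degree h"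
    using monic_division[OF h] by blast
  have eq: "q - Polynomial.smult (int p) r = h * (Polynomial.smult (int p) A + t)"
    unfolding st r(1) by (simp add: algebra_simps smult_add_right)
  have "Polynomial.degree (q - Polynomial.smult (int p) r) < Polynomial.degree h"
    using q(2) r(2) by (meson degree_diff_less degree_smult_le le_less_trans)
  hence "Polynomial.smult (int p) A + t = 0"
    unfolding eq using h by (metis degree_mult_right_le leD mult_eq_0_iff)
  thus ?thesis using eq by auto
qed

lemma power_add_diff_multiple:
  fixes a b :: "'a :: comm_ring_1"
  shows "(a + b) ^ n - b ^ n = a * (\<Sum>i<n. (a + b) ^ i * b ^ (n - Suc i))"
  using power_diff_sumr2[of "a + b" n b] by (simp add: mult.commute)

lemma one_plus_mult_geometric:
  fixes t :: "'a :: comm_ring_1"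
  shows "(1 + t) * (\<Sum>i<n. (- t) ^ i) = 1 - (- t) ^ n"
  using one_diff_power_eq[of "- t" n] by simp

text \<open>The integers are integrally closed in the rationals. Through \<open>B_p_dvd\<close> this
  keeps \<open>p\<close> from becoming a unit in the order.\<close>

lemma algebraic_int_ratio:
  assumes "algebraic_int (of_int a / of_nat b :: complex)" "b > 0"
  shows "int b dvd a"
proof -
  have "of_int a / of_nat b = (of_rat (of_int a / of_nat b) :: complex)" by (simp add: of_rat_divide)
  hence "of_int a / of_nat b \<in> (\<rat> :: complex set)" by (metis Rats_of_rat)
  then obtain c where "of_int a / of_nat b = (of_int c :: complex)"
    using rational_algebraic_int_is_int[OF assms(1)] by (auto elim: Ints_cases)
  hence "(of_int a :: complex) = of_int (c * int b)" using assms(2) by (simp add: field_simps)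
  hence "a = c * int b" by (simp only: of_int_eq_iff)
  thus ?thesis by simp
qed

text \<open>
  \<open>B = \<int>[x, y]\<close> with maximal ideal \<open>P = (p, y)\<close>, \<open>S\<close> its complement and \<open>D\<close> the localization
  of \<open>B\<close> at \<open>P\<close>.
\<close>

locale eis_data =
  fixes p :: nat and h :: "int poly" and U :: "int poly poly" and e :: nat and x y :: complex
  assumes p: "p > 1"
    and h: "Polynomial.lead_coeff h = 1"
    and ph1: "1 \<notin> ph_ideal p h"
    and ph2: "\<And>q. q \<notin> ph_ideal p h \<Longrightarrow> \<exists>r. q * r - 1 \<in> ph_ideal p h"
    and e: "e > 0" and U: "Polynomial.degree U < e" "poly.coeff U 0 \<notin> ph_ideal p h"
    and x: "poly (of_int_poly h) x = 0"
    and y: "y ^ e = of_nat p * eval2 of_int x y U"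
begin

abbreviation ev :: "int poly poly \<Rightarrow> complex" where "ev \<equiv> eval2 of_int x y"
abbreviation evq :: "rat poly poly \<Rightarrow> complex" where "evq \<equiv> eval2 of_rat x y"
abbreviation pc :: complex where "pc \<equiv> of_nat p"

sublocale ev: comm_ring_hom ev by (rule eval2_hom) unfold_locales
sublocale evq: comm_ring_hom evq by (rule eval2_hom) unfold_locales

lemma ev_pCons: "ev (pCons a F) = poly (of_int_poly a) x + y * ev F"
  by (rule eval2_pCons) unfold_locales

lemma evq_pCons: "evq (pCons a F) = poly (map_poly of_rat a) x + y * evq F"
  by (rule eval2_pCons) unfold_locales

lemma ev_const: "ev [:a:] = poly (of_int_poly a) x"
  by (simp add: ev_pCons)

lemma evq_const: "evq [:a:] = poly (map_poly of_rat a) x"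
  by (simp add: evq_pCons)

lemma ev_of_int: "ev [:[:c:]:] = of_int c"
  by (simp add: ev_const of_int_hom.map_poly_pCons_hom)

lemma ev_monom: "ev (Polynomial.monom 1 n) = y ^ n"
proof (induction n)
  case 0
  show ?case using ev.hom_one by simp
qed (simp add: monom_Suc ev_pCons)

definition B :: "complex set" where "B = range ev"

lemma B_ev: "ev F \<in> B" unfolding B_def by simp
lemma B_add: "a \<in> B \<Longrightarrow> b \<in> B \<Longrightarrow> a + b \<in> B"
  unfolding B_def by (auto simp flip: ev.hom_add)
lemma B_mult: "a \<in> B \<Longrightarrow> b \<in> B \<Longrightarrow> a * b \<in> B"
  unfolding B_def by (auto simp flip: ev.hom_mult)
lemma B_int: "of_int c \<in> B" using B_ev[of "[:[:c:]:]"] by (simp only: ev_of_int)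
lemma B_nat: "of_nat c \<in> B" using B_int[of "int c"] by simp
lemma B_0: "0 \<in> B" and B_1: "1 \<in> B" using B_int[of 0] B_int[of 1] by simp_all
lemma B_uminus: "a \<in> B \<Longrightarrow> - a \<in> B" using B_mult[OF B_int[of "-1"]] by simp
lemma B_diff: "a \<in> B \<Longrightarrow> b \<in> B \<Longrightarrow> a - b \<in> B" using B_add[of a "- b"] B_uminus[of b] by simp
lemma B_power: "a \<in> B \<Longrightarrow> a ^ n \<in> B" by (induction n) (auto intro: B_1 B_mult)
lemma B_sum: "(\<And>i. i \<in> I \<Longrightarrow> a i \<in> B) \<Longrightarrow> sum a I \<in> B"
  by (induction I rule: infinite_finite_induct) (auto intro: B_0 B_add)
lemma B_y: "y \<in> B" using B_ev[of "Polynomial.monom 1 1"] ev_monom by simp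
lemma B_x: "poly (of_int_poly q) x \<in> B" using B_ev[of "[:q:]"] by (simp only: ev_const)

lemmas B_intros = B_add B_mult B_int B_nat B_0 B_1 B_uminus B_diff B_power B_sum B_y B_x B_ev

definition P :: "complex set" where "P = {pc * a + y * b | a b. a \<in> B \<and> b \<in> B}"
definition S :: "complex set" where "S = B - P"

lemma P_I: "a \<in> B \<Longrightarrow> b \<in> B \<Longrightarrow> pc * a + y * b \<in> P" unfolding P_def by blast
lemma P_p: "a \<in> B \<Longrightarrow> pc * a \<in> P" using P_I[OF _ B_0] by simp
lemma P_y: "b \<in> B \<Longrightarrow> y * b \<in> P" using P_I[OF B_0] by simp
lemma P_B: "a \<in> P \<Longrightarrow> a \<in> B" unfolding P_def by (auto intro: B_intros)
lemma P_0: "0 \<in> P" using P_p[OF B_0] by simp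
lemma P_mult: "c \<in> B \<Longrightarrow> a \<in> P \<Longrightarrow> c * a \<in> P"
proof -
  assume c: "c \<in> B" and "a \<in> P"
  then obtain a1 b1 where ab: "a = pc * a1 + y * b1" "a1 \<in> B" "b1 \<in> B" unfolding P_def by auto
  have "c * a = pc * (c * a1) + y * (c * b1)" unfolding ab by (simp add: algebra_simps)
  thus "c * a \<in> P" using P_I[of "c * a1" "c * b1"] ab c by (auto intro: B_intros)
qed
lemma P_add: "a \<in> P \<Longrightarrow> b \<in> P \<Longrightarrow> a + b \<in> P"
proof -
  assume "a \<in> P" "b \<in> P"
  then obtain a1 b1 a2 b2 where ab: "a = pc * a1 + y * b1" "a1 \<in> B" "b1 \<in> B"
    "b = pc * a2 + y * b2" "a2 \<in> B" "b2 \<in> B" unfolding P_def by auto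
  have "a + b = pc * (a1 + a2) + y * (b1 + b2)" unfolding ab by (simp add: algebra_simps)
  thus "a + b \<in> P" using P_I[of "a1 + a2" "b1 + b2"] ab by (auto intro: B_intros)
qed
lemma P_uminus: "a \<in> P \<Longrightarrow> - a \<in> P" using P_mult[OF B_int[of "-1"]] by simp
lemma P_diff: "a \<in> P \<Longrightarrow> b \<in> P \<Longrightarrow> a - b \<in> P" using P_add[of a "- b"] P_uminus[of b] by simp

lemma h_degree: "Polynomial.degree h > 0"
proof (rule ccontr)
  assume "\<not> Polynomial.degree h > 0"
  hence "h = 1" using h by (metis degree_eq_zeroE gr0I lead_coeff_pCons(2) one_pCons)
  hence "1 = Polynomial.smult (int p) 0 + h * 1" by simp
  thus False using ph1 unfolding ph_ideal_def by blast
qed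

lemma ph_in_P: "q \<in> ph_ideal p h \<Longrightarrow> poly (of_int_poly q) x \<in> P"
proof -
  assume "q \<in> ph_ideal p h"
  then obtain s t where "q = Polynomial.smult (int p) s + h * t" unfolding ph_ideal_def by blast
  hence "poly (of_int_poly q) x = pc * poly (of_int_poly s) x"
    using x by (simp add: hom_distribs)
  thus ?thesis using P_p B_x by simp
qed

lemma B_split:
  assumes "a \<in> B"
  obtains q b where "a = poly (of_int_poly q) x + y * b" "b \<in> B"
proof -
  obtain F where "a = ev F" using assms unfolding B_def by blast
  moreover obtain q G where "F = pCons q G" by (metis pCons_cases)
  ultimately show ?thesis using that[of q "ev G"] ev_pCons B_ev by simp
qed

text \<open>Modulo \<open>y\<close> an element of the order is the value at \<open>x\<close> of some
  \<open>q\<close> in Z[X]. If the element is outside \<open>P\<close>, then \<open>q\<close> is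
  outside (p, h), and an inverse of \<open>q\<close> modulo (p, h) inverts the element modulo
  \<open>P\<close>.\<close>

lemma S_inverse_mod_P:
  assumes "s \<in> S"
  shows "\<exists>t\<in>B. s * t - 1 \<in> P"
proof -
  obtain q b where qb: "s = poly (of_int_poly q) x + y * b" "b \<in> B"
    using B_split[of s] assms unfolding S_def by auto
  have "q \<notin> ph_ideal p h"
    using ph_in_P P_add P_y[OF qb(2)] assms qb(1) unfolding S_def by blast
  then obtain r where "q * r - 1 \<in> ph_ideal p h" using ph2 by blast
  from ph_in_P[OF this] have "poly (of_int_poly q) x * poly (of_int_poly r) x - 1 \<in> P"
    by (simp add: of_int_poly_hom.hom_minus of_int_poly_hom.hom_mult)
  moreover have "y * (b * poly (of_int_poly r) x) \<in> P" using qb by (intro P_y B_intros)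
  ultimately have "(poly (of_int_poly q) x * poly (of_int_poly r) x - 1) + y * (b * poly (of_int_poly r) x) \<in> P"
    by (rule P_add)
  hence "s * poly (of_int_poly r) x - 1 \<in> P" unfolding qb by (simp add: algebra_simps)
  thus ?thesis using B_x by blast
qed

text \<open>The \<open>e\<close>-th power of \<open>p a + y b\<close> differs from that of
  \<open>y b\<close> by a multiple of \<open>p\<close>, and \<open>y ^ e\<close> is itself a
  multiple of \<open>p\<close>.\<close>

lemma P_power_e:
  assumes "t \<in> P"
  shows "\<exists>z\<in>B. t ^ e = pc * z"
proof -
  obtain a b where ab: "t = pc * a + y * b" "a \<in> B" "b \<in> B" using assms unfolding P_def by auto
  define z where "z = a * (\<Sum>i<e. (pc * a + y * b) ^ i * (y * b) ^ (e - Suc i)) + ev U * b ^ e"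
  have "t ^ e = pc * a * (\<Sum>i<e. (pc * a + y * b) ^ i * (y * b) ^ (e - Suc i)) + (y * b) ^ e"
    using power_add_diff_multiple[of "pc * a" "y * b" e] ab by (simp add: algebra_simps)
  also have "(y * b) ^ e = pc * ev U * b ^ e" using y by (simp add: power_mult_distrib)
  finally have "t ^ e = pc * z" by (simp add: z_def algebra_simps)
  moreover have "z \<in> B" unfolding z_def using ab by (intro B_intros)
  ultimately show ?thesis by blast
qed

text \<open>A geometric series with \<open>e\<close> terms improves an inverse modulo
  \<open>P\<close> to one modulo \<open>p\<close>, because \<open>\<tau> ^ e\<close> is a multiple
  of \<open>p\<close>. A congruence modulo \<open>p\<close> can be used in every ideal that contains
  \<open>p\<close>, in particular in an unknown prime over \<open>p\<close>.\<close>

lemma S_inverse_mod_p: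
  assumes "s \<in> S"
  shows "\<exists>v\<in>B. \<exists>z\<in>B. s * v = 1 + pc * z"
proof -
  obtain t where t: "t \<in> B" "s * t - 1 \<in> P" using S_inverse_mod_P assms by blast
  define \<tau> where "\<tau> = s * t - 1"
  obtain z where z: "z \<in> B" "(- \<tau>) ^ e = pc * z" using P_power_e P_uminus t(2) unfolding \<tau>_def by blast
  have "s * (t * (\<Sum>i<e. (- \<tau>) ^ i)) = (1 + \<tau>) * (\<Sum>i<e. (- \<tau>) ^ i)"
    unfolding \<tau>_def by (simp add: algebra_simps)
  also have "\<dots> = 1 + pc * (- z)" using one_plus_mult_geometric[of \<tau> e] z by simp
  finally have "s * (t * (\<Sum>i<e. (- \<tau>) ^ i)) = 1 + pc * (- z)" .
  moreover have "\<tau> \<in> B" using t(2) P_B \<tau>_def by simp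
  ultimately show ?thesis using t z
    by (intro bexI[of _ "t * (\<Sum>i<e. (- \<tau>) ^ i)"] bexI[of _ "- z"]) (auto intro!: B_intros)
qed

end

section \<open>The Eisenstein polynomial, and clearing denominators of rational polynomials\<close>

definition eis_poly :: "nat \<Rightarrow> nat \<Rightarrow> int poly poly \<Rightarrow> int poly poly" where
  "eis_poly p e U = Polynomial.monom 1 e - [:[:int p:]:] * U"

lemma eis_poly_monic:
  assumes "Polynomial.degree U < e"
  shows "Polynomial.degree (eis_poly p e U) = e" "Polynomial.lead_coeff (eis_poly p e U) = 1"
proof -
  have *: "poly.coeff (eis_poly p e U) e = 1"
    using assms by (simp add: eis_poly_def coeff_eq_0)
  show deg: "Polynomial.degree (eis_poly p e U) = e"
  proof (rule antisym)
    show "e \<le> Polynomial.degree (eis_poly p e U)" using * by (intro le_degree) simp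
    show "Polynomial.degree (eis_poly p e U) \<le> e"
      unfolding eis_poly_def using assms degree_smult_le[of "[:int p:]" U]
      by (intro degree_diff_le degree_monom_le) simp
  qed
  show "Polynomial.lead_coeff (eis_poly p e U) = 1" using * deg by simp
qed

lemma rat_poly_denominator:
  "\<exists>N>0. \<exists>q. Polynomial.smult (of_int N) F = map_poly rat_of_int q"
proof (induction F)
  case 0
  show ?case by (intro exI[of _ 1] conjI exI[of _ 0]) simp_all
next
  case (pCons a F)
  then obtain N q where N: "N > 0" "Polynomial.smult (of_int N) F = map_poly rat_of_int q" by blast
  obtain c d where cd: "a = of_int c / of_int d" "d > 0"
    by (metis quotient_of_div quotient_of_denom_pos surj_pair)
  have "Polynomial.smult (of_int (d * N)) (pCons a F)
      = pCons (of_int (N * c)) (Polynomial.smult (of_int d) (Polynomial.smult (of_int N) F))"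
    using cd by simp
  also have "\<dots> = map_poly rat_of_int (pCons (N * c) (Polynomial.smult d q))"
    unfolding N(2) by (simp add: of_int_hom.map_poly_pCons_hom hom_distribs)
  finally show ?case using N(1) cd(2) by (metis mult_pos_pos)
qed

lemma rat_poly_poly_denominator:
  "\<exists>N>0. \<exists>G. [:[:of_int N:]:] * F = map_poly (map_poly rat_of_int) G"
proof (induction F)
  case 0
  show ?case by (intro exI[of _ 1] conjI exI[of _ 0]) simp_all
next
  case (pCons a F)
  then obtain N G where N: "N > 0" "[:[:of_int N:]:] * F = map_poly (map_poly rat_of_int) G" by blast
  obtain d q where d: "d > 0" "Polynomial.smult (of_int d) a = map_poly rat_of_int q"
    using rat_poly_denominator by blast
  have "[:[:of_int (d * N):]:] * pCons a F
      = pCons (Polynomial.smult (of_int N) (Polynomial.smult (of_int d) a))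
          ([:[:of_int d:]:] * ([:[:of_int N:]:] * F))"
    by (simp add: mult.commute)
  also have "\<dots> = map_poly (map_poly rat_of_int) (pCons (Polynomial.smult N q) ([:[:d:]:] * G))"
    unfolding N(2) d(2) by (simp add: Polynomial.map_poly_pCons hom_distribs)
  finally show ?case using N(1) d(1) by (metis mult_pos_pos)
qed

context eis_data
begin

lemma ev_eis_poly: "ev (eis_poly p e U) = 0"
  unfolding eis_poly_def ev.hom_minus ev.hom_mult ev_monom ev_of_int using y by simp

lemma ev_monom': "ev (Polynomial.monom a n) = poly (of_int_poly a) x * y ^ n"
proof -
  have "Polynomial.monom a n = [:a:] * Polynomial.monom 1 n" by (simp add: smult_monom)
  thus ?thesis by (simp only: ev.hom_mult ev_monom ev_const)
qed

lemma ev_int_poly_poly: "evq (map_poly (map_poly of_int) G) = ev G"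
proof (induction G)
  case 0
  show ?case by (simp add: eval2_0)
next
  case (pCons a G)
  have "poly (map_poly of_rat (map_poly rat_of_int a)) x = poly (of_int_poly a) x"
    by (simp add: map_poly_map_poly o_def)
  thus ?case using pCons by (simp add: Polynomial.map_poly_pCons evq_pCons ev_pCons)
qed

section \<open>The order as a finitely generated group of algebraic integers\<close>

definition basis :: "complex set" where
  "basis = (\<lambda>(i, j). x ^ i * y ^ j) ` ({..<Polynomial.degree h} \<times> {..<e})"

lemma basis_finite: "finite basis" by (simp add: basis_def)
lemma basis_one: "1 \<in> basis" using h_degree e by (force simp: basis_def)
lemma basis_B: "m \<in> basis \<Longrightarrow> m \<in> B"
proof -
  assume "m \<in> basis"
  then obtain i j where "m = x ^ i * y ^ j" by (auto simp: basis_def)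
  moreover have "x \<in> B" using B_x[of "[:0, 1:]"] by (simp add: of_int_hom.map_poly_pCons_hom)
  ultimately show "m \<in> B" by (auto intro: B_intros)
qed

lemma ev_reduced_in_span:
  assumes "reduced (Polynomial.degree h) e r"
  shows "ev r \<in> zspan basis"
proof -
  have 1: "poly (of_int_poly q) x * y ^ j \<in> zspan basis"
    if q: "Polynomial.degree q < Polynomial.degree h" and j: "j < e" for q j
  proof -
    have "poly (of_int_poly q) x * y ^ j = (\<Sum>i\<le>Polynomial.degree q. of_int (poly.coeff q i) * (x ^ i * y ^ j))"
      by (simp add: poly_altdef sum_distrib_left sum_distrib_right algebra_simps)
    also have "\<dots> \<in> zspan basis"
      using q j by (intro zspan_sum zspan_base basis_finite) (auto simp: basis_def)
    finally show ?thesis .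
  qed
  have "ev r = ev (\<Sum>j\<le>Polynomial.degree r. Polynomial.monom (poly.coeff r j) j)"
    by (simp add: poly_as_sum_of_monoms)
  also have "\<dots> = (\<Sum>j\<le>Polynomial.degree r. of_int 1 * (poly (of_int_poly (poly.coeff r j)) x * y ^ j))"
    unfolding ev.hom_sum ev_monom' by simp
  also have "\<dots> \<in> zspan basis"
    using assms unfolding reduced_def by (intro zspan_sum 1) auto
  finally show ?thesis .
qed

lemma B_in_span: "a \<in> B \<Longrightarrow> a \<in> zspan basis"
proof -
  assume "a \<in> B"
  then obtain F where F: "a = ev F" by (auto simp: B_def)
  obtain A C r where r: "F = eis_poly p e U * A + [:h:] * C + r" "reduced (Polynomial.degree h) e r"
    using reduced_division[OF eis_poly_monic(2,1)[OF U(1)] e h refl h_degree] by blast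
  have "a = ev r" unfolding F r(1) ev.hom_add ev.hom_mult ev_const ev_eis_poly x by simp
  thus ?thesis using ev_reduced_in_span r(2) by simp
qed

lemma B_algebraic_int: "a \<in> B \<Longrightarrow> algebraic_int a"
  using algebraic_int_if_zspan_stable[OF basis_finite basis_one, of a] B_in_span B_mult basis_B by simp

text \<open>The quotient of \<open>N\<close> by \<open>p ^ n\<close> is a rational number in
  \<open>B\<close>, hence an algebraic integer, hence an integer.\<close>

lemma B_p_dvd: "of_int N = pc ^ n * c \<Longrightarrow> c \<in> B \<Longrightarrow> int (p ^ n) dvd N"
proof -
  assume "of_int N = pc ^ n * c" "c \<in> B"
  moreover have "pc ^ n \<noteq> 0" using p by simp
  ultimately have "c = of_int N / of_nat (p ^ n)" by (simp add: field_simps)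
  thus "int (p ^ n) dvd N" using algebraic_int_ratio[of N "p ^ n"] B_algebraic_int[OF \<open>c \<in> B\<close>] p by simp
qed

text \<open>By \<open>P_power_e\<close>, \<open>1 = 1 ^ e\<close> would be a multiple of
  \<open>p\<close> in \<open>B\<close>.\<close>

lemma one_notin_P: "1 \<notin> P"
proof
  assume "1 \<in> P"
  then obtain z where z: "z \<in> B" "1 = pc * z" using P_power_e by force
  have "int (p ^ 1) dvd 1" by (rule B_p_dvd[of _ _ z]) (use z in auto)
  thus False using p by simp
qed

lemma one_S: "1 \<in> S" using one_notin_P B_1 unfolding S_def by simp

lemma S_B: "s \<in> S \<Longrightarrow> s \<in> B" unfolding S_def by simp

text \<open>\<open>P\<close> is maximal, hence prime: if \<open>s v\<close> is 1 modulo
  \<open>P\<close>, then \<open>t = v (s t) - t (s v - 1)\<close> lies in \<open>P\<close> as soon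
  as \<open>s t\<close> does.\<close>

lemma S_mult: "s \<in> S \<Longrightarrow> t \<in> S \<Longrightarrow> s * t \<in> S"
proof -
  assume s: "s \<in> S" and t: "t \<in> S"
  obtain v where v: "v \<in> B" "s * v - 1 \<in> P" using S_inverse_mod_P s by blast
  have "t \<in> P" if "s * t \<in> P"
  proof -
    have "v * (s * t) - t * (s * v - 1) \<in> P"
      by (rule P_diff[OF P_mult[OF v(1) that] P_mult[OF S_B[OF t] v(2)]])
    thus ?thesis by (simp add: algebra_simps)
  qed
  thus "s * t \<in> S" using s t unfolding S_def by (auto intro: B_mult)
qed

lemma S_nonzero: "s \<in> S \<Longrightarrow> s \<noteq> 0" using P_0 unfolding S_def by auto

lemma S_power: "s \<in> S \<Longrightarrow> s ^ n \<in> S" by (induction n) (auto intro: one_S S_mult)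

lemma one_plus_p_S: "z \<in> B \<Longrightarrow> 1 + pc * z \<in> S"
  using P_diff[of "1 + pc * z" "pc * z"] P_p[of z] one_notin_P unfolding S_def by (auto intro: B_intros)

lemma coprime_S: "q \<notin> ph_ideal p h \<Longrightarrow> poly (of_int_poly q) x \<in> S"
proof -
  assume "q \<notin> ph_ideal p h"
  then obtain r where "q * r - 1 \<in> ph_ideal p h" using ph2 by blast
  from ph_in_P[OF this] have r: "poly (of_int_poly q) x * poly (of_int_poly r) x - 1 \<in> P"
    by (simp add: hom_distribs)
  have "1 \<in> P" if "poly (of_int_poly q) x \<in> P"
    using P_diff[OF P_mult[OF B_x[of r] that] r] by (simp add: algebra_simps)
  thus ?thesis using one_notin_P B_x unfolding S_def by auto
qed

lemma S_add_yB: "s \<in> S \<Longrightarrow> b \<in> B \<Longrightarrow> s + y * b \<in> S"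
  using P_diff[OF _ P_y, of "s + y * b" b] unfolding S_def by (auto intro: B_intros)

lemma ev_U_S: "ev U \<in> S"
proof -
  obtain q V where V: "U = pCons q V" by (metis pCons_cases)
  hence "q \<notin> ph_ideal p h" using U by simp
  thus ?thesis unfolding V ev_pCons by (intro S_add_yB coprime_S B_ev)
qed

lemma y_nonzero: "y \<noteq> 0"
  using y S_nonzero[OF ev_U_S] e p by (auto simp: power_0_left)

lemma poly_B: "a \<in> B \<Longrightarrow> poly (of_int_poly q) a \<in> B"
  by (induction q) (auto simp: of_int_hom.map_poly_pCons_hom intro: B_intros)

text \<open>A nonzero integer polynomial of least degree with root \<open>a\<close> has a nonzero
  constant coefficient \<open>N\<close>, and \<open>a\<close> divides \<open>N\<close> in
  \<open>B\<close>; then every power of \<open>p\<close> would divide \<open>N\<close>. This stands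
  in for Krull's intersection theorem.\<close>

lemma B_infinitely_divisible:
  assumes a: "a \<in> B" and div: "\<And>n. \<exists>c\<in>B. a = pc ^ n * c"
  shows "a = 0"
proof (rule ccontr)
  assume "a \<noteq> 0"
  obtain q0 :: "int poly" where "Polynomial.lead_coeff q0 = 1" "poly (of_int_poly q0) a = 0"
    using B_algebraic_int[OF a] algebraic_int_iff_monic_root by blast
  hence "q0 \<noteq> 0 \<and> poly (of_int_poly q0) a = 0" by auto
  from ex_has_least_nat[of "\<lambda>q. q \<noteq> 0 \<and> poly (of_int_poly q) a = 0", OF this, of Polynomial.degree]
  obtain q :: "int poly" where q: "q \<noteq> 0" "poly (of_int_poly q) a = 0"
    and min: "\<And>q'. q' \<noteq> 0 \<Longrightarrow> poly (of_int_poly q') a = 0 \<Longrightarrow> Polynomial.degree q \<le> Polynomial.degree q'"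
    by blast
  obtain N q' where qq': "q = pCons N q'" by (metis pCons_cases)
  have eq: "of_int N = - (a * poly (of_int_poly q') a)"
    using q(2) unfolding qq' by (simp add: of_int_hom.map_poly_pCons_hom add_eq_0_iff2)
  have "N \<noteq> 0"
  proof
    assume "N = 0"
    hence "q' \<noteq> 0" "poly (of_int_poly q') a = 0" using q(1) eq \<open>a \<noteq> 0\<close> qq' by auto
    from min[OF this] show False using \<open>q' \<noteq> 0\<close> qq' by simp
  qed
  have dvd: "int (p ^ n) dvd N" for n
  proof -
    obtain c where c: "c \<in> B" "a = pc ^ n * c" using div by blast
    show ?thesis
    proof (rule B_p_dvd)
      show "of_int N = pc ^ n * - (c * poly (of_int_poly q') a)" unfolding eq by (simp add: c(2)[symmetric] mult.assoc[symmetric])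
    qed (use c a in \<open>auto intro!: B_intros poly_B\<close>)
  qed
  have "int (p ^ nat \<bar>N\<bar>) \<le> \<bar>N\<bar>" using dvd[of "nat \<bar>N\<bar>"] \<open>N \<noteq> 0\<close>
    by (metis abs_of_nat dvd_imp_le_int)
  moreover have "nat \<bar>N\<bar> < p ^ nat \<bar>N\<bar>" using p by (intro power_gt_expt) simp
  ultimately show False by linarith
qed

text \<open>Multiplying \<open>y ^ e = p U(x, y)\<close> by an inverse \<open>w\<close> of
  \<open>U(x, y)\<close> modulo \<open>p\<close> turns the relation around: up to the factor
  \<open>s0 = 1 + p z\<close> from \<open>S\<close>, \<open>p\<close> is a multiple of
  \<open>y ^ e\<close>.\<close>

lemma p_factor: obtains s0 w where "s0 \<in> S" "w \<in> B" "pc * s0 = y ^ e * w"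
proof -
  obtain w z where wz: "w \<in> B" "z \<in> B" "ev U * w = 1 + pc * z" using S_inverse_mod_p[OF ev_U_S] by blast
  have "pc * (1 + pc * z) = y ^ e * w" unfolding y wz(3)[symmetric] by simp
  thus thesis using that[of "1 + pc * z" w] one_plus_p_S wz by blast
qed

text \<open>As long as the cofactor lies in \<open>P\<close>, one more factor \<open>y\<close>
  splits off after multiplication by \<open>s0\<close>. If this never stopped, \<open>a\<close>
  would be divisible by every power of \<open>p\<close>.\<close>

lemma B_decompose:
  assumes a: "a \<in> B" "a \<noteq> 0"
  shows "\<exists>n. \<exists>s\<in>S. \<exists>s'\<in>S. s * a = y ^ n * s'"
proof (rule ccontr)
  assume neg: "\<not> ?thesis"
  obtain s0 w where s0: "s0 \<in> S" "w \<in> B" "pc * s0 = y ^ e * w" using p_factor by blast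
  have step: "\<exists>a'\<in>B. s0 ^ n * a = y ^ n * a'" for n
  proof (induction n)
    case 0
    show ?case using a by auto
  next
    case (Suc n)
    then obtain a' where a': "a' \<in> B" "s0 ^ n * a = y ^ n * a'" by blast
    have "a' \<in> P" using neg a' S_power[OF s0(1), of n] unfolding S_def by auto
    then obtain b c where bc: "a' = pc * b + y * c" "b \<in> B" "c \<in> B" unfolding P_def by blast
    have ye: "y ^ e = y * y ^ (e - 1)" using e by (metis power_eq_if not_gr0)
    have "s0 ^ Suc n * a = y ^ n * (s0 * a')" using a' by simp
    also have "\<dots> = y ^ n * (pc * s0 * b + y * s0 * c)" unfolding bc by (simp add: algebra_simps)
    also have "\<dots> = y ^ Suc n * (y ^ (e - 1) * w * b + s0 * c)"
      unfolding s0(3) ye by (simp add: algebra_simps)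
    finally show ?case using bc s0 S_B by (intro bexI[of _ "y ^ (e - 1) * w * b + s0 * c"]) (auto intro!: B_intros)
  qed
  \<comment> \<open>The power of \<open>s0\<close> is removed modulo \<open>p ^ n\<close>: the sum
    \<open>g\<close> refines its inverse modulo \<open>p\<close> to one modulo \<open>p ^ n\<close>.
    The exponent \<open>e * n\<close> is chosen so that the power of \<open>y\<close> is a multiple
    of \<open>p ^ n\<close>.\<close>
  have "a = 0"
  proof (rule B_infinitely_divisible[OF a(1)])
    fix n
    obtain a' where a': "a' \<in> B" "s0 ^ (e * n) * a = y ^ (e * n) * a'" using step by blast
    have "s0 ^ (e * n) \<in> S" using S_power s0 by blast
    then obtain v z where vz: "v \<in> B" "z \<in> B" "s0 ^ (e * n) * v = 1 + pc * z" using S_inverse_mod_p by blast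
    define g where "g = (\<Sum>i<n. (- (pc * z)) ^ i)"
    have g: "g \<in> B" unfolding g_def using vz by (intro B_intros)
    have "(1 + pc * z) * g = 1 - (- (pc * z)) ^ n" unfolding g_def by (rule one_plus_mult_geometric)
    hence "1 = s0 ^ (e * n) * v * g + (- (pc * z)) ^ n" unfolding vz(3) by simp
    hence "a = (s0 ^ (e * n) * a) * (v * g) + (- (pc * z)) ^ n * a" by (metis (no_types, lifting) distrib_right mult.assoc mult.commute mult_1)
    also have "\<dots> = y ^ (e * n) * (a' * v * g) + (- (pc * z)) ^ n * a"
      unfolding a'(2) by (simp add: algebra_simps)
    also have "y ^ (e * n) = pc ^ n * ev U ^ n" by (simp add: power_mult y power_mult_distrib)
    also have "(- (pc * z)) ^ n = pc ^ n * (- z) ^ n" by (metis mult_minus_right power_mult_distrib)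
    finally have "a = pc ^ n * (ev U ^ n * a' * v * g + (- z) ^ n * a)" by (simp add: algebra_simps)
    thus "\<exists>c\<in>B. a = pc ^ n * c"
      using vz a' g a by (intro bexI[of _ "ev U ^ n * a' * v * g + (- z) ^ n * a"]) (auto intro!: B_intros)
  qed
  thus False using a(2) by simp
qed

section \<open>The localization D, its unit group W, and factorization by powers of y\<close>

definition D :: "complex set" where "D = {l. \<exists>s\<in>S. s * l \<in> B}"
definition W :: "complex set" where "W = {l. \<exists>s\<in>S. \<exists>s'\<in>S. s * l = s'}"

lemma D_I: "s \<in> S \<Longrightarrow> s * l \<in> B \<Longrightarrow> l \<in> D" unfolding D_def by blast
lemma B_D: "b \<in> B \<Longrightarrow> b \<in> D" by (rule D_I[OF one_S]) simp
lemma D_add: "a \<in> D \<Longrightarrow> b \<in> D \<Longrightarrow> a + b \<in> D"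
proof -
  assume "a \<in> D" "b \<in> D"
  then obtain s t where st: "s \<in> S" "s * a \<in> B" "t \<in> S" "t * b \<in> B" unfolding D_def by blast
  have "s * t * (a + b) = t * (s * a) + s * (t * b)" by (simp add: algebra_simps)
  also have "\<dots> \<in> B" by (rule B_add[OF B_mult[OF S_B[OF st(3)] st(2)] B_mult[OF S_B[OF st(1)] st(4)]])
  finally show ?thesis using D_I[OF S_mult] st by blast
qed
lemma D_mult: "a \<in> D \<Longrightarrow> b \<in> D \<Longrightarrow> a * b \<in> D"
proof -
  assume "a \<in> D" "b \<in> D"
  then obtain s t where st: "s \<in> S" "s * a \<in> B" "t \<in> S" "t * b \<in> B" unfolding D_def by blast
  have "s * t * (a * b) = (s * a) * (t * b)" by (simp add: algebra_simps)
  also have "\<dots> \<in> B" using st by (intro B_mult[of "s * a"]) auto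
  finally show ?thesis using D_I[OF S_mult] st by blast
qed
lemma D_uminus: "a \<in> D \<Longrightarrow> - a \<in> D" using D_mult[OF B_D[OF B_int[of "-1"]], of a] by simp
lemma D_power: "a \<in> D \<Longrightarrow> a ^ n \<in> D" by (induction n) (auto intro: D_mult B_D B_1)
lemma D_sum: "(\<And>i. i \<in> I \<Longrightarrow> a i \<in> D) \<Longrightarrow> sum a I \<in> D"
  by (induction I rule: infinite_finite_induct) (auto intro: D_add B_D B_0)

lemma W_D: "w \<in> W \<Longrightarrow> w \<in> D" unfolding W_def D_def using S_B by blast
lemma S_W: "s \<in> S \<Longrightarrow> s \<in> W" unfolding W_def using one_S by force
lemma W_nonzero: "w \<in> W \<Longrightarrow> w \<noteq> 0" unfolding W_def using S_nonzero[of 0] by auto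
lemma W_inverse: "w \<in> W \<Longrightarrow> inverse w \<in> W"
proof -
  assume w: "w \<in> W"
  then obtain s s' where "s \<in> S" "s' \<in> S" "s * w = s'" unfolding W_def by blast
  hence "s' * inverse w = s" using W_nonzero[OF w] by (auto simp: field_simps)
  thus ?thesis using \<open>s \<in> S\<close> \<open>s' \<in> S\<close> unfolding W_def by blast
qed

text \<open>Clearing denominators would put an element of \<open>S\<close> into
  \<open>P\<close>.\<close>

lemma y_mult_notin_W: "d \<in> D \<Longrightarrow> y * d \<notin> W"
proof
  assume "d \<in> D" "y * d \<in> W"
  then obtain s t t' where st: "s \<in> S" "s * d \<in> B" "t \<in> S" "t' \<in> S" "t * (y * d) = t'"
    unfolding D_def W_def by blast
  have "s * t' = y * (t * (s * d))" unfolding st(5)[symmetric] by (simp add: algebra_simps)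
  also have "\<dots> \<in> P" using st S_B by (intro P_y B_mult[of t]) auto
  finally show False using S_mult[OF st(1,4)] unfolding S_def by simp
qed

text \<open>With a common denominator \<open>N\<close>, both \<open>N\<close> and \<open>N l\<close>
  lie in \<open>B\<close>, and their factorizations are compared. The two alternatives stand for
  nonnegative and nonpositive exponents of \<open>y\<close>.\<close>

lemma nonzero_decompose:
  assumes "l \<in> range evq" "l \<noteq> 0"
  shows "\<exists>n. \<exists>w\<in>W. l = y ^ n * w \<or> l * y ^ n = w"
proof -
  obtain F where F: "l = evq F" using assms by blast
  obtain N G where N: "N > 0" "[:[:of_int N:]:] * F = map_poly (map_poly rat_of_int) G"
    using rat_poly_poly_denominator by blast
  have "evq [:[:of_int N:]:] = of_int N"
    using ev_int_poly_poly[of "[:[:N:]:]"] by (simp add: Polynomial.map_poly_pCons ev_of_int)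
  hence Nl: "of_int N * l = ev G"
    using arg_cong[OF N(2), of evq] unfolding evq.hom_mult ev_int_poly_poly F by simp
  have N0: "of_int N \<noteq> (0 :: complex)" using N by simp
  obtain n s s' where s: "s \<in> S" "s' \<in> S" "s * of_int N = y ^ n * s'"
    using B_decompose[OF B_int N0] by blast
  have "ev G \<noteq> 0" unfolding Nl[symmetric] using N0 assms(2) by simp
  then obtain m t t' where t: "t \<in> S" "t' \<in> S" "t * ev G = y ^ m * t'"
    using B_decompose[OF B_ev] by blast
  have "y ^ n * s' * t * l = s * t * (of_int N * l)" using s(3) by (simp add: algebra_simps)
  hence eq: "y ^ n * (s' * t * l) = y ^ m * (s * t')" unfolding Nl using t(3) by (simp add: algebra_simps)
  have st: "s' * t \<in> S" "s * t' \<in> S" using s t S_mult by auto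
  show ?thesis
  proof (cases "n \<le> m")
    case True
    define w where "w = s * t' / (s' * t)"
    have "s' * t * w = s * t'" using S_nonzero[OF st(1)] unfolding w_def by simp
    hence "w \<in> W" using st unfolding W_def by blast
    moreover have "y ^ n * (s' * t * l) = y ^ n * (y ^ (m - n) * (s * t'))"
      unfolding eq using True by (simp add: power_add[symmetric] mult.assoc[symmetric])
    hence "s' * t * l = y ^ (m - n) * (s * t')" using y_nonzero by simp
    hence "l = y ^ (m - n) * w" unfolding w_def using S_nonzero[OF st(1)] by (simp add: field_simps)
    ultimately show ?thesis by blast
  next
    case False
    have "y ^ m * (y ^ (n - m) * (s' * t * l)) = y ^ m * (s * t')"
      unfolding eq[symmetric] using False by (simp add: power_add[symmetric] mult.assoc[symmetric])
    hence "s' * t * (l * y ^ (n - m)) = s * t'" using y_nonzero by (simp add: algebra_simps)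
    hence "l * y ^ (n - m) \<in> W" using st unfolding W_def by blast
    thus ?thesis by blast
  qed
qed

lemma y_D: "y \<in> D" using B_D B_y by simp

lemma D_decompose:
  assumes "l \<in> range evq" "l \<in> D"
  shows "l \<in> W \<or> (\<exists>d\<in>D. l = y * d)"
proof (cases "l = 0")
  case True
  thus ?thesis using B_D[OF B_0] by auto
next
  case False
  then obtain n w where w: "w \<in> W" "l = y ^ n * w \<or> l * y ^ n = w"
    using nonzero_decompose assms(1) by blast
  show ?thesis
  proof (cases n)
    case 0
    thus ?thesis using w by auto
  next
    case (Suc m)
    have "l \<noteq> 0 \<Longrightarrow> y * (l * y ^ m) \<notin> W" using assms(2) y_D by (intro y_mult_notin_W D_mult D_power)
    hence "l = y * (y ^ m * w)" using w Suc False by (auto simp: algebra_simps)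
    thus ?thesis using W_D[OF w(1)] y_D by (blast intro: D_mult D_power)
  qed
qed

text \<open>Valuation rings are integrally closed. If \<open>l = w / y ^ n\<close> with
  \<open>n > 0\<close> and \<open>w\<close> a unit, an integral equation of degree \<open>m\<close>
  multiplied by \<open>y ^ (n m)\<close> exhibits the unit \<open>w ^ m\<close> as \<open>y\<close>
  times an element of \<open>D\<close>.\<close>

lemma algebraic_int_D:
  assumes "l \<in> range evq" "algebraic_int l"
  shows "l \<in> D"
proof (cases "l = 0")
  case True
  thus ?thesis using B_D[OF B_0] by simp
next
  case False
  then obtain n w where w: "w \<in> W" "l = y ^ n * w \<or> l * y ^ n = w"
    using nonzero_decompose assms(1) by blast
  show ?thesis
  proof (cases "l = y ^ n * w \<or> n = 0")
    case True
    thus ?thesis using w W_D y_D by (auto intro: D_mult D_power)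
  next
    case False
    hence lw: "l * y ^ n = w" and n: "n > 0" using w by auto
    obtain m c where m: "m > 0" "l ^ m = (\<Sum>i<m. of_int (c i) * l ^ i)"
      using algebraic_int_power_reduce[OF assms(2)] by metis
    have "w ^ m = l ^ m * (y ^ n) ^ m" unfolding lw[symmetric] by (simp add: power_mult_distrib)
    also have "\<dots> = (\<Sum>i<m. of_int (c i) * (l * y ^ n) ^ i * (y ^ n) ^ (m - i))"
      unfolding m(2) sum_distrib_right
    proof (intro sum.cong refl)
      fix i assume "i \<in> {..<m}"
      hence "(y ^ n) ^ m = (y ^ n) ^ i * (y ^ n) ^ (m - i)" by (simp add: power_add[symmetric])
      thus "of_int (c i) * l ^ i * (y ^ n) ^ m = of_int (c i) * (l * y ^ n) ^ i * (y ^ n) ^ (m - i)"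
        by (simp add: power_mult_distrib)
    qed
    also have "\<dots> = y * (\<Sum>i<m. of_int (c i) * w ^ i * (y ^ (n - 1) * (y ^ n) ^ (m - Suc i)))"
      unfolding sum_distrib_left lw
    proof (intro sum.cong refl)
      fix i assume "i \<in> {..<m}"
      hence "(y ^ n) ^ (m - i) = y ^ n * (y ^ n) ^ (m - Suc i)" by (metis Suc_diff_Suc lessThan_iff power_Suc)
      moreover have "y ^ n = y * y ^ (n - 1)" using n by (metis power_eq_if not_gr0)
      ultimately have "(y ^ n) ^ (m - i) = y * (y ^ (n - 1) * (y ^ n) ^ (m - Suc i))" by (metis mult.assoc)
      thus "of_int (c i) * w ^ i * (y ^ n) ^ (m - i)
          = y * (of_int (c i) * w ^ i * (y ^ (n - 1) * (y ^ n) ^ (m - Suc i)))"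
        by (metis mult.left_commute)
    qed
    finally have "w ^ m = y * (\<Sum>i<m. of_int (c i) * w ^ i * (y ^ (n - 1) * (y ^ n) ^ (m - Suc i)))" .
    moreover have "(\<Sum>i<m. of_int (c i) * w ^ i * (y ^ (n - 1) * (y ^ n) ^ (m - Suc i))) \<in> D"
      using W_D[OF w(1)] y_D by (intro D_sum D_mult D_power B_D[OF B_int]) auto
    moreover have "w ^ k \<in> W" for k
    proof (induction k)
      case (Suc k)
      then obtain s s' t t' where "s \<in> S" "s' \<in> S" "s * w = s'" "t \<in> S" "t' \<in> S" "t * w ^ k = t'"
        using w(1) unfolding W_def by blast
      moreover from this have "s * t * w ^ Suc k = s' * t'" by (auto simp: algebra_simps)
      ultimately show ?case using S_mult unfolding W_def by blast
    qed (use one_S S_W in simp)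
    ultimately show ?thesis using y_mult_notin_W by metis
  qed
qed

lemma P_yD: "a \<in> P \<Longrightarrow> \<exists>d\<in>D. a = y * d"
proof -
  assume "a \<in> P"
  then obtain b c where bc: "a = pc * b + y * c" "b \<in> B" "c \<in> B" unfolding P_def by blast
  obtain s0 w where s0: "s0 \<in> S" "w \<in> B" "pc * s0 = y ^ e * w" using p_factor by blast
  have ye: "y ^ e = y * y ^ (e - 1)" using e by (metis power_eq_if not_gr0)
  define d where "d = (y ^ (e - 1) * w * b + s0 * c) / s0"
  have sd: "s0 * d = y ^ (e - 1) * w * b + s0 * c" using S_nonzero[OF s0(1)] unfolding d_def by simp
  also have "\<dots> \<in> B" using bc s0 S_B by (intro B_intros) auto
  finally have "d \<in> D" using D_I s0(1) by blast
  moreover have "s0 * a = s0 * (y * d)"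
  proof -
    have "s0 * a = (pc * s0) * b + y * (s0 * c)" unfolding bc(1) by (simp add: algebra_simps)
    also have "\<dots> = y * (s0 * d)" unfolding s0(3) ye sd by (simp add: algebra_simps)
    finally show ?thesis by (simp add: algebra_simps)
  qed
  hence "a = y * d" using S_nonzero[OF s0(1)] by simp
  ultimately show ?thesis by blast
qed

text \<open>Describes \<open>S\<close> through divisibility by \<open>y\<close> in \<open>D\<close>,
  the form in which it is carried over to abstract fields.\<close>

lemma S_iff: "b \<in> S \<longleftrightarrow> b \<in> B \<and> \<not> (\<exists>d\<in>D. b = y * d)"
  using P_yD S_W y_mult_notin_W unfolding S_def by blast

text \<open>A unit of \<open>D\<close> is a quotient \<open>s' / s\<close> of elements of
  \<open>S\<close>; the factor \<open>t\<close> is \<open>s\<close> times an inverse of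
  \<open>s'\<close> modulo \<open>p\<close>.\<close>

lemma unit_mod_p:
  assumes "l \<in> range evq" "l \<in> D" "\<not> (\<exists>d\<in>D. l = y * d)"
  shows "\<exists>t\<in>B. \<exists>z\<in>B. l * t = 1 + pc * z"
proof -
  obtain s s' where s: "s \<in> S" "s' \<in> S" "s * l = s'" using D_decompose[OF assms(1,2)] assms(3) unfolding W_def by blast
  obtain v z where vz: "v \<in> B" "z \<in> B" "s' * v = 1 + pc * z" using S_inverse_mod_p[OF s(2)] by blast
  have "l * (s * v) = (s * l) * v" by simp
  also have "\<dots> = 1 + pc * z" using s(3) vz(3) by simp
  finally have "l * (s * v) = 1 + pc * z" .
  thus ?thesis using vz s S_B by (blast intro: B_mult)
qed

text \<open>Let \<open>j\<close> be the least index of a coefficient not divisible by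
  \<open>p\<close>. Being of small degree, that coefficient is outside (p, h), so its term is
  \<open>y ^ j\<close> times an element of \<open>S\<close>. Later terms contain
  \<open>y ^ (j + 1)\<close>, and so do the earlier ones, because \<open>p\<close> is a multiple of
  \<open>y ^ e\<close> up to \<open>s0\<close> and \<open>j < e\<close>. Such a sum is not
  zero.\<close>

lemma reduced_root_divisible:
  assumes r: "reduced (Polynomial.degree h) e F" and 0: "ev F = 0"
  shows "\<exists>G. F = [:[:int p:]:] * G"
proof (rule ccontr)
  assume neg: "\<not> ?thesis"
  have ex: "\<exists>j. \<not> [:int p:] dvd poly.coeff F j"
  proof (rule ccontr)
    assume "\<not> ?thesis"
    hence "[:[:int p:]:] dvd F" by (subst const_poly_dvd_iff) blast
    then obtain G where "F = [:[:int p:]:] * G" by (rule dvdE)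
    thus False using neg by blast
  qed
  define j where "j = (LEAST j. \<not> [:int p:] dvd poly.coeff F j)"
  have j: "\<not> [:int p:] dvd poly.coeff F j" unfolding j_def using ex by (rule LeastI_ex)
  have less: "[:int p:] dvd poly.coeff F i" if "i < j" for i
    using not_less_Least[OF that[unfolded j_def]] by blast
  have "poly.coeff F j \<noteq> 0" using j by auto
  hence je: "j < e" using r le_degree[of F j] unfolding reduced_def by linarith
  have "[:[:int p:]:] dvd poly_cutoff j F"
    by (subst const_poly_dvd_iff) (simp add: coeff_poly_cutoff less)
  then obtain G where G: "poly_cutoff j F = [:[:int p:]:] * G" by (rule dvdE)
  obtain q H where H: "poly_shift j F = pCons q H" by (metis pCons_cases)
  have "q = poly.coeff (poly_shift j F) 0" unfolding H by simp
  hence q: "q = poly.coeff F j" by (simp add: coeff_poly_shift)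
  have "F = poly_cutoff j F + Polynomial.monom 1 j * poly_shift j F"
    by (rule poly_eqI) (simp add: coeff_poly_cutoff coeff_monom_mult coeff_poly_shift)
  hence "ev F = pc * ev G + y ^ j * (poly (of_int_poly q) x + y * ev H)"
    unfolding G H using ev.hom_add ev.hom_mult ev_monom ev_of_int ev_pCons by (metis of_int_of_nat_eq)
  hence eq: "pc * ev G + y ^ j * (poly (of_int_poly q) x + y * ev H) = 0" using 0 by simp
  obtain s0 w where s0: "s0 \<in> S" "w \<in> B" "pc * s0 = y ^ e * w" using p_factor by blast
  have ye: "y ^ e = y ^ j * (y * y ^ (e - Suc j))"
    using je by (metis Suc_leI le_add_diff_inverse mult.assoc power_Suc2 power_add)
  have "y ^ j * (s0 * (poly (of_int_poly q) x + y * ev H) + y * (y ^ (e - Suc j) * w * ev G))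
      = s0 * (pc * ev G + y ^ j * (poly (of_int_poly q) x + y * ev H))"
    using s0(3) unfolding ye by (simp add: algebra_simps)
  also have "\<dots> = 0" using eq by simp
  finally have "s0 * (poly (of_int_poly q) x + y * ev H) + y * (y ^ (e - Suc j) * w * ev G) = 0"
    using y_nonzero by simp
  moreover have "q \<notin> ph_ideal p h"
  proof
    assume "q \<in> ph_ideal p h"
    hence "\<exists>s. q = Polynomial.smult (int p) s"
      using ph_ideal_small_degree[OF h h_degree] r q unfolding reduced_def by blast
    then obtain s where "q = [:int p:] * s" by auto
    thus False using j q by (metis dvd_triv_left)
  qed
  hence "s0 * (poly (of_int_poly q) x + y * ev H) + y * (y ^ (e - Suc j) * w * ev G) \<in> S"
    using s0 by (intro S_add_yB S_mult coprime_S B_intros)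
  ultimately show False using S_nonzero by metis
qed

text \<open>Infinite descent: \<open>p\<close> can be divided out again and again, so every
  coefficient is divisible by all powers of \<open>p\<close>.\<close>

lemma reduced_root_int:
  assumes r: "reduced (Polynomial.degree h) e F" and 0: "ev F = 0"
  shows "F = 0"
proof -
  have step: "\<exists>G. F = [:[:int p ^ n:]:] * G" for n
  proof (induction n)
    case (Suc n)
    then obtain G where G: "F = [:[:int p ^ n:]:] * G" by blast
    have pn: "int p ^ n \<noteq> 0" using p by simp
    have "reduced (Polynomial.degree h) e G"
      using r pn p unfolding reduced_def G by simp
    moreover have "of_int (int p ^ n) * ev G = 0" using 0 unfolding G ev.hom_mult ev_of_int .
    hence "ev G = 0" using p by simp
    ultimately obtain G' where "G = [:[:int p:]:] * G'" using reduced_root_divisible by blast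
    thus ?case unfolding G by (intro exI[of _ G']) (simp add: mult.commute)
  qed (intro exI[of _ F], simp add: pCons_one)
  show ?thesis
  proof (rule poly_eqI, rule poly_eqI)
    fix i j
    define c where "c = poly.coeff (poly.coeff F i) j"
    define n where "n = nat \<bar>c\<bar>"
    obtain G where "F = [:[:int p ^ n:]:] * G" using step by blast
    hence "c = int p ^ n * poly.coeff (poly.coeff G i) j" unfolding c_def by simp
    hence "int (p ^ n) dvd c" by (metis dvd_triv_left of_nat_power)
    moreover have "n < p ^ n" using p by (intro power_gt_expt) simp
    ultimately have "c = 0"
      using dvd_imp_le_int[of c "int (p ^ n)"] unfolding n_def by linarith
    thus "poly.coeff (poly.coeff F i) j = poly.coeff (poly.coeff 0 i) j" unfolding c_def by simp
  qed
qed

text \<open>Clearing denominators reduces this to integer coefficients. It identifies the kernels of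
  the evaluations in \<open>K_ker\<close> and \<open>L_ker\<close>.\<close>

lemma reduced_root_rat:
  assumes r: "reduced (Polynomial.degree h) e F" and 0: "evq F = 0"
  shows "F = 0"
proof -
  obtain N G where N: "N > 0" "[:[:of_int N:]:] * F = map_poly (map_poly rat_of_int) G"
    using rat_poly_poly_denominator by blast
  have "ev G = 0"
    using arg_cong[OF N(2), of evq] 0 unfolding evq.hom_mult ev_int_poly_poly by simp
  moreover have "reduced (Polynomial.degree h) e G"
  proof -
    have "Polynomial.degree G = Polynomial.degree F"
      using arg_cong[OF N(2), of Polynomial.degree] N(1) by (simp add: degree_map_poly)
    moreover have "Polynomial.degree (poly.coeff G i) = Polynomial.degree (poly.coeff F i)" for i
      using arg_cong[OF N(2), of "\<lambda>F. Polynomial.degree (poly.coeff F i)"] N(1)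
      by (simp add: degree_map_poly coeff_map_poly)
    ultimately show ?thesis using r unfolding reduced_def by simp
  qed
  ultimately have "G = 0" by (rule reduced_root_int[rotated])
  thus ?thesis using N by simp
qed

end

section \<open>Homomorphisms from rings that are types\<close>

text \<open>Spelled exactly like \<open>rat_ring\<close> and \<open>\<Z>\<close>, which are
  therefore instances of it.\<close>

abbreviation type_ring :: "'a :: comm_ring_1 ring" where
  "type_ring \<equiv> \<lparr>carrier = UNIV, monoid.mult = (*), one = 1, zero = 0, add = (+)\<rparr>"

lemma type_ring_cring: "cring (type_ring :: 'a :: comm_ring_1 ring)"
proof (rule cringI)
  show "abelian_group (type_ring :: 'a ring)"
    by (rule abelian_groupI) (simp_all add: add_ac, metis add.right_inverse)
  show "Group.comm_monoid (type_ring :: 'a ring)"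
    by (rule comm_monoidI) (auto simp: mult_ac)
qed (auto simp: distrib_right)

lemma type_ring_field: "field (type_ring :: 'a :: field ring)"
proof -
  interpret cring "type_ring :: 'a ring" by (rule type_ring_cring)
  have "x \<in> Units type_ring" if "x \<noteq> 0" for x :: 'a
    unfolding Units_def using that by (auto intro!: exI[of _ "inverse x"])
  moreover have "(0 :: 'a) \<notin> Units type_ring" unfolding Units_def by simp
  ultimately show ?thesis by (intro cring_fieldI) auto
qed

text \<open>Homomorphisms out of a type: identities are computed with type-class arithmetic at the
  source and then transported to the ring record.\<close>

locale type_ring_hom = cring A for A :: "('a, 'm) ring_scheme" (structure) +
  fixes \<phi> :: "'c :: comm_ring_1 \<Rightarrow> 'a"
  assumes hom_closed [simp, intro]: "\<phi> q \<in> carrier A"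
    and hom_add: "\<phi> (q + r) = \<phi> q \<oplus> \<phi> r"
    and hom_mult: "\<phi> (q * r) = \<phi> q \<otimes> \<phi> r"
    and hom_one: "\<phi> 1 = \<one>"
begin

lemma hom_zero: "\<phi> 0 = \<zero>"
  using hom_add[of 0 0] add.l_cancel_one[of "\<phi> 0" "\<phi> 0"] by simp

lemma hom_uminus: "\<phi> (- q) = \<ominus> \<phi> q"
  using hom_add[of "- q" q] by (simp add: hom_zero minus_equality)

lemma hom_diff: "\<phi> (q - r) = \<phi> q \<ominus> \<phi> r"
  using hom_add[of q "- r"] by (simp add: hom_uminus a_minus_def)

lemma hom_power: "\<phi> (q ^ n) = \<phi> q [^] n"
  by (induction n) (simp_all add: hom_one hom_mult m_comm)

lemma ring_hom: "\<phi> \<in> ring_hom type_ring A"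
  by (rule ring_hom_memI) (auto simp: hom_add hom_mult hom_one)

lemma hom_eq_iff: "\<phi> q = \<phi> r \<longleftrightarrow> \<phi> (q - r) = \<zero>"
  by (simp add: hom_diff r_right_minus_eq)

end

lemma type_ring_homI:
  "cring A \<Longrightarrow> \<phi> \<in> ring_hom type_ring A \<Longrightarrow> type_ring_hom A \<phi>"
  unfolding type_ring_hom_def type_ring_hom_axioms_def
  using ring_hom_memE[of \<phi> type_ring A] by auto

lemma type_ring_hom_compose:
  assumes "type_ring_hom A \<phi>" "cring C" "\<psi> \<in> ring_hom A C"
  shows "type_ring_hom C (\<lambda>q. \<psi> (\<phi> q))"
proof -
  interpret type_ring_hom A \<phi> by fact
  show ?thesis
    using assms(2) ring_hom_memE[OF assms(3)]
    by (intro type_ring_hom.intro type_ring_hom_axioms.intro) (auto simp: hom_add hom_mult hom_one)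
qed

lemma type_ring_hom_comp_type:
  assumes "type_ring_hom A \<phi>" "\<And>a b. \<psi> (a + b) = \<psi> a + \<psi> b" "\<And>a b. \<psi> (a * b) = \<psi> a * \<psi> b" "\<psi> 1 = 1"
  shows "type_ring_hom A (\<lambda>q. \<phi> (\<psi> q))"
proof -
  interpret type_ring_hom A \<phi> by fact
  show ?thesis
    by (intro type_ring_hom.intro type_ring_hom_axioms.intro)
       (auto simp: hom_add hom_mult hom_one assms cring_axioms)
qed

lemma (in cring) int_img_hom: "type_ring_hom R (int_img R)"
proof (intro type_ring_hom.intro type_ring_hom_axioms.intro)
  show "cring R" by (rule cring_axioms)
  fix m n :: int
  show "int_img R m \<in> carrier R" by (simp add: int_img_def)
  show "int_img R (m + n) = int_img R m \<oplus> int_img R n"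
    unfolding int_img_def using add.int_pow_mult[OF one_closed, of m n] by simp
  show "int_img R 1 = \<one>"
    unfolding int_img_def by (rule add.int_pow_1[OF one_closed])
  have "int_img R m \<otimes> int_img R n = [m] \<cdot> (\<one> \<otimes> int_img R n)"
    unfolding int_img_def by (rule add_pow_ldistr_int) simp_all
  also have "\<dots> = [m] \<cdot> ([n] \<cdot> \<one>)" by (simp add: int_img_def)
  also have "\<dots> = add_pow R (n * m) \<one>"
    by (rule add.int_pow_pow[OF one_closed])
  finally show "int_img R (m * n) = int_img R m \<otimes> int_img R n"
    unfolding int_img_def by (simp add: mult.commute)
qed

text \<open>The integers are initial among rings. All comparisons between images of integers in
  different rings rest on this.\<close>

lemma int_hom_unique:
  assumes "type_ring_hom A \<phi>" "type_ring_hom A \<psi>"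
  shows "\<phi> (n :: int) = \<psi> n"
proof -
  interpret a: type_ring_hom A \<phi> by fact
  interpret b: type_ring_hom A \<psi> by fact
  show ?thesis
    by (induction n rule: int_induct[of _ 0])
       (simp_all add: a.hom_zero b.hom_zero a.hom_add b.hom_add a.hom_one b.hom_one a.hom_diff b.hom_diff)
qed

lemma int_hom_eq_int_img: "type_ring_hom A \<phi> \<Longrightarrow> \<phi> n = int_img A n"
  using int_hom_unique cring.int_img_hom type_ring_hom.axioms(1) by metis

text \<open>Horner's scheme along \<open>\<iota>\<close>. Two variables are handled by using it
  twice, with an evaluation in the role of \<open>\<iota>\<close>.\<close>

definition peval :: "('a, 'm) ring_scheme \<Rightarrow> ('c :: zero \<Rightarrow> 'a) \<Rightarrow> 'a \<Rightarrow> 'c poly \<Rightarrow> 'a" where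
  "peval A \<iota> x q = fold_coeffs (\<lambda>c r. \<iota> c \<oplus>\<^bsub>A\<^esub> x \<otimes>\<^bsub>A\<^esub> r) q \<zero>\<^bsub>A\<^esub>"

locale poly_evaluation = type_ring_hom A \<iota>
  for A :: "('a, 'm) ring_scheme" (structure) and \<iota> :: "'c :: comm_ring_1 \<Rightarrow> 'a" +
  fixes x
  assumes x: "x \<in> carrier A"
begin

abbreviation E :: "'c poly \<Rightarrow> 'a" where "E \<equiv> peval A \<iota> x"

lemma peval_0: "E 0 = \<zero>"
  by (simp add: peval_def)

lemma peval_pCons: "E (pCons c q) = \<iota> c \<oplus> x \<otimes> E q"
proof (cases "c = 0 \<and> q = 0")
  case True
  thus ?thesis using x by (simp add: peval_def hom_zero)
next
  case False
  thus ?thesis unfolding peval_def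
    by (cases "c = 0") (simp_all add: fold_coeffs_pCons_coeff_not_0_eq fold_coeffs_pCons_not_0_0_eq)
qed

lemma peval_closed: "E q \<in> carrier A"
  by (induction q) (use x in \<open>simp_all add: peval_0 peval_pCons\<close>)

lemma peval_add: "E (q + r) = E q \<oplus> E r"
proof (induction q r rule: poly_induct2)
  case 0
  show ?case by (simp add: peval_0)
next
  case (pCons a p b q)
  show ?case using x peval_closed[of p] peval_closed[of q] hom_closed[of a] hom_closed[of b]
    unfolding add_pCons peval_pCons pCons hom_add by algebra
qed

lemma peval_smult: "E (Polynomial.smult c q) = \<iota> c \<otimes> E q"
proof (induction q)
  case 0
  show ?case by (simp add: peval_0)
next
  case (pCons a q)
  show ?case using x peval_closed[of q] hom_closed[of a] hom_closed[of c]
    unfolding smult_pCons peval_pCons pCons hom_mult by algebra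
qed

lemma peval_mult: "E (q * r) = E q \<otimes> E r"
proof (induction q)
  case 0
  show ?case using peval_closed[of r] by (simp add: peval_0)
next
  case (pCons a q)
  show ?case using x peval_closed[of q] peval_closed[of r] hom_closed[of a]
    unfolding mult_pCons_left peval_add peval_smult peval_pCons pCons hom_zero
    by (simp add: l_distr m_assoc)
qed

lemma peval_hom: "type_ring_hom A E"
proof (intro type_ring_hom.intro type_ring_hom_axioms.intro cring_axioms peval_closed peval_add peval_mult)
  show "E 1 = \<one>" using x by (simp add: one_pCons peval_pCons peval_0 hom_one)
qed

lemma peval_const: "E [:c:] = \<iota> c"
  using x by (simp add: peval_pCons peval_0)

lemma peval_X: "E [:0, 1:] = x"
  using x by (simp add: peval_pCons peval_0 hom_zero hom_one)

end

text \<open>The uniqueness half of the universal property of polynomial rings.\<close>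

lemma poly_hom_eq_peval:
  assumes "type_ring_hom A \<phi>"
  shows "\<phi> q = peval A (\<lambda>c. \<phi> [:c:]) (\<phi> [:0, 1:]) q"
proof -
  interpret type_ring_hom A \<phi> by fact
  interpret c: type_ring_hom A "\<lambda>c. \<phi> [:c:]"
    by (rule type_ring_hom_comp_type[OF assms]) auto
  interpret poly_evaluation A "\<lambda>c. \<phi> [:c:]" "\<phi> [:0, 1:]"
    by unfold_locales auto
  show ?thesis
  proof (induction q)
    case 0
    show ?case by (simp add: peval_0 hom_zero)
  next
    case (pCons a q)
    have "pCons a q = [:a:] + [:0, 1:] * q" by simp
    hence "\<phi> (pCons a q) = \<phi> [:a:] \<oplus>\<^bsub>A\<^esub> \<phi> [:0, 1:] \<otimes>\<^bsub>A\<^esub> \<phi> q" by (simp only: hom_add hom_mult)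
    thus ?case using pCons by (simp add: peval_pCons)
  qed
qed

lemma poly_hom_eqI:
  assumes "type_ring_hom A \<phi>" "type_ring_hom A \<psi>" "\<And>c. \<phi> [:c:] = \<psi> [:c:]" "\<phi> [:0, 1:] = \<psi> [:0, 1:]"
  shows "\<phi> q = \<psi> q"
  using poly_hom_eq_peval[OF assms(1), of q] poly_hom_eq_peval[OF assms(2), of q] assms(3,4) by simp

section \<open>Polynomials as lists and as elements of a type\<close>

text \<open>The normalization is there because \<open>\<iota>\<close> may kill leading coefficients,
  as in a reduction modulo \<open>p\<close>.\<close>

definition list_poly :: "('a, 'm) ring_scheme \<Rightarrow> ('c :: zero \<Rightarrow> 'a) \<Rightarrow> 'c poly \<Rightarrow> 'a list" where
  "list_poly A \<iota> q = ring.normalize A (rev (map \<iota> (coeffs q)))"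

context type_ring_hom
begin

lemma list_poly_closed: "list_poly A \<phi> q \<in> carrier (poly_ring A)"
  unfolding list_poly_def univ_poly_carrier[symmetric]
  by (rule normalize_gives_polynomial) auto

lemma list_poly_coeff: "coeff (list_poly A \<phi> q) i = \<phi> (poly.coeff q i)"
proof -
  have "coeff (list_poly A \<phi> q) i = coeff (rev (map \<phi> (coeffs q))) i"
    unfolding list_poly_def normalize_coeff[symmetric] ..
  also have "\<dots> = \<phi> (poly.coeff q i)"
  proof (cases "i < length (coeffs q)")
    case True
    thus ?thesis by (simp add: coeff_nth rev_nth coeffs_nth nth_default_coeffs_eq[symmetric] nth_default_def)
  next
    case False
    thus ?thesis by (simp add: coeff_length hom_zero nth_default_coeffs_eq[symmetric] nth_default_def)
  qed
  finally show ?thesis .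
qed

lemma list_poly_explicit:
  assumes "q \<noteq> 0" "\<phi> (Polynomial.lead_coeff q) \<noteq> \<zero>"
  shows "list_poly A \<phi> q = rev (map \<phi> (coeffs q))"
proof -
  have "rev (map \<phi> (coeffs q)) \<noteq> []" using assms(1) by simp
  moreover have "hd (rev (map \<phi> (coeffs q))) = \<phi> (Polynomial.lead_coeff q)"
    using assms(1) by (simp add: hd_rev last_map last_coeffs_eq_coeff_degree)
  ultimately show ?thesis
    unfolding list_poly_def using assms(2) by (intro normalize_polynomial[of "carrier A"]) (auto simp: polynomial_def)
qed

lemma list_poly_monic:
  assumes "Polynomial.lead_coeff q = 1" "\<one> \<noteq> \<zero>"
  shows "list_poly A \<phi> q = rev (map \<phi> (coeffs q))" "list_poly A \<phi> q \<noteq> []" "Polynomials.degree (list_poly A \<phi> q) = Polynomial.degree q"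
    "Polynomials.lead_coeff (list_poly A \<phi> q) = \<one>" "Defs.monic A (list_poly A \<phi> q)"
proof -
  have q: "q \<noteq> 0" using assms by auto
  show eq: "list_poly A \<phi> q = rev (map \<phi> (coeffs q))"
    using list_poly_explicit[OF q] assms by (simp add: hom_one)
  thus ne: "list_poly A \<phi> q \<noteq> []" using q by simp
  show "Polynomials.degree (list_poly A \<phi> q) = Polynomial.degree q"
    unfolding eq using q by (simp add: length_coeffs)
  show "Polynomials.lead_coeff (list_poly A \<phi> q) = \<one>"
    unfolding eq using q assms by (simp add: hd_rev last_map last_coeffs_eq_coeff_degree hom_one)
  thus "Defs.monic A (list_poly A \<phi> q)" using ne list_poly_closed unfolding Defs.monic_def by simp
qed

end

locale domain_type_hom = domain A + type_ring_hom A \<iota>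
  for A :: "('a, 'm) ring_scheme" (structure) and \<iota> :: "'c :: comm_ring_1 \<Rightarrow> 'a"
begin

abbreviation \<Theta> :: "'c poly \<Rightarrow> 'a list" where "\<Theta> \<equiv> list_poly A \<iota>"

lemma list_poly_eqI:
  assumes "l \<in> carrier (poly_ring A)" "\<And>i. coeff l i = \<iota> (poly.coeff q i)"
  shows "\<Theta> q = l"
  using coeff_iff_polynomial_cond[of "carrier A" "\<Theta> q" l] list_poly_closed[of q] assms list_poly_coeff
  by (simp add: univ_poly_carrier fun_eq_iff)

lemma poly_ring_cring: "cring (poly_ring A)"
  using univ_poly_is_cring[OF carrier_is_subring] .

lemma list_poly_add: "\<Theta> (q + r) = \<Theta> q \<oplus>\<^bsub>poly_ring A\<^esub> \<Theta> r"
proof (rule list_poly_eqI)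
  interpret P: cring "poly_ring A" by (rule poly_ring_cring)
  show "\<Theta> q \<oplus>\<^bsub>poly_ring A\<^esub> \<Theta> r \<in> carrier (poly_ring A)" using list_poly_closed by simp
  fix i
  have "set (\<Theta> q) \<subseteq> carrier A" "set (\<Theta> r) \<subseteq> carrier A"
    using list_poly_closed univ_poly_carrier polynomial_incl by blast+
  thus "coeff (\<Theta> q \<oplus>\<^bsub>poly_ring A\<^esub> \<Theta> r) i = \<iota> (poly.coeff (q + r) i)"
    by (simp add: univ_poly_add poly_add_coeff list_poly_coeff hom_add del: poly_add.simps)
qed

lemma list_poly_mult: "\<Theta> (q * r) = \<Theta> q \<otimes>\<^bsub>poly_ring A\<^esub> \<Theta> r"
proof (rule list_poly_eqI)
  interpret P: cring "poly_ring A" by (rule poly_ring_cring)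
  show "\<Theta> q \<otimes>\<^bsub>poly_ring A\<^esub> \<Theta> r \<in> carrier (poly_ring A)" using list_poly_closed by simp
  fix i
  have sum: "\<iota> (\<Sum>k\<in>I. g k) = (\<Oplus>k\<in>I. \<iota> (g k))" if "finite I" for g and I :: "nat set"
    using that by (induction I) (simp_all add: hom_zero hom_add)
  have "set (\<Theta> q) \<subseteq> carrier A" "set (\<Theta> r) \<subseteq> carrier A"
    using list_poly_closed univ_poly_carrier polynomial_incl by blast+
  thus "coeff (\<Theta> q \<otimes>\<^bsub>poly_ring A\<^esub> \<Theta> r) i = \<iota> (poly.coeff (q * r) i)"
    by (simp add: univ_poly_mult poly_mult_coeff list_poly_coeff coeff_mult sum hom_mult del: poly_mult.simps)
qed

lemma list_poly_one: "\<Theta> 1 = \<one>\<^bsub>poly_ring A\<^esub>"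
  by (simp add: list_poly_def univ_poly_one hom_one)

lemma list_poly_hom: "type_ring_hom (poly_ring A) \<Theta>"
  by (intro type_ring_hom.intro type_ring_hom_axioms.intro poly_ring_cring
      list_poly_closed list_poly_add list_poly_mult list_poly_one)

lemma list_poly_const: "\<Theta> [:c:] = poly_of_const (\<iota> c)"
proof (cases "c = 0")
  case True
  thus ?thesis by (simp add: list_poly_def poly_of_const_def hom_zero)
next
  case False
  thus ?thesis by (simp add: list_poly_def poly_of_const_def)
qed

lemma list_poly_X: "\<Theta> [:0, 1:] = X"
  by (simp add: list_poly_def var_def hom_zero hom_one)

lemma list_poly_surj:
  assumes "\<iota> ` UNIV = carrier A" "l \<in> carrier (poly_ring A)"
  shows "\<exists>q. \<Theta> q = l"
proof -
  have "\<exists>q. \<forall>i. coeff l i = \<iota> (poly.coeff q i)" if "set l \<subseteq> carrier A" for l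
  proof -
    define f where "f = inv_into UNIV \<iota>"
    have f: "\<iota> (f a) = a" if "a \<in> carrier A" for a
      unfolding f_def using that assms(1) by (simp add: f_inv_into_f)
    have "coeff l i = \<iota> (poly.coeff (Poly (rev (map f l))) i)" for i
    proof (cases "i < length l")
      case True
      hence "l ! (length l - Suc i) \<in> carrier A" using that by (auto simp: subset_iff)
      thus ?thesis using True by (simp add: coeff_nth coeff_Poly nth_default_def rev_nth f)
    next
      case False
      thus ?thesis by (simp add: coeff_length coeff_Poly nth_default_def hom_zero)
    qed
    thus ?thesis by blast
  qed
  moreover have "set l \<subseteq> carrier A" using assms(2) univ_poly_carrier polynomial_incl by blast
  ultimately show ?thesis using list_poly_eqI[OF assms(2)] by metis
qed

lemma list_poly_eq_0_iff: "\<Theta> q = \<zero>\<^bsub>poly_ring A\<^esub> \<longleftrightarrow> (\<forall>i. \<iota> (poly.coeff q i) = \<zero>)"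
proof
  assume "\<Theta> q = \<zero>\<^bsub>poly_ring A\<^esub>"
  hence "coeff (\<Theta> q) i = \<zero>" for i by (simp add: univ_poly_zero)
  thus "\<forall>i. \<iota> (poly.coeff q i) = \<zero>" using list_poly_coeff by simp
next
  assume "\<forall>i. \<iota> (poly.coeff q i) = \<zero>"
  thus "\<Theta> q = \<zero>\<^bsub>poly_ring A\<^esub>"
    by (intro list_poly_eqI) (auto simp: univ_poly_zero univ_poly_zero_closed)
qed

end

section \<open>Quotients\<close>

lemma (in ideal) rcos_eq_zero_iff:
  "a \<in> carrier R \<Longrightarrow> I +> a = \<zero>\<^bsub>R Quot I\<^esub> \<longleftrightarrow> a \<in> I"
  using a_rcos_zero[OF is_ideal, of a] rcos_const_imp_mem[of a] by (auto simp: FactRing_def)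

lemma carrier_FactRing: "carrier (R Quot I) = (\<lambda>a. I +>\<^bsub>R\<^esub> a) ` carrier R"
  unfolding FactRing_def A_RCOSETS_def' by auto

text \<open>\<open>j\<close> applies \<open>\<chi>\<close> to an arbitrary preimage under
  \<open>\<psi>\<close>; the condition on kernels makes the result independent of the
  choice.\<close>

lemma type_ring_hom_factor:
  assumes \<psi>: "type_ring_hom L \<psi>" and surj: "\<psi> ` UNIV = carrier L" and \<chi>: "type_ring_hom C \<chi>"
    and ker: "\<And>q. \<psi> q = \<zero>\<^bsub>L\<^esub> \<Longrightarrow> \<chi> q = \<zero>\<^bsub>C\<^esub>"
  obtains j where "j \<in> ring_hom L C" "\<And>q. j (\<psi> q) = \<chi> q"
proof -
  interpret a: type_ring_hom L \<psi> by fact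
  interpret b: type_ring_hom C \<chi> by fact
  define j where "j = (\<lambda>l. \<chi> (SOME q. \<psi> q = l))"
  have j: "j (\<psi> q) = \<chi> q" for q
  proof -
    have "\<psi> (SOME r. \<psi> r = \<psi> q) = \<psi> q" by (rule someI[of _ q]) simp
    thus ?thesis unfolding j_def using ker a.hom_eq_iff b.hom_eq_iff by blast
  qed
  have "j \<in> ring_hom L C"
  proof (rule ring_hom_memI)
    fix x y assume "x \<in> carrier L" "y \<in> carrier L"
    then obtain q r where "x = \<psi> q" "y = \<psi> r" using surj by blast
    thus "j x \<in> carrier C" "j (x \<otimes>\<^bsub>L\<^esub> y) = j x \<otimes>\<^bsub>C\<^esub> j y" "j (x \<oplus>\<^bsub>L\<^esub> y) = j x \<oplus>\<^bsub>C\<^esub> j y"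
      by (simp_all add: j a.hom_mult[symmetric] a.hom_add[symmetric] b.hom_mult b.hom_add)
  next
    show "j \<one>\<^bsub>L\<^esub> = \<one>\<^bsub>C\<^esub>" using j[of 1] by (simp add: a.hom_one b.hom_one)
  qed
  thus thesis using j that by blast
qed

text \<open>The quotient F[X]/(g) seen through a surjection \<open>\<iota>\<close> from a type onto
  \<open>F\<close>. Then \<open>\<psi>\<close> is a surjection from a polynomial type onto the
  quotient, and it can serve as the \<open>\<iota>\<close> of a further extension; this is how
  \<open>L\<close> is built over \<open>K\<close>.\<close>

locale monic_quotient = field F + domain_type_hom F \<iota>
  for F :: "('a, 'm) ring_scheme" (structure) and \<iota> :: "'c :: comm_ring_1 \<Rightarrow> 'a" +
  fixes g :: "'c poly"
  assumes surj: "\<iota> ` UNIV = carrier F"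
    and g: "Polynomial.lead_coeff g = 1" "Polynomial.degree g > 0"
begin

abbreviation "L \<equiv> Rupt (carrier F) (\<Theta> g)"
definition \<psi> :: "'c poly \<Rightarrow> 'a list set" where "\<psi> q = poly_class F (\<Theta> g) (\<Theta> q)"

interpretation P: cring "poly_ring F" by (rule poly_ring_cring)
interpretation I: ideal "PIdl\<^bsub>poly_ring F\<^esub> (\<Theta> g)" "poly_ring F"
  by (rule P.cgenideal_ideal[OF list_poly_closed])

lemma L_cring: "cring L"
  unfolding rupture_def by (rule I.quotient_is_cring[OF P.cring_axioms])

lemma \<psi>_hom: "type_ring_hom L \<psi>"
  unfolding \<psi>_def poly_class_def
  by (rule type_ring_hom_compose[OF list_poly_hom L_cring]) (unfold rupture_def, rule I.rcos_ring_hom)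

lemma \<psi>_surj: "\<psi> ` UNIV = carrier L"
proof -
  have "carrier (poly_ring F) = \<Theta> ` UNIV" using list_poly_surj[OF surj] list_poly_closed by blast
  thus ?thesis unfolding rupture_def carrier_FactRing \<psi>_def poly_class_def by (auto simp: image_image)
qed

text \<open>Divisibility by \<open>g\<close> holds only up to polynomials whose coefficients are
  killed by \<open>\<iota>\<close>, which need not be injective.\<close>

lemma \<psi>_eq_0_iff: "\<psi> q = \<zero>\<^bsub>L\<^esub> \<longleftrightarrow> (\<exists>a. \<forall>i. \<iota> (poly.coeff (q - g * a) i) = \<zero>)"
proof -
  interpret \<Theta>: type_ring_hom "poly_ring F" \<Theta> by (rule list_poly_hom)
  have "\<psi> q = \<zero>\<^bsub>L\<^esub> \<longleftrightarrow> \<Theta> q \<in> PIdl\<^bsub>poly_ring F\<^esub> (\<Theta> g)"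
    unfolding rupture_def \<psi>_def poly_class_def by (rule I.rcos_eq_zero_iff[OF list_poly_closed])
  also have "\<dots> \<longleftrightarrow> (\<exists>a. \<Theta> q = \<Theta> (g * a))"
  proof
    assume "\<Theta> q \<in> PIdl\<^bsub>poly_ring F\<^esub> (\<Theta> g)"
    then obtain l where l: "l \<in> carrier (poly_ring F)" "\<Theta> q = l \<otimes>\<^bsub>poly_ring F\<^esub> \<Theta> g"
      unfolding cgenideal_def by blast
    then obtain a where "l = \<Theta> a" using list_poly_surj[OF surj] by blast
    thus "\<exists>a. \<Theta> q = \<Theta> (g * a)" using l(2) by (metis list_poly_mult mult.commute)
  next
    assume "\<exists>a. \<Theta> q = \<Theta> (g * a)"
    then obtain a where "\<Theta> q = \<Theta> a \<otimes>\<^bsub>poly_ring F\<^esub> \<Theta> g" by (metis list_poly_mult mult.commute)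
    thus "\<Theta> q \<in> PIdl\<^bsub>poly_ring F\<^esub> (\<Theta> g)" unfolding cgenideal_def using list_poly_closed by blast
  qed
  also have "\<dots> \<longleftrightarrow> (\<exists>a. \<forall>i. \<iota> (poly.coeff (q - g * a) i) = \<zero>)"
    by (simp only: \<Theta>.hom_eq_iff list_poly_eq_0_iff)
  finally show ?thesis .
qed

lemma const_class_eq: "const_class F (\<Theta> g) (\<iota> c) = \<psi> [:c:]"
  by (simp add: const_class_def \<psi>_def list_poly_const)

lemma X_class_eq: "poly_class F (\<Theta> g) X = \<psi> [:0, 1:]"
  by (simp add: \<psi>_def list_poly_X)

lemma const_class_hom: "const_class F (\<Theta> g) \<in> ring_hom F L"
proof -
  have "poly_of_const \<in> ring_hom F (poly_ring F)"
    using canonical_embedding_is_hom[OF carrier_is_subring] by simp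
  moreover have "(\<lambda>q. PIdl\<^bsub>poly_ring F\<^esub> (\<Theta> g) +>\<^bsub>poly_ring F\<^esub> q) \<in> ring_hom (poly_ring F) L"
    unfolding rupture_def by (rule I.rcos_ring_hom)
  ultimately have "(\<lambda>q. PIdl\<^bsub>poly_ring F\<^esub> (\<Theta> g) +>\<^bsub>poly_ring F\<^esub> q) \<circ> poly_of_const \<in> ring_hom F L"
    by (rule ring_hom_trans)
  thus ?thesis unfolding const_class_def poly_class_def comp_def .
qed

lemma L_dimension:
  "ring.dimension L (Polynomial.degree g) (const_class F (\<Theta> g) ` carrier F) (carrier L)"
  using rupture_dimension[OF carrier_is_subfield list_poly_closed[of g],
      unfolded list_poly_monic(3)[OF g(1) one_not_zero], OF g(2)]
  unfolding image_image const_class_def poly_class_def .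

text \<open>In a domain L the ideal generated by \<open>g\<close> is prime, so \<open>g\<close> is
  irreducible over the field \<open>F\<close>. What remains for each floor of the tower is an
  embedding into the complex numbers.\<close>

lemma L_field:
  assumes "domain L"
  shows "field L"
proof -
  interpret PD: domain "poly_ring F" by (rule univ_poly_is_domain[OF carrier_is_subring])
  have "primeideal (PIdl\<^bsub>poly_ring F\<^esub> (\<Theta> g)) (poly_ring F)"
    using P.quot_domain_imp_primeideal[OF I.is_ideal] assms unfolding rupture_def by simp
  moreover have "\<Theta> g \<in> carrier (poly_ring F) - {\<zero>\<^bsub>poly_ring F\<^esub>}"
    using list_poly_closed list_poly_monic(2)[OF g(1) one_not_zero] by (simp add: univ_poly_zero)
  ultimately have "ring_prime\<^bsub>poly_ring F\<^esub> (\<Theta> g)"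
    using PD.primeideal_iff_prime by blast
  thus ?thesis
    using pprime_iff_pirreducible[OF carrier_is_subfield list_poly_closed]
      rupture_is_field_iff_pirreducible[OF carrier_is_subfield list_poly_closed] by blast
qed

end

lemma (in ring) inj_hom_domain:
  assumes "domain C" "j \<in> ring_hom R C" "inj_on j (carrier R)"
  shows "domain R"
proof -
  interpret ring_hom_ring R C j by (rule ring_hom_ringI2[OF ring_axioms domain.axioms(1)[THEN cring.axioms(1)] assms(2)]) fact
  show ?thesis by (rule inj_on_domain[OF assms(3,1)])
qed

section \<open>Powers of ideals\<close>

context cring
begin

lemma ideal_pow_0: "ideal_pow R I 0 = carrier R"
  by (simp add: nat_pow_def ideals_set_def)

lemma ideal_pow_Suc: "ideal_pow R I (Suc n) = ideal_prod R (ideal_pow R I n) I"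
  by (simp add: nat_pow_def ideals_set_def)

lemma ideal_pow_ideal: "ideal I R \<Longrightarrow> ideal (ideal_pow R I n) R"
  by (induction n) (simp_all only: ideal_pow_0 ideal_pow_Suc oneideal ideal_prod_is_ideal)

lemma pow_mem_ideal_pow: "x \<in> I \<Longrightarrow> I \<subseteq> carrier R \<Longrightarrow> x [^] n \<in> ideal_pow R I n"
proof (induction n)
  case 0
  show ?case unfolding ideal_pow_0 by simp
next
  case (Suc n)
  thus ?case unfolding ideal_pow_Suc nat_pow_Suc by (intro ideal_prod.prod) auto
qed

text \<open>Bounds ideal powers from above by a filtration \<open>f\<close> that is closed under
  sums and shifted by one under multiplication by \<open>I\<close>, without choosing
  generators.\<close>

lemma ideal_pow_subsetI:
  assumes start: "carrier R \<subseteq> f 0"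
    and add: "\<And>n x y. x \<in> f n \<Longrightarrow> y \<in> f n \<Longrightarrow> x \<oplus> y \<in> f n"
    and mult: "\<And>n x y. x \<in> f n \<Longrightarrow> y \<in> I \<Longrightarrow> x \<otimes> y \<in> f (Suc n)"
  shows "ideal_pow R I n \<subseteq> f n"
proof (induction n)
  case 0
  show ?case unfolding ideal_pow_0 by (rule start)
next
  case (Suc n)
  show ?case
  proof
    fix x assume "x \<in> ideal_pow R I (Suc n)"
    hence "x \<in> ideal_prod R (ideal_pow R I n) I" by (simp only: ideal_pow_Suc)
    thus "x \<in> f (Suc n)"
      by (induction rule: ideal_prod.induct) (use Suc mult add in blast)+
  qed
qed

lemma ideal_pow_PIdl:
  assumes "x \<in> carrier R"
  shows "ideal_pow R (PIdl x) n = PIdl (x [^] n)"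
proof
  show "ideal_pow R (PIdl x) n \<subseteq> PIdl (x [^] n)"
  proof (rule ideal_pow_subsetI)
    show "carrier R \<subseteq> PIdl (x [^] (0 :: nat))" unfolding cgenideal_def by force
    fix n :: nat and a b
    show "a \<in> PIdl (x [^] n) \<Longrightarrow> b \<in> PIdl (x [^] n) \<Longrightarrow> a \<oplus> b \<in> PIdl (x [^] n)"
      using cgenideal_ideal[of "x [^] n"] assms
      by (simp add: additive_subgroup.a_closed ideal.axioms(1))
    assume "a \<in> PIdl (x [^] n)" "b \<in> PIdl x"
    then obtain c d where "c \<in> carrier R" "d \<in> carrier R" "a = c \<otimes> x [^] n" "b = d \<otimes> x"
      unfolding cgenideal_def by blast
    moreover have "c \<otimes> x [^] n \<otimes> (d \<otimes> x) = (c \<otimes> d) \<otimes> (x [^] n \<otimes> x)"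
      if "c \<in> carrier R" "d \<in> carrier R" using that assms by (simp add: m_ac)
    ultimately show "a \<otimes> b \<in> PIdl (x [^] Suc n)" unfolding cgenideal_def by auto
  qed
  show "PIdl (x [^] n) \<subseteq> ideal_pow R (PIdl x) n"
    using additive_subgroup.a_subset[OF ideal.axioms(1)[OF cgenideal_ideal[OF assms]]]
    by (intro cgenideal_minimal[OF ideal_pow_ideal[OF cgenideal_ideal[OF assms]]]
        pow_mem_ideal_pow[OF cgenideal_self[OF assms]])
qed

end

section \<open>Rings of integers in a discretely valued field\<close>

lemma (in cring) subring_cring: "subring K R \<Longrightarrow> cring (R\<lparr>carrier := K\<rparr>)"
  using subcringI' subcring_iff subringE(1) by blast

lemma int_img_subring:
  assumes "cring L" "subring K L"
  shows "int_img (L\<lparr>carrier := K\<rparr>) n = int_img L n"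
proof -
  interpret cring L by fact
  have c: "cring (L\<lparr>carrier := K\<rparr>)" by (rule subring_cring[OF assms(2)])
  have "(\<lambda>x. x) \<in> ring_hom (L\<lparr>carrier := K\<rparr>) L"
    using subringE(1)[OF assms(2)] by (intro ring_hom_memI) auto
  from type_ring_hom_compose[OF cring.int_img_hom[OF c] assms(1) this]
  show ?thesis by (rule int_hom_eq_int_img)
qed

lemma ring_of_integers_def':
  "\<O> K = K\<lparr>carrier := carrier (\<O> K)\<rparr>"
  by (simp add: ring_of_integers_def)

text \<open>What is needed of \<open>D\<close> and the order \<open>B\<close>, freed from complex
  numbers so that it serves both fields of the tower. The units of \<open>D\<close> turn out to be
  the elements outside \<open>y D\<close>; \<open>denominator\<close> clears denominators by units
  from \<open>B\<close>, and \<open>inverse_mod_p\<close> inverts units modulo \<open>p\<close> with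
  a factor from \<open>B\<close>.\<close>

locale valued_field = field L for L :: "('a, 'm) ring_scheme" (structure) +
  fixes p e :: nat and y :: 'a and B D :: "'a set"
  assumes p: "Factorial_Ring.prime p" and e: "e > 0"
    and O_subring: "subring (carrier (\<O> L)) L"
    and D_subring: "subring D L"
    and B_subring: "subring B L"
    and B_O: "B \<subseteq> carrier (\<O> L)" and O_D: "carrier (\<O> L) \<subseteq> D"
    and y_B: "y \<in> B" and y_nonzero: "y \<noteq> \<zero>"
    and y_nonunit: "\<And>d. d \<in> D \<Longrightarrow> y \<otimes> d \<noteq> \<one>"
    and decompose: "\<And>l. l \<in> carrier L \<Longrightarrow> l \<noteq> \<zero> \<Longrightarrow>
      \<exists>n::nat. \<exists>w \<in> D. w \<noteq> \<zero> \<and> inv w \<in> D \<and> (l = y [^] n \<otimes> w \<or> l \<otimes> y [^] n = w)"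
    and denominator: "\<And>d. d \<in> D \<Longrightarrow> \<exists>s\<in>B. s \<notin> (\<otimes>) y ` D \<and> s \<otimes> d \<in> B"
    and inverse_mod_p: "\<And>s. s \<in> D \<Longrightarrow> s \<notin> (\<otimes>) y ` D \<Longrightarrow>
      \<exists>t\<in>B. \<exists>z\<in>B. s \<otimes> t = \<one> \<oplus> int_img L (int p) \<otimes> z"
    and ramified: "\<exists>u\<in>B. u \<notin> (\<otimes>) y ` D \<and> int_img L (int p) \<otimes> u = y [^] e"
begin

abbreviation "OL \<equiv> carrier (\<O> L)"
abbreviation "pp \<equiv> int_img L (int p)"
definition "DR = L\<lparr>carrier := D\<rparr>"
definition "PL = {z \<in> OL. z \<in> (\<otimes>) y ` D}"

lemma O_carrier: "x \<in> OL \<Longrightarrow> x \<in> carrier L" using subringE(1)[OF O_subring] by blast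
lemma D_carrier: "x \<in> D \<Longrightarrow> x \<in> carrier L" using subringE(1)[OF D_subring] by blast
lemma B_D: "x \<in> B \<Longrightarrow> x \<in> D" using B_O O_D by blast
lemma y_carrier: "y \<in> carrier L" using y_B B_D D_carrier by blast
lemma y_O: "y \<in> OL" using y_B B_O by blast
lemma y_D: "y \<in> D" using y_B B_D by blast

lemma D_add: "a \<in> D \<Longrightarrow> b \<in> D \<Longrightarrow> a \<oplus> b \<in> D" by (rule subringE(7)[OF D_subring])
lemma D_mult: "a \<in> D \<Longrightarrow> b \<in> D \<Longrightarrow> a \<otimes> b \<in> D" by (rule subringE(6)[OF D_subring])
lemma D_one: "\<one> \<in> D" by (rule subringE(3)[OF D_subring])
lemma D_zero: "\<zero> \<in> D" by (rule subringE(2)[OF D_subring])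
lemma O_add: "a \<in> OL \<Longrightarrow> b \<in> OL \<Longrightarrow> a \<oplus> b \<in> OL" by (rule subringE(7)[OF O_subring])
lemma O_mult: "a \<in> OL \<Longrightarrow> b \<in> OL \<Longrightarrow> a \<otimes> b \<in> OL" by (rule subringE(6)[OF O_subring])
lemma O_uminus: "a \<in> OL \<Longrightarrow> \<ominus> a \<in> OL" by (rule subringE(5)[OF O_subring])
lemma O_one: "\<one> \<in> OL" by (rule subringE(3)[OF O_subring])
lemma O_zero: "\<zero> \<in> OL" by (rule subringE(2)[OF O_subring])
lemma O_pow: "a \<in> OL \<Longrightarrow> a [^] (n::nat) \<in> OL" by (induction n) (auto intro: O_one O_mult)
lemma D_pow: "a \<in> D \<Longrightarrow> a [^] (n::nat) \<in> D" by (induction n) (auto intro: D_one D_mult)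

lemma OR_cring: "cring (\<O> L)"
  using subring_cring[OF O_subring] ring_of_integers_def'[of L] by simp

lemma OR_simps: "mult (\<O> L) = mult L" "add (\<O> L) = add L" "one (\<O> L) = \<one>" "zero (\<O> L) = \<zero>"
  by (simp_all add: ring_of_integers_def)

lemma OR_int_img: "int_img (\<O> L) n = int_img L n"
  using int_img_subring[OF cring_axioms O_subring] ring_of_integers_def'[of L] by simp

lemma OR_pow: "x [^]\<^bsub>\<O> L\<^esub> (n::nat) = x [^] n"
  by (induction n) (simp_all add: nat_pow_def OR_simps)

lemma DR_domain: "domain DR"
  unfolding DR_def by (rule subring_is_domain[OF D_subring])

lemma DR_cring: "cring DR" using DR_domain by (simp add: domain_def)

lemma DR_simps: "carrier DR = D" "mult DR = mult L" "add DR = add L" "one DR = \<one>" "zero DR = \<zero>"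
  by (simp_all add: DR_def)

lemma DR_pow: "x [^]\<^bsub>DR\<^esub> (n::nat) = x [^] n"
  by (induction n) (simp_all add: nat_pow_def DR_simps)

lemma int_img_carrier: "int_img L n \<in> carrier L"
  using type_ring_hom.hom_closed[OF int_img_hom] .

lemma pp_O: "pp \<in> OL"
  using type_ring_hom.hom_closed[OF cring.int_img_hom[OF OR_cring]] OR_int_img by simp

text \<open>For an element of \<open>D\<close> the alternative with a negative exponent of
  \<open>y\<close> is excluded, since it would make \<open>y\<close> a unit.\<close>

lemma unit_or_multiple:
  assumes "l \<in> D" "l \<noteq> \<zero>"
  shows "\<exists>n::nat. \<exists>w\<in>D. w \<noteq> \<zero> \<and> inv w \<in> D \<and> l = y [^] n \<otimes> w"
proof -
  obtain n :: nat and w where w: "w \<in> D" "w \<noteq> \<zero>" "inv w \<in> D" "l = y [^] n \<otimes> w \<or> l \<otimes> y [^] n = w"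
    using decompose[OF D_carrier[OF assms(1)] assms(2)] by blast
  show ?thesis
  proof (cases "l = y [^] n \<otimes> w")
    case True
    thus ?thesis using w by blast
  next
    case False
    hence lw: "l \<otimes> y [^] n = w" using w by blast
    show ?thesis
    proof (cases n)
      case 0
      hence "l = y [^] (0::nat) \<otimes> w" using lw w D_carrier assms(1) by simp
      thus ?thesis using w by blast
    next
      case (Suc m)
      have c: "l \<in> carrier L" "y [^] m \<in> carrier L" "inv w \<in> carrier L" "w \<in> carrier L"
        using assms w D_carrier y_carrier by auto
      have "y \<otimes> (l \<otimes> y [^] m \<otimes> inv w) = l \<otimes> y [^] n \<otimes> inv w"
        unfolding Suc using c y_carrier by (simp add: m_ac)
      also have "\<dots> = \<one>" using lw w c field_Units by simp
      finally show ?thesis using y_nonunit[of "l \<otimes> y [^] m \<otimes> inv w"] w assms(1) y_D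
        by (auto intro: D_mult D_pow)
    qed
  qed
qed

lemma not_multiple_unit:
  assumes "l \<in> D" "l \<notin> (\<otimes>) y ` D"
  shows "l \<noteq> \<zero>" "inv l \<in> D"
proof -
  have "\<zero> = y \<otimes> \<zero>" using y_carrier by simp
  thus 0: "l \<noteq> \<zero>" using assms(2) D_zero by blast
  obtain n :: nat and w where w: "w \<in> D" "w \<noteq> \<zero>" "inv w \<in> D" "l = y [^] n \<otimes> w"
    using unit_or_multiple[OF assms(1) 0] by blast
  show "inv l \<in> D"
  proof (cases n)
    case 0
    thus ?thesis using w D_carrier by simp
  next
    case (Suc m)
    have "l = y \<otimes> (y [^] m \<otimes> w)" using w(1,4) y_carrier D_carrier unfolding Suc by (simp add: m_ac)
    thus ?thesis using assms(2) w y_D by (auto intro: D_mult D_pow)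
  qed
qed

lemma unit_not_multiple:
  assumes "l \<in> D" "inv l \<in> D" "l \<noteq> \<zero>"
  shows "l \<notin> (\<otimes>) y ` D"
proof
  assume "l \<in> (\<otimes>) y ` D"
  then obtain d where d: "d \<in> D" "l = y \<otimes> d" by blast
  have "y \<otimes> (d \<otimes> inv l) = l \<otimes> inv l" unfolding d(2) using d D_carrier assms y_carrier by (simp add: m_assoc)
  also have "\<dots> = \<one>" using assms D_carrier field_Units by simp
  finally show False using y_nonunit[of "d \<otimes> inv l"] d assms by (auto intro: D_mult)
qed

lemma not_multiple_mult:
  assumes "a \<in> D" "b \<in> D" "a \<notin> (\<otimes>) y ` D" "b \<notin> (\<otimes>) y ` D"
  shows "a \<otimes> b \<notin> (\<otimes>) y ` D"
proof (rule unit_not_multiple)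
  note a = not_multiple_unit[OF assms(1,3)] and b = not_multiple_unit[OF assms(2,4)]
  show "a \<otimes> b \<in> D" by (rule D_mult[OF assms(1,2)])
  show "a \<otimes> b \<noteq> \<zero>" using a b assms D_carrier integral by blast
  have c: "a \<in> carrier L" "b \<in> carrier L" "inv a \<in> carrier L" "inv b \<in> carrier L"
    using a b assms D_carrier by auto
  have "(a \<otimes> b) \<otimes> (inv b \<otimes> inv a) = (a \<otimes> inv a) \<otimes> (b \<otimes> inv b)" using c by (simp add: m_ac)
  also have "\<dots> = \<one>" using a b c field_Units by simp
  finally have "inv (a \<otimes> b) = inv b \<otimes> inv a" using c by (intro comm_inv_char) auto
  thus "inv (a \<otimes> b) \<in> D" using a b by (simp add: D_mult)
qed

lemma y_pow_nonzero: "y [^] (n::nat) \<noteq> \<zero>"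
  by (induction n) (use y_nonzero y_carrier integral in auto)

lemma pow_multiple_unit_iff:
  assumes "w \<in> D" "w \<noteq> \<zero>" "inv w \<in> D" "d \<in> D" "y [^] (n::nat) \<otimes> w = y [^] (m::nat) \<otimes> d"
  shows "m \<le> n"
proof (rule ccontr)
  assume "\<not> m \<le> n"
  then obtain k where m: "m = n + Suc k" using less_natE not_le by (metis add_Suc_right)
  have c: "w \<in> carrier L" "d \<in> carrier L" "y [^] n \<in> carrier L" "y [^] k \<in> carrier L"
    using assms D_carrier y_carrier by auto
  have "y [^] n \<otimes> w = y [^] n \<otimes> (y \<otimes> (y [^] k \<otimes> d))"
    using assms(5) c y_carrier unfolding m by (simp add: nat_pow_mult[symmetric] m_ac)
  moreover have "y [^] n \<noteq> \<zero>" by (rule y_pow_nonzero)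
  ultimately have "w = y \<otimes> (y [^] k \<otimes> d)" using c y_carrier m_lcancel[of "y [^] n" w] by simp
  moreover have "y [^] k \<otimes> d \<in> D" using assms y_D by (auto intro: D_mult D_pow)
  ultimately show False using unit_not_multiple[OF assms(1,3,2)] by blast
qed

subsection \<open>The discrete valuation ring\<close>

text \<open>With an element \<open>y [^] n \<otimes> w\<close>, \<open>w\<close> a unit, the ideal
  contains \<open>y [^] n\<close>; the generator is the least such power.\<close>

lemma DR_ideal:
  assumes "ideal I DR" "I \<noteq> {\<zero>}"
  obtains n :: nat where "I = (\<otimes>) (y [^] n) ` D"
proof -
  interpret I: ideal I DR by fact
  have ID: "I \<subseteq> D" using I.a_subset by (simp add: DR_simps)
  have mem: "y [^] n \<in> I" if "w \<in> D" "w \<noteq> \<zero>" "inv w \<in> D" "y [^] n \<otimes> w \<in> I" for n :: nat and w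
  proof -
    have "(y [^] n \<otimes> w) \<otimes> inv w \<in> I" using I.I_r_closed[OF that(4)] that by (simp add: DR_simps)
    thus ?thesis using that D_carrier y_carrier field_Units by (simp add: m_assoc)
  qed
  have "\<zero> \<in> I" using additive_subgroup.zero_closed[OF I.is_additive_subgroup] by (simp add: DR_simps)
  then obtain l where l: "l \<in> I" "l \<noteq> \<zero>" using assms(2) by blast
  then obtain m :: nat and w where "w \<in> D" "w \<noteq> \<zero>" "inv w \<in> D" "l = y [^] m \<otimes> w"
    using unit_or_multiple ID by blast
  hence ex: "y [^] m \<in> I" using mem l by blast
  define n where "n = (LEAST n::nat. y [^] n \<in> I)"
  have n: "y [^] n \<in> I" unfolding n_def using ex by (rule LeastI)
  have "I = (\<otimes>) (y [^] n) ` D"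
  proof
    show "(\<otimes>) (y [^] n) ` D \<subseteq> I" using I.I_r_closed[OF n] by (auto simp: DR_simps)
    show "I \<subseteq> (\<otimes>) (y [^] n) ` D"
    proof
      fix x assume x: "x \<in> I"
      show "x \<in> (\<otimes>) (y [^] n) ` D"
      proof (cases "x = \<zero>")
        case True
        thus ?thesis using D_zero y_carrier by (intro image_eqI[of _ _ \<zero>]) auto
      next
        case False
        then obtain m :: nat and w where w: "w \<in> D" "w \<noteq> \<zero>" "inv w \<in> D" "x = y [^] m \<otimes> w"
          using unit_or_multiple ID x by blast
        hence "n \<le> m" unfolding n_def using mem x by (intro Least_le) blast
        then obtain k where "m = n + k" using le_Suc_ex by blast
        hence "x = y [^] n \<otimes> (y [^] k \<otimes> w)" using w D_carrier y_carrier by (simp add: nat_pow_mult[symmetric] m_assoc)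
        moreover have "y [^] k \<otimes> w \<in> D" using w y_D by (auto intro: D_mult D_pow)
        ultimately show ?thesis by blast
      qed
    qed
  qed
  thus thesis using that by blast
qed

lemma DR_PIdl: "d \<in> D \<Longrightarrow> PIdl\<^bsub>DR\<^esub> d = (\<otimes>) d ` D"
  unfolding cgenideal_def DR_simps using m_comm D_carrier by force

lemma DR_discrete_valuation_ring: "discrete_valuation_ring DR"
  unfolding discrete_valuation_ring_def
proof (intro conjI)
  interpret DR: domain DR by (rule DR_domain)
  have zero: "{\<zero>} = PIdl\<^bsub>DR\<^esub> \<zero>" using DR_PIdl[OF D_zero] D_zero D_carrier by auto
  show "principal_domain DR"
  proof (intro principal_domain.intro principal_domain_axioms.intro DR_domain)
    fix I assume I: "ideal I DR"
    show "\<exists>a\<in>carrier DR. I = PIdl\<^bsub>DR\<^esub> a"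
    proof (cases "I = {\<zero>}")
      case True
      thus ?thesis using zero D_zero DR_simps by auto
    next
      case False
      then obtain n :: nat where "I = (\<otimes>) (y [^] n) ` D" using DR_ideal[OF I] by blast
      thus ?thesis using DR_PIdl[OF D_pow[OF y_D]] D_pow[OF y_D] unfolding DR_simps by metis
    qed
  qed
  have one: "\<one> \<notin> (\<otimes>) y ` D" using y_nonunit by (metis imageE)
  have yI: "ideal ((\<otimes>) y ` D) DR" using DR.cgenideal_ideal[of y] DR_PIdl[OF y_D] y_D DR_simps by simp
  have below: "I \<subseteq> (\<otimes>) y ` D" if I: "ideal I DR" "I \<noteq> D" for I
  proof
    fix x assume x: "x \<in> I"
    have xD: "x \<in> D" using x ideal.Icarr[OF I(1)] DR_simps by simp
    show "x \<in> (\<otimes>) y ` D"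
    proof (rule ccontr)
      assume "x \<notin> (\<otimes>) y ` D"
      note u = not_multiple_unit[OF xD this]
      hence "x \<otimes> inv x \<in> I" using ideal.I_r_closed[OF I(1) x] by (simp add: DR_simps)
      hence "\<one> \<in> I" using u xD D_carrier field_Units by simp
      hence "I = D" using ideal.one_imp_carrier[OF I(1)] by (simp add: DR_simps)
      thus False using I(2) by simp
    qed
  qed
  show "\<exists>!P. maximalideal P DR"
  proof (rule ex1I)
    show "maximalideal ((\<otimes>) y ` D) DR"
    proof (rule maximalidealI[OF yI])
      show "carrier DR \<noteq> (\<otimes>) y ` D" using one D_one DR_simps by metis
      fix J assume "ideal J DR" "(\<otimes>) y ` D \<subseteq> J" "J \<subseteq> carrier DR"
      thus "J = (\<otimes>) y ` D \<or> J = carrier DR" using below DR_simps by blast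
    qed
    fix Q assume Q: "maximalideal Q DR"
    interpret Q: maximalideal Q DR by fact
    have "Q \<noteq> D" using Q.I_notcarr DR_simps by metis
    hence "Q \<subseteq> (\<otimes>) y ` D" using below Q.is_ideal by blast
    thus "Q = (\<otimes>) y ` D"
      using Q.I_maximal[OF yI] one D_one DR_simps ideal.Icarr[OF yI] by (metis subsetI)
  qed
  show "\<not> field DR"
  proof
    assume "field DR"
    hence "y \<in> Units DR" using y_D y_nonzero field.field_Units DR_simps by (metis Diff_iff singletonD)
    then obtain d where "d \<in> D" "y \<otimes> d = \<one>" unfolding Units_def DR_simps by blast
    thus False using y_nonunit by blast
  qed
qed

end

lemma (in cring) ideal_criterion:
  assumes "I \<subseteq> carrier R" "\<zero> \<in> I" "\<And>a b. a \<in> I \<Longrightarrow> b \<in> I \<Longrightarrow> a \<oplus> b \<in> I"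
    "\<And>a x. a \<in> I \<Longrightarrow> x \<in> carrier R \<Longrightarrow> x \<otimes> a \<in> I"
  shows "ideal I R"
proof (rule idealI[OF ring_axioms])
  have "\<ominus> a \<in> I" if "a \<in> I" for a
    using assms(4)[OF that, of "\<ominus> \<one>"] assms(1) that by (auto simp: l_minus subset_iff)
  thus "subgroup I (add_monoid R)"
    using assms(1,2,3) by (intro subgroup.intro) (auto simp: a_inv_def[symmetric])
  show "x \<otimes> a \<in> I" "a \<otimes> x \<in> I" if "a \<in> I" "x \<in> carrier R" for a x
    using assms(4)[OF that] m_comm[of a x] assms(1) that by auto
qed

lemma (in cring) PIdl_iff: "b \<in> PIdl a \<longleftrightarrow> (\<exists>x\<in>carrier R. b = x \<otimes> a)"
  unfolding cgenideal_def by blast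

section \<open>The prime over p in the ring of integers, and its powers\<close>

context valued_field
begin

sublocale OR: cring "\<O> L" by (rule OR_cring)

lemma PL_O: "x \<in> PL \<Longrightarrow> x \<in> OL" unfolding PL_def by simp

lemma yD_mult: "x \<in> (\<otimes>) y ` D \<Longrightarrow> d \<in> D \<Longrightarrow> d \<otimes> x \<in> (\<otimes>) y ` D"
proof -
  assume "x \<in> (\<otimes>) y ` D" and d: "d \<in> D"
  then obtain c where c: "c \<in> D" "x = y \<otimes> c" by blast
  have "d \<otimes> x = y \<otimes> (d \<otimes> c)" using c d D_carrier y_carrier by (simp add: m_ac)
  thus ?thesis using D_mult[OF d c(1)] by blast
qed

lemma yD_add: "a \<in> (\<otimes>) y ` D \<Longrightarrow> b \<in> (\<otimes>) y ` D \<Longrightarrow> a \<oplus> b \<in> (\<otimes>) y ` D"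
proof -
  assume "a \<in> (\<otimes>) y ` D" "b \<in> (\<otimes>) y ` D"
  then obtain c d where c: "c \<in> D" "a = y \<otimes> c" "d \<in> D" "b = y \<otimes> d" by blast
  have "a \<oplus> b = y \<otimes> (c \<oplus> d)" using c D_carrier y_carrier by (simp add: r_distr)
  thus ?thesis using D_add[OF c(1,3)] by blast
qed

lemma zero_yD: "\<zero> \<in> (\<otimes>) y ` D"
  using D_zero y_carrier by (intro image_eqI[of _ _ \<zero>]) auto

lemma one_notin_yD: "\<one> \<notin> (\<otimes>) y ` D" using y_nonunit by (metis imageE)

lemma PL_ideal: "ideal PL (\<O> L)"
  by (rule OR.ideal_criterion)
     (auto simp: PL_def OR_simps O_zero O_add O_mult zero_yD intro: yD_add yD_mult dest: set_mp[OF O_D])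

lemma PL_prime: "primeideal PL (\<O> L)"
proof (rule primeidealI[OF PL_ideal OR_cring])
  show "OL \<noteq> PL" using one_notin_yD O_one unfolding PL_def by blast
  fix a b assume "a \<in> OL" "b \<in> OL" "a \<otimes>\<^bsub>\<O> L\<^esub> b \<in> PL"
  thus "a \<in> PL \<or> b \<in> PL"
    using not_multiple_mult O_D unfolding PL_def OR_simps by blast
qed

lemma y_PL: "y \<in> PL"
  unfolding PL_def using y_O D_one y_carrier by (auto intro!: image_eqI[of _ _ \<one>])

lemma pp_decompose: obtains u v where "u \<in> B" "v \<in> D" "pp \<otimes> u = y [^] e" "pp = y [^] e \<otimes> v" "u \<otimes> v = \<one>"
proof -
  obtain u where u: "u \<in> B" "u \<notin> (\<otimes>) y ` D" "pp \<otimes> u = y [^] e" using ramified by blast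
  note inv = not_multiple_unit[OF B_D[OF u(1)] u(2)]
  have c: "u \<in> carrier L" "pp \<in> carrier L" "inv u \<in> carrier L" using u(1) B_D D_carrier int_img_carrier inv by auto
  have uu: "u \<otimes> inv u = \<one>" using inv(1) c field_Units by simp
  have "pp = pp \<otimes> (u \<otimes> inv u)" unfolding uu using c by simp
  also have "\<dots> = y [^] e \<otimes> inv u" unfolding u(3)[symmetric] using c by (simp add: m_assoc)
  finally show thesis using that u inv(2) uu by blast
qed

lemma pp_PL: "pp \<in> PL"
proof -
  obtain u v where v: "v \<in> D" "pp = y [^] e \<otimes> v" by (rule pp_decompose)
  obtain m where m: "e = Suc m" using e gr0_implies_Suc by blast
  have "pp = y \<otimes> (y [^] m \<otimes> v)" unfolding v(2) m using v(1) D_carrier y_carrier by (simp add: m_ac)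
  moreover have "y [^] m \<otimes> v \<in> D" using v(1) y_D by (auto intro: D_mult D_pow)
  ultimately show ?thesis unfolding PL_def using pp_O by blast
qed

text \<open>By Bezout's identity, an integer prime to \<open>p\<close> in \<open>I\<close> would put
  1 into \<open>I\<close>.\<close>

lemma int_img_in_ideal_iff:
  assumes I: "ideal I (\<O> L)" "\<one> \<notin> I" "pp \<in> I"
  shows "int_img (\<O> L) n \<in> I \<longleftrightarrow> int p dvd n"
proof -
  interpret I: ideal I "\<O> L" by fact
  interpret i: type_ring_hom "\<O> L" "int_img (\<O> L)" by (rule OR.int_img_hom)
  have mult: "int_img (\<O> L) (a * b) \<in> I" if "int_img (\<O> L) b \<in> I" for a b
    unfolding i.hom_mult using I.I_l_closed[OF that] by simp
  have ppI: "int_img (\<O> L) (int p) \<in> I" using I(3) OR_int_img by simp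
  show ?thesis
  proof
    assume n: "int_img (\<O> L) n \<in> I"
    show "int p dvd n"
    proof (rule ccontr)
      assume "\<not> int p dvd n"
      hence "coprime (int p) n" using p by (simp add: prime_imp_coprime)
      then obtain a b where ab: "a * int p + b * n = 1" using bezout_int[of "int p" n] by auto
      have "int_img (\<O> L) (a * int p + b * n) \<in> I"
        unfolding i.hom_add by (rule additive_subgroup.a_closed[OF I.is_additive_subgroup mult[OF ppI] mult[OF n]])
      thus False unfolding ab i.hom_one using I(2) by (simp add: OR_simps)
    qed
  next
    assume "int p dvd n"
    then obtain c where "n = c * int p" by (metis dvd_def mult.commute)
    thus "int_img (\<O> L) n \<in> I" using mult[OF ppI] by simp
  qed
qed

lemma PL_lies_over: "lies_over (\<O> L) PL p"
  unfolding lies_over_def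
  using PL_prime int_img_in_ideal_iff[OF PL_ideal _ pp_PL] one_notin_yD unfolding PL_def by auto

text \<open>An element with a multiple of the form \<open>1 + p z\<close> cannot lie in a prime over
  \<open>p\<close>, so \<open>Q\<close> contains no unit of \<open>D\<close>. Conversely,
  \<open>y ^ e\<close> is a multiple of \<open>p\<close>, whence \<open>y \<in> Q\<close>; and for
  \<open>z = y d\<close> in \<open>PL\<close>, a denominator \<open>s\<close> of \<open>d\<close>
  satisfies \<open>s z \<in> Q\<close> but \<open>s \<notin> Q\<close>.\<close>

lemma lies_over_unique:
  assumes "lies_over (\<O> L) Q p"
  shows "Q = PL"
proof
  have prime: "primeideal Q (\<O> L)" and "{n. int_img (\<O> L) n \<in> Q} = {n. int p dvd n}"
    using assms unfolding lies_over_def by auto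
  hence ppQ: "pp \<in> Q" using OR_int_img by (metis dvd_refl mem_Collect_eq)
  interpret Q: primeideal Q "\<O> L" by fact
  have one: "\<one> \<notin> Q" using Q.one_imp_carrier Q.I_notcarr by (metis OR_simps(3))
  have no_inv: False if "q \<in> Q" "t \<in> B" "z \<in> B" "q \<otimes> t = \<one> \<oplus> pp \<otimes> z" for q t z
  proof -
    have c: "z \<in> OL" "t \<in> OL" using that B_O by auto
    have 1: "q \<otimes> t \<in> Q" using Q.I_r_closed[OF that(1) c(2)] by (simp add: OR_simps)
    have 2: "pp \<otimes> z \<in> Q" using Q.I_r_closed[OF ppQ c(1)] by (simp add: OR_simps)
    have "q \<otimes> t \<oplus> (\<ominus>\<^bsub>\<O> L\<^esub> \<one>\<^bsub>\<O> L\<^esub>) \<otimes>\<^bsub>\<O> L\<^esub> (pp \<otimes> z) \<in> Q"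
      using additive_subgroup.a_closed[OF Q.is_additive_subgroup 1 Q.I_l_closed[OF 2 OR.a_inv_closed[OF OR.one_closed]]]
      by (simp add: OR_simps)
    also have "q \<otimes> t \<oplus> (\<ominus>\<^bsub>\<O> L\<^esub> \<one>\<^bsub>\<O> L\<^esub>) \<otimes>\<^bsub>\<O> L\<^esub> (pp \<otimes> z)
        = \<one>\<^bsub>\<O> L\<^esub> \<oplus>\<^bsub>\<O> L\<^esub> pp \<otimes>\<^bsub>\<O> L\<^esub> z \<oplus>\<^bsub>\<O> L\<^esub> (\<ominus>\<^bsub>\<O> L\<^esub> \<one>\<^bsub>\<O> L\<^esub>) \<otimes>\<^bsub>\<O> L\<^esub> (pp \<otimes>\<^bsub>\<O> L\<^esub> z)"
      using that(4) by (simp add: OR_simps)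
    also have "\<dots> = \<one>\<^bsub>\<O> L\<^esub>" using c(1) pp_O by algebra
    finally show False using one by (simp add: OR_simps)
  qed
  show "Q \<subseteq> PL"
  proof
    fix q assume q: "q \<in> Q"
    hence "q \<in> OL" using Q.Icarr by simp
    thus "q \<in> PL" using no_inv[OF q] inverse_mod_p[of q] O_D unfolding PL_def by blast
  qed
  show "PL \<subseteq> Q"
  proof
    fix z assume "z \<in> PL"
    then obtain d where d: "d \<in> D" "z = y \<otimes> d" "z \<in> OL" unfolding PL_def by blast
    obtain s where s: "s \<in> B" "s \<notin> (\<otimes>) y ` D" "s \<otimes> d \<in> B" using denominator[OF d(1)] by blast
    obtain u v where u: "u \<in> B" "pp \<otimes> u = y [^] e" by (rule pp_decompose)
    have "y [^] e \<in> Q" unfolding u(2)[symmetric] using Q.I_r_closed[OF ppQ] u(1) B_O by (auto simp: OR_simps)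
    moreover have "y [^] n \<in> Q \<Longrightarrow> y \<in> Q" for n :: nat
    proof (induction n)
      case 0
      thus ?case using one by simp
    next
      case (Suc n)
      thus ?case using Q.I_prime[of "y [^] n" y] y_O O_pow by (auto simp: OR_simps)
    qed
    ultimately have yQ: "y \<in> Q" by blast
    have "s \<otimes> z = y \<otimes> (s \<otimes> d)" using s d B_D D_carrier y_carrier by (simp add: m_ac)
    also have "\<dots> \<in> Q" using Q.I_r_closed[OF yQ] s(3) B_O by (auto simp: OR_simps)
    finally have "s \<in> Q \<or> z \<in> Q" using Q.I_prime[of s z] s d B_O by (auto simp: OR_simps)
    thus "z \<in> Q" using no_inv[of s] inverse_mod_p[OF B_D[OF s(1)] s(2)] by blast
  qed
qed

lemma PL_pow_subset: "ideal_pow (\<O> L) PL n \<subseteq> {z \<in> OL. z \<in> (\<otimes>) (y [^] n) ` D}"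
proof (rule OR.ideal_pow_subsetI)
  show "OL \<subseteq> {z \<in> OL. z \<in> (\<otimes>) (y [^] (0::nat)) ` D}"
    using O_D D_carrier by (auto intro!: image_eqI)
next
  fix n a b assume a: "a \<in> {z \<in> OL. z \<in> (\<otimes>) (y [^] (n::nat)) ` D}"
  then obtain c where c: "c \<in> D" "a = y [^] n \<otimes> c" by blast
  {
    assume b: "b \<in> {z \<in> OL. z \<in> (\<otimes>) (y [^] n) ` D}"
    then obtain d where d: "d \<in> D" "b = y [^] n \<otimes> d" by blast
    have "a \<oplus> b = y [^] n \<otimes> (c \<oplus> d)" using c d D_carrier y_carrier by (simp add: r_distr)
    thus "a \<oplus>\<^bsub>\<O> L\<^esub> b \<in> {z \<in> OL. z \<in> (\<otimes>) (y [^] n) ` D}"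
      using a b D_add[OF c(1) d(1)] O_add[of a b] unfolding OR_simps by blast
  next
    assume b: "b \<in> PL"
    then obtain d where d: "d \<in> D" "b = y \<otimes> d" unfolding PL_def by blast
    have "a \<otimes> b = y [^] Suc n \<otimes> (c \<otimes> d)" using c d D_carrier y_carrier by (simp add: m_ac)
    thus "a \<otimes>\<^bsub>\<O> L\<^esub> b \<in> {z \<in> OL. z \<in> (\<otimes>) (y [^] Suc n) ` D}"
      using a PL_O[OF b] D_mult[OF c(1) d(1)] O_mult[of a b] unfolding OR_simps by blast
  }
qed

lemma pp_PIdl: "PIdl\<^bsub>\<O> L\<^esub> pp = ideal_pow (\<O> L) PL e"
proof
  interpret J: ideal "ideal_pow (\<O> L) PL e" "\<O> L" by (rule OR.ideal_pow_ideal[OF PL_ideal])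
  obtain u v where u: "u \<in> B" "pp \<otimes> u = y [^] e" "v \<in> D" "pp = y [^] e \<otimes> v" "u \<otimes> v = \<one>" by (rule pp_decompose)
  have uO: "u \<in> OL" using u B_O by blast
  have PLc: "PL \<subseteq> OL" using PL_O by blast
  have "u \<notin> (\<otimes>) y ` D"
  proof
    assume "u \<in> (\<otimes>) y ` D"
    from yD_mult[OF this u(3)] show False using u B_D D_carrier m_comm one_notin_yD by metis
  qed
  then obtain t z where tz: "t \<in> B" "z \<in> B" "u \<otimes> t = \<one> \<oplus> pp \<otimes> z" using inverse_mod_p B_D u(1) by blast
  have tzO: "t \<in> OL" "z \<in> OL" using tz B_O by auto
  \<comment> \<open>With \<open>u t = 1 + p z\<close> and \<open>k = m + 1\<close> one has
    \<open>p^k = y^e t p^m - z p^(k+1)\<close>, and \<open>y^e\<close> lies in the ideal. Starting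
    from \<open>p^e\<close>, which lies in it as a product of \<open>e\<close> elements of
    \<open>PL\<close>, the exponent goes down to 1.\<close>
  have step: "pp [^] k \<in> ideal_pow (\<O> L) PL e"
    if k: "pp [^] Suc k \<in> ideal_pow (\<O> L) PL e" "k > 0" for k
  proof -
    obtain m where m: "k = Suc m" using k(2) gr0_implies_Suc by blast
    have c: "pp \<in> carrier L" "u \<in> carrier L" "t \<in> carrier L" "z \<in> carrier L" "pp [^] m \<in> carrier L"
      using pp_O uO tzO O_carrier by auto
    have ye: "y [^] e \<in> ideal_pow (\<O> L) PL e"
      using OR.pow_mem_ideal_pow[OF y_PL PLc, of e] by (simp add: OR_pow)
    have A: "y [^] e \<otimes> (t \<otimes> pp [^] m) \<in> ideal_pow (\<O> L) PL e"
      using J.I_r_closed[OF ye, of "t \<otimes> pp [^] m"] tzO pp_O by (simp add: OR_simps O_mult O_pow)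
    have "(\<ominus> z) \<otimes> pp [^] Suc k \<in> ideal_pow (\<O> L) PL e"
      using J.I_l_closed[OF k(1), of "\<ominus> z"] tzO by (simp add: OR_simps O_uminus)
    from additive_subgroup.a_closed[OF J.is_additive_subgroup A this]
    have "y [^] e \<otimes> (t \<otimes> pp [^] m) \<oplus> (\<ominus> z) \<otimes> pp [^] Suc k \<in> ideal_pow (\<O> L) PL e"
      by (simp add: OR_simps)
    also have "y [^] e \<otimes> (t \<otimes> pp [^] m) = pp \<otimes> (u \<otimes> t) \<otimes> pp [^] m"
      unfolding u(2)[symmetric] using c by (simp add: m_ac)
    also have "\<dots> = pp [^] k \<oplus> z \<otimes> pp [^] Suc k"
      unfolding tz(3) m using c by (simp add: r_distr l_distr m_ac)
    also have "pp [^] k \<oplus> z \<otimes> pp [^] Suc k \<oplus> (\<ominus> z) \<otimes> pp [^] Suc k = pp [^] k"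
      using c by (simp add: l_minus a_assoc r_neg)
    finally show ?thesis .
  qed
  have "pp [^] (Suc k) \<in> ideal_pow (\<O> L) PL e \<Longrightarrow> pp [^] (Suc 0) \<in> ideal_pow (\<O> L) PL e" for k
  proof (induction k)
    case (Suc k)
    thus ?case using step[of "Suc k"] by blast
  qed
  moreover have "pp [^] e \<in> ideal_pow (\<O> L) PL e"
    using OR.pow_mem_ideal_pow[OF pp_PL PLc, of e] by (simp add: OR_pow)
  ultimately have "pp \<in> ideal_pow (\<O> L) PL e" using e int_img_carrier by (cases e) auto
  thus "PIdl\<^bsub>\<O> L\<^esub> pp \<subseteq> ideal_pow (\<O> L) PL e" by (rule OR.cgenideal_minimal[OF J.is_ideal])
  show "ideal_pow (\<O> L) PL e \<subseteq> PIdl\<^bsub>\<O> L\<^esub> pp"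
  proof
    fix x assume "x \<in> ideal_pow (\<O> L) PL e"
    then obtain d where d: "d \<in> D" "x = y [^] e \<otimes> d" "x \<in> OL" using PL_pow_subset by blast
    \<comment> \<open>This is \<open>x / p\<close>. It is integral: if \<open>s d'\<close> lies in
      \<open>B\<close> and \<open>s t = 1 + p z\<close>, then
      \<open>d' = t (s d') - z x\<close>.\<close>
    define d' where "d' = u \<otimes> d"
    have d': "d' \<in> D" unfolding d'_def using u d B_D by (auto intro: D_mult)
    have xd: "x = pp \<otimes> d'" unfolding d(2) u(2)[symmetric] d'_def
      using d(1) B_D[OF u(1)] D_carrier int_img_carrier by (simp add: m_assoc)
    obtain s where s: "s \<in> B" "s \<notin> (\<otimes>) y ` D" "s \<otimes> d' \<in> B" using denominator[OF d'] by blast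
    obtain t z where tz: "t \<in> B" "z \<in> B" "s \<otimes> t = \<one> \<oplus> pp \<otimes> z" using inverse_mod_p[OF B_D[OF s(1)] s(2)] by blast
    have c: "s \<in> carrier L" "t \<in> carrier L" "z \<in> carrier L" "pp \<in> carrier L" "d' \<in> carrier L"
      using s tz d' B_D D_carrier int_img_carrier by auto
    have "t \<otimes> (s \<otimes> d') = (s \<otimes> t) \<otimes> d'" using c by (simp add: m_ac)
    also have "\<dots> = d' \<oplus> z \<otimes> x" unfolding tz(3) xd using c by (simp add: l_distr r_distr m_ac)
    finally have "d' = t \<otimes> (s \<otimes> d') \<oplus> \<ominus> (z \<otimes> x)"
      using c xd by (simp add: a_assoc r_neg)
    also have "\<dots> \<in> OL" using tz s d B_O by (intro O_add O_uminus O_mult[of t "s \<otimes> d'"] O_mult[of z x]) auto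
    finally have "d' \<in> OL" .
    thus "x \<in> PIdl\<^bsub>\<O> L\<^esub> pp" unfolding cgenideal_def OR_simps xd using c m_comm by blast
  qed
qed

lemma ramification_index: "ramification_index (\<O> L) PL p = e"
  unfolding ramification_index_def OR_int_img
proof (rule Greatest_equality)
  show "PIdl\<^bsub>\<O> L\<^esub> pp \<subseteq> ideal_pow (\<O> L) PL e" using pp_PIdl by simp
  fix n assume "PIdl\<^bsub>\<O> L\<^esub> pp \<subseteq> ideal_pow (\<O> L) PL n"
  hence "pp \<in> ideal_pow (\<O> L) PL n" using OR.cgenideal_self pp_O by blast
  then obtain d where d: "d \<in> D" "pp = y [^] n \<otimes> d" using PL_pow_subset by blast
  obtain u v where u: "u \<in> B" "pp \<otimes> u = y [^] e" by (rule pp_decompose)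
  have "y [^] e \<otimes> \<one> = y [^] n \<otimes> (d \<otimes> u)"
    using d u B_D D_carrier y_carrier by (simp add: m_assoc[symmetric])
  thus "n \<le> e" using d u B_D by (intro pow_multiple_unit_iff[of \<one>]) (auto intro: D_one D_mult)
qed

text \<open>The order and the possibly larger ring of integers have the same localization: fractions
  of integral elements stay in \<open>D\<close>, and every element of \<open>D\<close> already has
  numerator and denominator in \<open>B\<close>.\<close>

lemma localization: "localization_at L PL = DR"
proof -
  have "{x \<otimes> inv z | x z. x \<in> OL \<and> z \<in> OL - PL} = D"
  proof (intro equalityI subsetI)
    fix l assume "l \<in> {x \<otimes> inv z | x z. x \<in> OL \<and> z \<in> OL - PL}"
    then obtain x z where "l = x \<otimes> inv z" "x \<in> OL" "z \<in> OL" "z \<notin> (\<otimes>) y ` D" unfolding PL_def by blast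
    thus "l \<in> D" using not_multiple_unit[of z] O_D by (auto intro: D_mult)
  next
    fix d assume d: "d \<in> D"
    obtain s where s: "s \<in> B" "s \<notin> (\<otimes>) y ` D" "s \<otimes> d \<in> B" using denominator[OF d] by blast
    note u = not_multiple_unit[OF B_D[OF s(1)] s(2)]
    have c: "s \<in> carrier L" "inv s \<in> carrier L" "d \<in> carrier L" using s d u B_D D_carrier by auto
    have "(s \<otimes> d) \<otimes> inv s = d \<otimes> (s \<otimes> inv s)" using c by (simp add: m_ac)
    also have "\<dots> = d" using u c field_Units by simp
    finally show "d \<in> {x \<otimes> inv z | x z. x \<in> OL \<and> z \<in> OL - PL}"
      using s B_O unfolding PL_def by (intro CollectI exI[of _ "s \<otimes> d"] exI[of _ s]) auto
  qed
  thus ?thesis unfolding localization_at_def DR_def by simp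
qed

lemma PL_pow_extension: "Idl\<^bsub>DR\<^esub> (ideal_pow (\<O> L) PL n) = PIdl\<^bsub>DR\<^esub> (y [^] n)"
proof
  interpret DR: cring DR by (rule DR_cring)
  have eq: "PIdl\<^bsub>DR\<^esub> (y [^] n) = (\<otimes>) (y [^] n) ` D" by (rule DR_PIdl[OF D_pow[OF y_D]])
  have id: "ideal (PIdl\<^bsub>DR\<^esub> (y [^] n)) DR" using D_pow[OF y_D] by (intro DR.cgenideal_ideal) (simp add: DR_simps)
  show "Idl\<^bsub>DR\<^esub> (ideal_pow (\<O> L) PL n) \<subseteq> PIdl\<^bsub>DR\<^esub> (y [^] n)"
    using PL_pow_subset by (intro DR.genideal_minimal[OF id]) (auto simp: eq)
  have sub: "ideal_pow (\<O> L) PL n \<subseteq> carrier DR" using PL_pow_subset O_D unfolding DR_simps by blast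
  have "y [^] n \<in> Idl\<^bsub>DR\<^esub> (ideal_pow (\<O> L) PL n)"
    using OR.pow_mem_ideal_pow[OF y_PL, of n] PL_O DR.genideal_self[OF sub] by (auto simp: OR_pow)
  thus "PIdl\<^bsub>DR\<^esub> (y [^] n) \<subseteq> Idl\<^bsub>DR\<^esub> (ideal_pow (\<O> L) PL n)"
    by (rule DR.cgenideal_minimal[OF DR.genideal_ideal[OF sub]])
qed

text \<open>The extension of \<open>p \<O> K\<close> to \<open>\<O> L\<close> is
  \<open>p \<O> L\<close>, which is \<open>PL ^ e\<close> by \<open>pp_PIdl\<close>; the exponent
  demanded by total ramification is the degree, given as \<open>e\<close>.\<close>

lemma total_ramification:
  assumes K: "cring K" "cring (\<O> K)" "subring (carrier (\<O> K)) K" and \<iota>: "\<iota> \<in> ring_hom K L" "\<iota> ` carrier (\<O> K) \<subseteq> OL"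
    and dim: "ring.dim L (\<iota> ` carrier K) (carrier L) = e"
  shows "totally_ramified K L \<iota> (PIdl\<^bsub>\<O> K\<^esub> (int_img (\<O> K) (int p)))"
  unfolding totally_ramified_def dim
proof (intro exI[of _ PL] conjI PL_prime)
  interpret OK: cring "\<O> K" by fact
  interpret iK: type_ring_hom K "int_img K" by (rule cring.int_img_hom[OF K(1)])
  interpret iOK: type_ring_hom "\<O> K" "int_img (\<O> K)" by (rule OK.int_img_hom)
  have pK: "int_img (\<O> K) (int p) = int_img K (int p)"
    using int_img_subring[OF K(1,3)] ring_of_integers_def'[of K] by simp
  have \<iota>p: "\<iota> (int_img K (int p)) = pp"
    by (rule int_hom_eq_int_img[OF type_ring_hom_compose[OF iK.type_ring_hom_axioms cring_axioms \<iota>(1)]])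
  have sub: "\<iota> ` (PIdl\<^bsub>\<O> K\<^esub> (int_img (\<O> K) (int p))) \<subseteq> PIdl\<^bsub>\<O> L\<^esub> pp"
  proof
    fix l assume "l \<in> \<iota> ` (PIdl\<^bsub>\<O> K\<^esub> (int_img (\<O> K) (int p)))"
    then obtain c where c: "c \<in> carrier (\<O> K)" "l = \<iota> (c \<otimes>\<^bsub>\<O> K\<^esub> int_img (\<O> K) (int p))"
      unfolding OK.PIdl_iff cgenideal_def by blast
    moreover have "c \<in> carrier K" using c subringE(1)[OF K(3)] by blast
    ultimately have "l = \<iota> c \<otimes> pp"
      using ring_hom_mult[OF \<iota>(1), of c "int_img K (int p)"] \<iota>p pK by (simp add: ring_of_integers_def)
    thus "l \<in> PIdl\<^bsub>\<O> L\<^esub> pp" unfolding cgenideal_def OR_simps using \<iota>(2) c(1) by blast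
  qed
  have id: "ideal (PIdl\<^bsub>\<O> L\<^esub> pp) (\<O> L)" by (rule OR.cgenideal_ideal[OF pp_O])
  have "pp \<in> \<iota> ` (PIdl\<^bsub>\<O> K\<^esub> (int_img (\<O> K) (int p)))"
    using OK.cgenideal_self[OF iOK.hom_closed[of "int p"]] \<iota>p pK by force
  hence "PIdl\<^bsub>\<O> L\<^esub> pp \<subseteq> Idl\<^bsub>\<O> L\<^esub> (\<iota> ` (PIdl\<^bsub>\<O> K\<^esub> (int_img (\<O> K) (int p))))"
    using sub id by (intro OR.cgenideal_minimal OR.genideal_ideal set_mp[OF OR.genideal_self]) (auto dest: ideal.Icarr[OF id])
  moreover have "Idl\<^bsub>\<O> L\<^esub> (\<iota> ` (PIdl\<^bsub>\<O> K\<^esub> (int_img (\<O> K) (int p)))) \<subseteq> PIdl\<^bsub>\<O> L\<^esub> pp"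
    by (rule OR.genideal_minimal[OF id sub])
  ultimately show "Idl\<^bsub>\<O> L\<^esub> (\<iota> ` (PIdl\<^bsub>\<O> K\<^esub> (int_img (\<O> K) (int p)))) = ideal_pow (\<O> L) PL e"
    using pp_PIdl by simp
qed

text \<open>For \<open>e = 1\<close> the identity between \<open>p \<O> L\<close> and
  \<open>PL ^ e\<close> says that \<open>p\<close> generates a prime ideal. It is meant for the
  lower field, where \<open>p\<close> is the uniformizer.\<close>

lemma inert_if_unramified:
  assumes "e = 1"
  shows "PIdl\<^bsub>\<O> L\<^esub> pp = PL" "inert (\<O> L) p"
proof -
  have "ideal_pow (\<O> L) PL 1 = ideal_prod (\<O> L) (carrier (\<O> L)) PL"
    unfolding One_nat_def OR.ideal_pow_Suc OR.ideal_pow_0 ..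
  also have "\<dots> = PL"
    using OR.ideal_prod_one[OF PL_ideal] OR.ideal_prod_commute[OF PL_ideal OR.oneideal] by simp
  finally show eq: "PIdl\<^bsub>\<O> L\<^esub> pp = PL" using pp_PIdl assms by simp
  show "inert (\<O> L) p" unfolding inert_def OR_int_img eq by (rule PL_prime)
qed

subsection \<open>Homomorphisms to finite rings\<close>

text \<open>Universal property of localization: \<open>\<Phi> d\<close> is
  \<open>\<phi> (s d) / \<phi> s\<close> for a chosen denominator \<open>s\<close>. Independence of
  the choice is \<open>char\<close>, and \<open>eqI\<close> computes \<open>\<Phi> d\<close> from
  whichever denominator is convenient.\<close>

lemma extend_hom:
  assumes R: "cring R" and \<phi>: "\<phi> \<in> ring_hom (L\<lparr>carrier := B\<rparr>) R"
    and units: "\<And>s. s \<in> B \<Longrightarrow> s \<notin> (\<otimes>) y ` D \<Longrightarrow> \<phi> s \<in> Units R"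
  obtains \<Phi> where "\<Phi> \<in> ring_hom DR R" "\<And>b. b \<in> B \<Longrightarrow> \<Phi> b = \<phi> b"
proof -
  interpret R: cring R by fact
  have \<phi>_closed: "\<phi> a \<in> carrier R" if "a \<in> B" for a using ring_hom_closed[OF \<phi>] that by simp
  have \<phi>_mult: "\<phi> (a \<otimes> b) = \<phi> a \<otimes>\<^bsub>R\<^esub> \<phi> b" if "a \<in> B" "b \<in> B" for a b
    using ring_hom_mult[OF \<phi>, of a b] that by simp
  have \<phi>_add: "\<phi> (a \<oplus> b) = \<phi> a \<oplus>\<^bsub>R\<^esub> \<phi> b" if "a \<in> B" "b \<in> B" for a b
    using ring_hom_add[OF \<phi>, of a b] that by simp
  have \<phi>_one: "\<phi> \<one> = \<one>\<^bsub>R\<^esub>" using ring_hom_one[OF \<phi>] by simp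
  have B_mult: "a \<otimes> b \<in> B" if "a \<in> B" "b \<in> B" for a b using subringE(6)[OF B_subring] that by blast
  have B_add: "a \<oplus> b \<in> B" if "a \<in> B" "b \<in> B" for a b using subringE(7)[OF B_subring] that by blast
  define good where "good d s \<longleftrightarrow> s \<in> B \<and> s \<notin> (\<otimes>) y ` D \<and> s \<otimes> d \<in> B" for d s
  define \<Phi> where "\<Phi> d = (let s = SOME s. good d s in \<phi> (s \<otimes> d) \<otimes>\<^bsub>R\<^esub> inv\<^bsub>R\<^esub> \<phi> s)" for d
  have char: "\<Phi> d \<otimes>\<^bsub>R\<^esub> \<phi> s = \<phi> (s \<otimes> d) \<and> \<Phi> d \<in> carrier R" if d: "d \<in> D" and s: "good d s" for d s
  proof -
    define s0 where "s0 = (SOME s. good d s)"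
    have s0: "good d s0" unfolding s0_def using s by (rule someI)
    note s = s[unfolded good_def] and s0 = s0[unfolded good_def]
    have \<Phi>: "\<Phi> d = \<phi> (s0 \<otimes> d) \<otimes>\<^bsub>R\<^esub> inv\<^bsub>R\<^esub> \<phi> s0" unfolding \<Phi>_def s0_def Let_def ..
    have u: "\<phi> s0 \<in> Units R" using units s0 by blast
    have c: "\<phi> s \<in> carrier R" "\<phi> s0 \<in> carrier R" "\<phi> (s \<otimes> d) \<in> carrier R" "\<phi> (s0 \<otimes> d) \<in> carrier R" "inv\<^bsub>R\<^esub> \<phi> s0 \<in> carrier R"
      using s s0 \<phi>_closed u by auto
    have "s \<otimes> (s0 \<otimes> d) = s0 \<otimes> (s \<otimes> d)" using s s0 d B_D D_carrier by (simp add: m_lcomm)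
    hence "\<phi> s \<otimes>\<^bsub>R\<^esub> \<phi> (s0 \<otimes> d) = \<phi> s0 \<otimes>\<^bsub>R\<^esub> \<phi> (s \<otimes> d)" using \<phi>_mult s s0 by metis
    hence "\<Phi> d \<otimes>\<^bsub>R\<^esub> \<phi> s = \<phi> (s \<otimes> d) \<otimes>\<^bsub>R\<^esub> (\<phi> s0 \<otimes>\<^bsub>R\<^esub> inv\<^bsub>R\<^esub> \<phi> s0)"
      unfolding \<Phi> using c by (metis R.m_assoc R.m_comm R.m_closed)
    thus ?thesis using c u \<Phi> by simp
  qed
  have eqI: "\<Phi> d = r" if "d \<in> D" "good d s" "r \<in> carrier R" "r \<otimes>\<^bsub>R\<^esub> \<phi> s = \<phi> (s \<otimes> d)" for d s r
  proof -
    have u: "\<phi> s \<in> Units R" using units that(2) unfolding good_def by blast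
    have "\<Phi> d \<otimes>\<^bsub>R\<^esub> \<phi> s = r \<otimes>\<^bsub>R\<^esub> \<phi> s" using char[OF that(1,2)] that(4) by simp
    thus ?thesis using u char[OF that(1,2)] that(3) by (metis R.Units_closed R.Units_l_cancel R.m_comm)
  qed
  have ex: "\<exists>s. good d s" if "d \<in> D" for d using denominator[OF that] unfolding good_def by blast
  have "\<Phi> \<in> ring_hom DR R"
  proof (rule ring_hom_memI; unfold DR_simps)
    fix c d assume cd: "c \<in> D" "d \<in> D"
    obtain s t where st: "good c s" "good d t" using ex cd by blast
    show "\<Phi> c \<in> carrier R" using char[OF cd(1) st(1)] by blast
    note C = char[OF cd(1) st(1)] char[OF cd(2) st(2)]
    have Cc: "\<Phi> c \<in> carrier R" "\<Phi> d \<in> carrier R" using C by auto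
    note st' = st[unfolded good_def]
    have sc: "s \<in> carrier L" "t \<in> carrier L" "c \<in> carrier L" "d \<in> carrier L" using st' cd B_D D_carrier by auto
    have \<phi>c: "\<phi> s \<in> carrier R" "\<phi> t \<in> carrier R" using st' \<phi>_closed by auto
    have stB: "s \<otimes> t \<in> B" "s \<otimes> t \<notin> (\<otimes>) y ` D"
      using st' B_mult not_multiple_mult B_D by auto
    have e1: "s \<otimes> t \<otimes> (c \<otimes> d) = (s \<otimes> c) \<otimes> (t \<otimes> d)" using sc by (simp add: m_ac)
    have e2: "s \<otimes> t \<otimes> (c \<oplus> d) = t \<otimes> (s \<otimes> c) \<oplus> s \<otimes> (t \<otimes> d)" using sc by (simp add: r_distr m_ac)
    have g: "good (c \<otimes> d) (s \<otimes> t)" "good (c \<oplus> d) (s \<otimes> t)"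
      unfolding good_def e1 e2 using stB st' B_mult B_add by auto
    show "\<Phi> (c \<otimes> d) = \<Phi> c \<otimes>\<^bsub>R\<^esub> \<Phi> d"
    proof (rule eqI[OF D_mult[OF cd] g(1)])
      show "\<Phi> c \<otimes>\<^bsub>R\<^esub> \<Phi> d \<in> carrier R" using C by simp
      have "\<Phi> c \<otimes>\<^bsub>R\<^esub> \<Phi> d \<otimes>\<^bsub>R\<^esub> \<phi> (s \<otimes> t) = (\<Phi> c \<otimes>\<^bsub>R\<^esub> \<phi> s) \<otimes>\<^bsub>R\<^esub> (\<Phi> d \<otimes>\<^bsub>R\<^esub> \<phi> t)"
        using Cc \<phi>c st' by (simp add: \<phi>_mult R.m_ac)
      also have "\<dots> = \<phi> (s \<otimes> c) \<otimes>\<^bsub>R\<^esub> \<phi> (t \<otimes> d)" using C by simp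
      finally show "\<Phi> c \<otimes>\<^bsub>R\<^esub> \<Phi> d \<otimes>\<^bsub>R\<^esub> \<phi> (s \<otimes> t) = \<phi> (s \<otimes> t \<otimes> (c \<otimes> d))"
        using st' by (simp add: e1 \<phi>_mult)
    qed
    show "\<Phi> (c \<oplus> d) = \<Phi> c \<oplus>\<^bsub>R\<^esub> \<Phi> d"
    proof (rule eqI[OF D_add[OF cd] g(2)])
      show "\<Phi> c \<oplus>\<^bsub>R\<^esub> \<Phi> d \<in> carrier R" using C by simp
      have "(\<Phi> c \<oplus>\<^bsub>R\<^esub> \<Phi> d) \<otimes>\<^bsub>R\<^esub> \<phi> (s \<otimes> t)
          = \<phi> t \<otimes>\<^bsub>R\<^esub> (\<Phi> c \<otimes>\<^bsub>R\<^esub> \<phi> s) \<oplus>\<^bsub>R\<^esub> \<phi> s \<otimes>\<^bsub>R\<^esub> (\<Phi> d \<otimes>\<^bsub>R\<^esub> \<phi> t)"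
        using Cc \<phi>c st' by (simp add: \<phi>_mult R.l_distr R.r_distr R.m_ac)
      also have "\<dots> = \<phi> t \<otimes>\<^bsub>R\<^esub> \<phi> (s \<otimes> c) \<oplus>\<^bsub>R\<^esub> \<phi> s \<otimes>\<^bsub>R\<^esub> \<phi> (t \<otimes> d)" using C by simp
      finally show "(\<Phi> c \<oplus>\<^bsub>R\<^esub> \<Phi> d) \<otimes>\<^bsub>R\<^esub> \<phi> (s \<otimes> t) = \<phi> (s \<otimes> t \<otimes> (c \<oplus> d))"
        using st' by (simp add: e2 \<phi>_mult \<phi>_add B_mult)
    qed
  next
    show "\<Phi> \<one> = \<one>\<^bsub>R\<^esub>"
      using subringE(3)[OF B_subring] one_notin_yD
      by (intro eqI[OF D_one, of \<one>]) (auto simp: good_def \<phi>_one)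
  qed
  moreover have "\<Phi> b = \<phi> b" if b: "b \<in> B" for b
    using subringE(3)[OF B_subring] one_notin_yD b B_D D_carrier
    by (intro eqI[OF B_D[OF b], of \<one>]) (auto simp: good_def \<phi>_one \<phi>_closed)
  ultimately show thesis using that by blast
qed

text \<open>A nonzero element of \<open>D\<close> is \<open>y ^ n\<close> times a unit, so whether
  it is killed depends only on \<open>n\<close> and on the least exponent \<open>a\<close> with
  \<open>\<Phi> y [^] a = \<zero>\<close>.\<close>

lemma hom_kernel:
  assumes R: "cring R" and \<Phi>: "\<Phi> \<in> ring_hom DR R" and \<pi>: "\<Phi> y [^]\<^bsub>R\<^esub> a = \<zero>\<^bsub>R\<^esub>"
    "\<And>n. n < a \<Longrightarrow> \<Phi> y [^]\<^bsub>R\<^esub> (n::nat) \<noteq> \<zero>\<^bsub>R\<^esub>"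
  shows "a_kernel DR R \<Phi> = PIdl\<^bsub>DR\<^esub> (y [^] a)"
proof -
  interpret R: cring R by fact
  interpret DR: cring DR by (rule DR_cring)
  interpret \<Phi>: ring_hom_cring DR R \<Phi> by unfold_locales (rule \<Phi>)
  have \<Phi>m: "\<Phi> (c \<otimes> d) = \<Phi> c \<otimes>\<^bsub>R\<^esub> \<Phi> d" if "c \<in> D" "d \<in> D" for c d
    using \<Phi>.hom_mult[of c d] that by (simp add: DR_simps)
  have \<Phi>c: "\<Phi> c \<in> carrier R" if "c \<in> D" for c using \<Phi>.hom_closed[of c] that by (simp add: DR_simps)
  have \<Phi>y: "\<Phi> (y [^] n) = \<Phi> y [^]\<^bsub>R\<^esub> n" for n :: nat
    using \<Phi>.ring.hom_nat_pow[of y n] y_D by (simp add: DR_simps DR_pow)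
  have "d \<in> (\<otimes>) (y [^] a) ` D" if d: "d \<in> D" "\<Phi> d = \<zero>\<^bsub>R\<^esub>" for d
  proof (cases "d = \<zero>")
    case True
    thus ?thesis using D_zero y_carrier by (intro image_eqI[of _ _ \<zero>]) auto
  next
    case False
    then obtain n :: nat and w where w: "w \<in> D" "w \<noteq> \<zero>" "inv w \<in> D" "d = y [^] n \<otimes> w"
      using unit_or_multiple d by blast
    have "y [^] n = d \<otimes> inv w" unfolding w(4) using w D_carrier y_carrier field_Units by (simp add: m_assoc)
    hence "\<Phi> y [^]\<^bsub>R\<^esub> n = \<Phi> d \<otimes>\<^bsub>R\<^esub> \<Phi> (inv w)" using \<Phi>m[OF d(1) w(3)] \<Phi>y by metis
    hence "\<Phi> y [^]\<^bsub>R\<^esub> n = \<zero>\<^bsub>R\<^esub>" using d(2) \<Phi>c[OF w(3)] by simp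
    hence "a \<le> n" using \<pi>(2) not_le by blast
    then obtain k where "n = a + k" using le_Suc_ex by blast
    hence "d = y [^] a \<otimes> (y [^] k \<otimes> w)" using w D_carrier y_carrier by (simp add: nat_pow_mult[symmetric] m_assoc)
    moreover have "y [^] k \<otimes> w \<in> D" using w y_D by (auto intro: D_mult D_pow)
    ultimately show ?thesis by blast
  qed
  moreover have "\<Phi> (y [^] a \<otimes> d) = \<zero>\<^bsub>R\<^esub>" if "d \<in> D" for d
    using \<Phi>m[OF D_pow[OF y_D] that] \<Phi>y \<pi>(1) \<Phi>c[OF that] by simp
  ultimately show ?thesis
    unfolding DR_PIdl[OF D_pow[OF y_D]] a_kernel_def' DR_simps using D_pow[OF y_D] by (auto intro: D_mult)
qed

end

section \<open>Evaluation of integer polynomials\<close>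

text \<open>Connects evaluation of coefficient lists, as in the statement, with evaluation of typed
  polynomials, as in the proof.\<close>

lemma (in type_ring_hom) eval_list_eq_peval:
  assumes "x \<in> carrier A"
  shows "eval (rev (map \<phi> (coeffs q))) x = peval A \<phi> x q"
proof -
  interpret poly_evaluation A \<phi> x by unfold_locales (rule assms)
  show ?thesis
  proof (induction q)
    case 0
    show ?case by (simp add: peval_0)
  next
    case (pCons a q)
    have "rev (map \<phi> (coeffs (pCons a q))) = rev (map \<phi> (coeffs q)) @ [\<phi> a]"
      using pCons.hyps by (auto simp: cCons_def)
    also have "eval \<dots> x = eval (rev (map \<phi> (coeffs q))) x \<otimes> x \<oplus> \<phi> a"
      using assms by (subst eval_append) auto
    also have "\<dots> = \<phi> a \<oplus> x \<otimes> peval A \<phi> x q"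
      unfolding pCons.IH using assms peval_closed by (simp add: a_comm m_comm)
    finally show ?case by (simp add: peval_pCons)
  qed
qed

lemma (in cring) int_eval_eq_peval:
  assumes "x \<in> carrier R"
  shows "int_eval R (rev (coeffs q)) x = peval R (int_img R) x q"
  using type_ring_hom.eval_list_eq_peval[OF int_img_hom assms, of q] by (simp add: int_eval_def rev_map)

lemma type_ring_id_hom: "domain_type_hom (type_ring :: 'c :: idom ring) (\<lambda>c. c)"
proof -
  interpret cring "type_ring :: 'c ring" by (rule type_ring_cring)
  show ?thesis by unfold_locales auto
qed

lemma type_ring_list_poly: "list_poly (type_ring :: 'c :: idom ring) (\<lambda>c. c) q = rev (coeffs q)"
proof (cases "q = 0")
  case True
  interpret domain_type_hom "type_ring :: 'c ring" "\<lambda>c. c" by (rule type_ring_id_hom)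
  show ?thesis using True by (simp add: list_poly_def)
next
  case False
  interpret domain_type_hom "type_ring :: 'c ring" "\<lambda>c. c" by (rule type_ring_id_hom)
  show ?thesis using list_poly_explicit[OF False] False by simp
qed

lemma monic_int_list:
  assumes "Defs.monic \<Z> l"
  obtains h where "l = rev (coeffs h)" "Polynomial.lead_coeff h = 1" "Polynomials.degree l = Polynomial.degree h"
proof -
  interpret domain_type_hom "\<Z>" "\<lambda>c. c" by (rule type_ring_id_hom)
  obtain h where h: "list_poly \<Z> (\<lambda>c. c) h = l" using list_poly_surj[of l] assms unfolding Defs.monic_def by auto
  hence l: "l = rev (coeffs h)" by (simp add: type_ring_list_poly)
  hence "h \<noteq> 0" using assms unfolding Defs.monic_def by auto
  hence "Polynomial.lead_coeff h = 1"
    using assms unfolding Defs.monic_def l by (simp add: hd_rev last_coeffs_eq_coeff_degree)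
  thus thesis using that l \<open>h \<noteq> 0\<close> by (simp add: length_coeffs)
qed

section \<open>Irreducibility modulo a prime\<close>

lemma ZFact_field:
  assumes p: "Factorial_Ring.prime (p :: nat)"
  shows "field (ZFact (int p))"
proof -
  interpret cring "ZFact (int p)" by (rule ZFact_is_cring)
  interpret I: ideal "Idl\<^bsub>\<Z>\<^esub> {int p}" \<Z> by (rule int.genideal_ideal) simp
  define \<zeta> where "\<zeta> = (\<lambda>c. Idl\<^bsub>\<Z>\<^esub> {int p} +>\<^bsub>\<Z>\<^esub> c)"
  have mem: "c \<in> Idl\<^bsub>\<Z>\<^esub> {int p} \<longleftrightarrow> int p dvd c" for c
    unfolding int_Idl by (auto simp: dvd_def mult.commute)
  have hom: "\<zeta> \<in> ring_hom \<Z> (ZFact (int p))" unfolding \<zeta>_def ZFact_def by (rule I.rcos_ring_hom)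
  interpret \<zeta>: type_ring_hom "ZFact (int p)" \<zeta> by (rule type_ring_homI[OF ZFact_is_cring hom])
  have zero: "\<zeta> c = \<zero>\<^bsub>ZFact (int p)\<^esub> \<longleftrightarrow> int p dvd c" for c
    unfolding \<zeta>_def ZFact_def using I.rcos_eq_zero_iff[of c] mem by simp
  show ?thesis
  proof (rule cring_fieldI2)
    show "\<zero>\<^bsub>ZFact (int p)\<^esub> \<noteq> \<one>\<^bsub>ZFact (int p)\<^esub>" using zero[of 1] p \<zeta>.hom_one by auto
    fix a assume a: "a \<in> carrier (ZFact (int p))" "a \<noteq> \<zero>\<^bsub>ZFact (int p)\<^esub>"
    then obtain c where c: "a = \<zeta> c" unfolding ZFact_def carrier_FactRing \<zeta>_def by auto
    hence "coprime (int p) c" using a(2) zero p by (simp add: prime_imp_coprime)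
    then obtain u v where "u * int p + v * c = 1" using bezout_int[of "int p" c] by auto
    hence "\<zeta> (u * int p + c * v) = \<one>\<^bsub>ZFact (int p)\<^esub>" using \<zeta>.hom_one by (simp add: mult.commute)
    moreover have "\<zeta> (u * int p) = \<zero>\<^bsub>ZFact (int p)\<^esub>" using zero by simp
    ultimately have "a \<otimes>\<^bsub>ZFact (int p)\<^esub> \<zeta> v = \<one>\<^bsub>ZFact (int p)\<^esub>"
      by (simp add: \<zeta>.hom_add \<zeta>.hom_mult c)
    thus "\<exists>b\<in>carrier (ZFact (int p)). a \<otimes>\<^bsub>ZFact (int p)\<^esub> b = \<one>\<^bsub>ZFact (int p)\<^esub>"
      by (intro bexI[of _ "\<zeta> v"]) auto
  qed
qed

text \<open>Maximality of (p, h) in terms of elements. By \<open>irreducible_mod_iff\<close> this is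
  irreducibility of \<open>h\<close> modulo \<open>p\<close>, in the form that can be evaluated in
  any ring.\<close>

definition ph_maximal :: "nat \<Rightarrow> int poly \<Rightarrow> bool" where
  "ph_maximal p h \<longleftrightarrow> 1 \<notin> ph_ideal p h \<and> (\<forall>q. q \<notin> ph_ideal p h \<longrightarrow> (\<exists>r. q * r - 1 \<in> ph_ideal p h))"

lemma smult_iff_coeff_dvd: "(\<exists>s. q = Polynomial.smult (c :: int) s) \<longleftrightarrow> (\<forall>i. c dvd poly.coeff q i)"
proof
  assume "\<forall>i. c dvd poly.coeff q i"
  hence "[:c:] dvd q" by (simp add: const_poly_dvd_iff)
  then obtain s where "q = [:c:] * s" by (rule dvdE)
  thus "\<exists>s. q = Polynomial.smult c s" by auto
qed auto

text \<open>The quotient \<open>\<int>[X]/(p, h)\<close> is realised as \<open>(\<int>/p)[X]/(h)\<close>.\<close>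

lemma ph_quotient:
  assumes p: "Factorial_Ring.prime (p :: nat)" and h: "Polynomial.lead_coeff h = 1" "Polynomial.degree h > 0"
  obtains E :: "int set list set ring" and \<psi>
  where "type_ring_hom E \<psi>" "\<psi> ` UNIV = carrier E" "\<And>q. \<psi> q = \<zero>\<^bsub>E\<^esub> \<longleftrightarrow> q \<in> ph_ideal p h"
    "field E \<longleftrightarrow> irreducible_mod p (rev (coeffs h))"
proof -
  define \<zeta> where "\<zeta> = (\<lambda>c. Idl\<^bsub>\<Z>\<^esub> {int p} +>\<^bsub>\<Z>\<^esub> c)"
  interpret I: ideal "Idl\<^bsub>\<Z>\<^esub> {int p}" \<Z> by (rule int.genideal_ideal) simp
  have mem: "c \<in> Idl\<^bsub>\<Z>\<^esub> {int p} \<longleftrightarrow> int p dvd c" for c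
    unfolding int_Idl by (auto simp: dvd_def mult.commute)
  have hom: "\<zeta> \<in> ring_hom \<Z> (ZFact (int p))" unfolding \<zeta>_def ZFact_def by (rule I.rcos_ring_hom)
  interpret F: field "ZFact (int p)" by (rule ZFact_field[OF p])
  interpret \<zeta>: type_ring_hom "ZFact (int p)" \<zeta> by (rule type_ring_homI[OF ZFact_is_cring hom])
  have zero: "\<zeta> c = \<zero>\<^bsub>ZFact (int p)\<^esub> \<longleftrightarrow> int p dvd c" for c
    unfolding \<zeta>_def ZFact_def using I.rcos_eq_zero_iff[of c] mem by simp
  interpret M: monic_quotient "ZFact (int p)" \<zeta> h
    using h by unfold_locales (auto simp: ZFact_def carrier_FactRing \<zeta>_def)
  have poly: "poly_mod \<Z> (Idl\<^bsub>\<Z>\<^esub> {int p}) (rev (coeffs h)) = list_poly (ZFact (int p)) \<zeta> h"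
    unfolding poly_mod_def list_poly_def \<zeta>_def ZFact_def by (simp add: rev_map)
  have "M.\<psi> q = \<zero>\<^bsub>M.L\<^esub> \<longleftrightarrow> q \<in> ph_ideal p h" for q
  proof -
    have "M.\<psi> q = \<zero>\<^bsub>M.L\<^esub> \<longleftrightarrow> (\<exists>a s. q - h * a = Polynomial.smult (int p) s)"
      unfolding M.\<psi>_eq_0_iff zero smult_iff_coeff_dvd ..
    also have "\<dots> \<longleftrightarrow> q \<in> ph_ideal p h" unfolding ph_ideal_def by (auto simp: algebra_simps)
    finally show ?thesis .
  qed
  moreover have "field M.L \<longleftrightarrow> irreducible_mod p (rev (coeffs h))"
    unfolding irreducible_mod_def poly
    by (rule F.rupture_is_field_iff_pirreducible[OF F.carrier_is_subfield \<zeta>.list_poly_closed])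
  ultimately show thesis using that[OF M.\<psi>_hom M.\<psi>_surj] by blast
qed

text \<open>Both sides say that the quotient \<open>E\<close> is a field: inverses in
  \<open>E\<close> correspond to inverses modulo (p, h) along the surjection from Z[X].\<close>

lemma irreducible_mod_iff:
  assumes p: "Factorial_Ring.prime (p :: nat)" and h: "Polynomial.lead_coeff h = 1" "Polynomial.degree h > 0"
  shows "irreducible_mod p (rev (coeffs h)) \<longleftrightarrow> ph_maximal p h"
proof -
  obtain E :: "int set list set ring" and \<psi> where E: "type_ring_hom E \<psi>" "\<psi> ` UNIV = carrier E"
    "\<And>q. \<psi> q = \<zero>\<^bsub>E\<^esub> \<longleftrightarrow> q \<in> ph_ideal p h"
    "field E \<longleftrightarrow> irreducible_mod p (rev (coeffs h))"
  proof (rule ph_quotient[OF assms])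
  qed (rule that)
  interpret type_ring_hom E \<psi> by (rule E(1))
  have eq1: "\<psi> q \<otimes>\<^bsub>E\<^esub> \<psi> r = \<one>\<^bsub>E\<^esub> \<longleftrightarrow> q * r - 1 \<in> ph_ideal p h" for q r
    using hom_eq_iff[of "q * r" 1] E(3)[of "q * r - 1"] by (simp add: hom_mult hom_one)
  have eq0: "\<zero>\<^bsub>E\<^esub> \<noteq> \<one>\<^bsub>E\<^esub> \<longleftrightarrow> 1 \<notin> ph_ideal p h" using E(3)[of 1] hom_one by auto
  show ?thesis unfolding E(4)[symmetric]
  proof
    assume "field E"
    then interpret F: field E .
    have "\<exists>r. q * r - 1 \<in> ph_ideal p h" if "q \<notin> ph_ideal p h" for q
    proof -
      have "\<psi> q \<noteq> \<zero>\<^bsub>E\<^esub>" using E(3) that by blast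
      hence u: "\<psi> q \<in> Units E" using F.field_Units by simp
      then obtain r where "inv\<^bsub>E\<^esub> \<psi> q = \<psi> r" using E(2) Units_inv_closed by blast
      thus ?thesis using eq1 u Units_r_inv by metis
    qed
    thus "ph_maximal p h" unfolding ph_maximal_def using eq0 F.one_not_zero by auto
  next
    assume max: "ph_maximal p h"
    show "field E"
    proof (rule cring_fieldI2)
      show "\<zero>\<^bsub>E\<^esub> \<noteq> \<one>\<^bsub>E\<^esub>" using eq0 max unfolding ph_maximal_def by blast
      fix a assume a: "a \<in> carrier E" "a \<noteq> \<zero>\<^bsub>E\<^esub>"
      then obtain q where q: "a = \<psi> q" using E(2) by blast
      hence "q \<notin> ph_ideal p h" using E(3) a by blast
      then obtain r where "q * r - 1 \<in> ph_ideal p h" using max unfolding ph_maximal_def by blast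
      thus "\<exists>b\<in>carrier E. a \<otimes>\<^bsub>E\<^esub> b = \<one>\<^bsub>E\<^esub>" unfolding q using eq1 hom_closed by blast
    qed
  qed
qed

lemma ph_maximal_degree:
  assumes "ph_maximal p h" "Polynomial.lead_coeff h = 1"
  shows "Polynomial.degree h > 0"
proof (rule ccontr)
  assume "\<not> Polynomial.degree h > 0"
  hence "h = 1" using assms(2) by (metis degree_eq_zeroE gr0I lead_coeff_pCons(2) one_pCons)
  hence "1 = Polynomial.smult (int p) 0 + h * 1" by simp
  thus False using assms(1) unfolding ph_maximal_def ph_ideal_def by blast
qed

text \<open>Division by \<open>h\<close> followed by reduction of the coefficients modulo
  \<open>p\<close> shows that each class has exactly one representative of degree below
  \<open>d\<close> with coefficients in \<open>{0..<p}\<close>.\<close>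

lemma card_ph_quotient:
  assumes \<phi>: "type_ring_hom A \<phi>" and ker: "\<And>q. \<phi> q = \<zero>\<^bsub>A\<^esub> \<longleftrightarrow> q \<in> ph_ideal p h"
    and h: "Polynomial.lead_coeff h = 1" "Polynomial.degree h > 0" and p: "p > 0"
  shows "card (range \<phi>) = p ^ Polynomial.degree h"
proof -
  interpret type_ring_hom A \<phi> by fact
  define d where "d = Polynomial.degree h"
  define C where "C = ({..<d} \<rightarrow>\<^sub>E {0..<int p})"
  define Q where "Q = (\<lambda>c :: nat \<Rightarrow> int. \<Sum>i<d. Polynomial.monom (c i) i)"
  have coeff_Q: "poly.coeff (Q c) i = (if i < d then c i else 0)" for c i
    unfolding Q_def by (simp add: coeff_sum)
  have deg_Q: "Polynomial.degree (Q c) < d" for c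
    using h(2) coeff_Q[of c] unfolding d_def by (metis degree_0 leading_coeff_0_iff)
  have "inj_on (\<lambda>c. \<phi> (Q c)) C"
  proof (rule inj_onI)
    fix b c assume bc: "b \<in> C" "c \<in> C" "\<phi> (Q b) = \<phi> (Q c)"
    have "Q b - Q c \<in> ph_ideal p h" using bc(3) hom_eq_iff ker by blast
    moreover have "Polynomial.degree (Q b - Q c) < Polynomial.degree h"
      using degree_diff_less[OF deg_Q deg_Q] unfolding d_def .
    ultimately obtain s where s: "Q b - Q c = Polynomial.smult (int p) s"
      using ph_ideal_small_degree[OF h] by metis
    show "b = c"
    proof (rule PiE_ext[OF bc(1,2)[unfolded C_def]])
      fix i assume i: "i \<in> {..<d}"
      hence "b i - c i = int p * poly.coeff s i"
        using arg_cong[OF s, of "\<lambda>q. poly.coeff q i"] coeff_Q by simp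
      hence "b i mod int p = c i mod int p" unfolding mod_eq_dvd_iff by (rule dvdI)
      moreover have "b i \<in> {0..<int p}" "c i \<in> {0..<int p}"
        using bc(1,2) i unfolding C_def by blast+
      ultimately show "b i = c i" by simp
    qed
  qed
  moreover have "(\<lambda>c. \<phi> (Q c)) ` C = range \<phi>"
  proof
    show "range \<phi> \<subseteq> (\<lambda>c. \<phi> (Q c)) ` C"
    proof
      fix a assume "a \<in> range \<phi>"
      then obtain q where q: "a = \<phi> q" by blast
      obtain t r where r: "q = h * t + r" "Polynomial.degree r < d"
        using monic_division[OF h] unfolding d_def by blast
      define c where "c = restrict (\<lambda>i. poly.coeff r i mod int p) {..<d}"
      have "r - Q c = Polynomial.smult (int p) (\<Sum>i<d. Polynomial.monom (poly.coeff r i div int p) i)"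
      proof (rule poly_eqI)
        fix i
        show "poly.coeff (r - Q c) i
            = poly.coeff (Polynomial.smult (int p) (\<Sum>i<d. Polynomial.monom (poly.coeff r i div int p) i)) i"
          using r(2) by (simp add: coeff_Q c_def coeff_sum coeff_eq_0 minus_mod_eq_mult_div)
      qed
      hence "q - Q c = Polynomial.smult (int p) (\<Sum>i<d. Polynomial.monom (poly.coeff r i div int p) i) + h * t"
        unfolding r(1) by (simp add: algebra_simps)
      hence "q - Q c \<in> ph_ideal p h" unfolding ph_ideal_def by blast
      hence "a = \<phi> (Q c)" by (simp only: q hom_eq_iff[of q] ker)
      moreover have "c \<in> C" unfolding C_def c_def using p by auto
      ultimately show "a \<in> (\<lambda>c. \<phi> (Q c)) ` C" by blast
    qed
  qed auto
  moreover have "card C = p ^ d" unfolding C_def by (simp add: card_PiE)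
  ultimately show ?thesis unfolding d_def using card_image by metis
qed

section \<open>Finite residue fields\<close>

text \<open>Every element is \<open>k v + w\<close> for exactly one pair: two representations with
  different \<open>k\<close> would express \<open>v\<close> in \<open>E\<close>.\<close>

lemma (in ring) line_extension_card:
  assumes K: "subfield K R" and E: "subalgebra K E R" and v: "v \<in> carrier R" "v \<notin> E"
    and fin: "finite K" "finite E"
  shows "finite (line_extension K v E)" "card (line_extension K v E) = card K * card E"
proof -
  interpret E: subalgebra K E R by fact
  have Kc: "K \<subseteq> carrier R" by (rule subfieldE(3)[OF K])
  have Ec: "E \<subseteq> carrier R" by (rule subgroup.subset[OF E.subgroup_axioms, simplified])
  have eq: "line_extension K v E = (\<lambda>(k, w). k \<otimes> v \<oplus> w) ` (K \<times> E)"
    by (fastforce simp: line_extension_mem_iff image_iff)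
  have "inj_on (\<lambda>(k, w). k \<otimes> v \<oplus> w) (K \<times> E)"
  proof (rule inj_onI, clarify)
    fix k w k' w' assume k: "k \<in> K" "k' \<in> K" and w: "w \<in> E" "w' \<in> E" and e: "k \<otimes> v \<oplus> w = k' \<otimes> v \<oplus> w'"
    have c: "k \<in> carrier R" "k' \<in> carrier R" "w \<in> carrier R" "w' \<in> carrier R" using k w Kc Ec by auto
    have "(k \<ominus> k') \<otimes> v = k \<otimes> v \<ominus> k' \<otimes> v"
      using c v(1) by (simp add: a_minus_def l_distr l_minus)
    also have "\<dots> = (k \<otimes> v \<oplus> w) \<ominus> w \<ominus> k' \<otimes> v"
      using c v(1) by (simp add: a_minus_def a_assoc r_neg)
    also have "\<dots> = w' \<ominus> w"
      unfolding e using c v(1) by (simp add: a_minus_def a_ac r_neg r_neg1 r_neg2)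
    finally have d: "(k \<ominus> k') \<otimes> v = w' \<ominus> w" .
    have dE: "w' \<ominus> w \<in> E"
      using subgroup.m_closed[OF E.subgroup_axioms, of w' "\<ominus> w"] subgroup.m_inv_closed[OF E.subgroup_axioms, of w] w
      by (simp add: a_minus_def a_inv_def)
    have "k = k'"
    proof (rule ccontr)
      assume "k \<noteq> k'"
      hence ne: "k \<ominus> k' \<noteq> \<zero>" using c by (simp add: r_right_minus_eq)
      have kk: "k \<ominus> k' \<in> K - {\<zero>}"
        using ne subringE(5,7)[OF subfieldE(1)[OF K]] k by (simp add: a_minus_def)
      note inv = subfield_m_inv[OF K kk]
      have "v = inv (k \<ominus> k') \<otimes> ((k \<ominus> k') \<otimes> v)"
        using inv kk v(1) Kc by (simp add: m_assoc[symmetric] subset_iff)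
      also have "\<dots> \<in> E" unfolding d using E.smult_closed[OF _ dE] inv(1) by simp
      finally show False using v(2) by simp
    qed
    moreover from this have "w = w'" using e c v(1) by simp
    ultimately show "k = k' \<and> w = w'" by simp
  qed
  thus "card (line_extension K v E) = card K * card E" "finite (line_extension K v E)"
    unfolding eq using fin by (simp_all add: card_image card_cartesian_product)
qed

text \<open>Turns the residue degree, given as a dimension over the prime field, into a count of
  elements.\<close>

lemma (in ring) dimension_card:
  assumes K: "subfield K R" "finite K" and dim: "dimension n K E"
  shows "finite E \<and> card E = card K ^ n"
  using dim
proof (induction n arbitrary: E)
  case 0
  have "E = {\<zero>}" by (rule dimension_zero[OF K(1) 0])
  thus ?case by simp
next
  case (Suc n)
  then obtain v E' where v: "v \<in> carrier R" "dimension n K E'" "v \<notin> E'" "E = line_extension K v E'"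
    using dimension_backwards[OF K(1) Suc.prems] by blast
  have "subalgebra K E' R"
    using finite_dimension_imp_subalgebra[OF K(1) finite_dimensionI[OF v(2)]] .
  from line_extension_card[OF K(1) this v(1,3) K(2)] Suc.IH[OF v(2)] show ?case unfolding v(4) by simp
qed

text \<open>\<open>has_char\<close> admits characteristic 0; finiteness rules it out, because the
  integers would embed.\<close>

lemma (in field) char_prime:
  assumes "finite (carrier R)" "has_char R p"
  shows "Factorial_Ring.prime p"
proof -
  interpret i: type_ring_hom R "int_img R" by (rule int_img_hom)
  have 0: "int_img R n = \<zero> \<longleftrightarrow> int p dvd n" for n using assms(2) unfolding has_char_def by blast
  have "p \<noteq> 0"
  proof
    assume p0: "p = 0"
    have "inj (int_img R)"
    proof (rule injI)
      fix m n assume "int_img R m = int_img R n"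
      hence "int p dvd m - n" by (simp only: i.hom_eq_iff 0)
      thus "m = n" unfolding p0 by simp
    qed
    moreover have "finite (range (int_img R))" by (rule finite_subset[OF _ assms(1)]) auto
    ultimately have "finite (UNIV :: int set)" by (rule finite_imageD[rotated])
    thus False by simp
  qed
  moreover have "\<not> p dvd 1"
  proof
    assume "p dvd 1"
    hence "int_img R 1 = \<zero>" unfolding 0 by simp
    thus False using i.hom_one one_not_zero by simp
  qed
  moreover have "p dvd a \<or> p dvd b" if "p dvd a * b" for a b
  proof -
    have "int_img R (int a * int b) = \<zero>" unfolding 0 of_nat_mult[symmetric] of_nat_dvd_iff by (rule that)
    hence "int_img R (int a) = \<zero> \<or> int_img R (int b) = \<zero>"
      unfolding i.hom_mult by (rule integral) auto
    thus ?thesis unfolding 0 of_nat_dvd_iff .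
  qed
  ultimately have "prime_elem p" unfolding prime_elem_def by blast
  thus ?thesis unfolding Factorial_Ring.prime_def by simp
qed

lemma (in field) prime_subring_subfield:
  assumes p: "Factorial_Ring.prime p" and char: "has_char R p"
  shows "subfield (prime_subring R) R" "finite (prime_subring R)" "card (prime_subring R) = p"
proof -
  interpret i: type_ring_hom R "int_img R" by (rule int_img_hom)
  have 0: "int_img R n = \<zero> \<longleftrightarrow> int p dvd n" for n using char unfolding has_char_def by blast
  have sub: "subring (prime_subring R) R"
    unfolding prime_subring_def
  proof (rule subringI)
    show "\<one> \<in> range (int_img R)" using i.hom_one by (metis rangeI)
    show "range (int_img R) \<subseteq> carrier R" by auto
  qed (auto simp: i.hom_uminus[symmetric] i.hom_add[symmetric] i.hom_mult[symmetric])
  show "subfield (prime_subring R) R"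
  proof (rule subfieldI'[OF sub])
    fix k assume k: "k \<in> prime_subring R - {\<zero>}"
    then obtain n where n: "k = int_img R n" unfolding prime_subring_def by blast
    hence "coprime (int p) n" using k 0 p by (simp add: prime_imp_coprime)
    then obtain u v where uv: "u * int p + v * n = 1" using bezout_int[of "int p" n] by auto
    have "int_img R (u * int p + n * v) = \<one>" using uv i.hom_one by (simp add: mult.commute)
    moreover have "int_img R (u * int p) = \<zero>" using 0 by simp
    ultimately have "k \<otimes> int_img R v = \<one>" by (simp add: i.hom_add i.hom_mult n)
    hence "inv k = int_img R v" using n by (intro comm_inv_char) auto
    thus "inv k \<in> prime_subring R" unfolding prime_subring_def by blast
  qed
  have p0: "p > 0" using p prime_gt_0_nat by blast
  have "prime_subring R = int_img R ` {0..<int p}"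
    unfolding prime_subring_def
  proof safe
    fix n
    have "int_img R n = int_img R (n mod int p)"
      unfolding i.hom_eq_iff[of n] 0 by (simp add: minus_mod_eq_mult_div)
    thus "int_img R n \<in> int_img R ` {0..<int p}" using p0 by auto
  qed auto
  moreover have "inj_on (int_img R) {0..<int p}"
  proof (rule inj_onI)
    fix m n assume mn: "m \<in> {0..<int p}" "n \<in> {0..<int p}" "int_img R m = int_img R n"
    hence "m mod int p = n mod int p" unfolding mod_eq_dvd_iff using i.hom_eq_iff 0 by blast
    thus "m = n" using mn by simp
  qed
  ultimately show "finite (prime_subring R)" "card (prime_subring R) = p"
    by (simp_all add: card_image)
qed

lemma (in field) finite_field_pow_card:
  assumes "finite (carrier R)" "x \<in> carrier R"
  shows "x [^] card (carrier R) = x"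
proof -
  have c0: "card (carrier R) > 0" using assms by (auto simp: card_gt_0_iff)
  show ?thesis
  proof (cases "x = \<zero>")
    case True
    thus ?thesis using c0 by (simp add: nat_pow_zero)
  next
    case False
    let ?M = "Multiplicative_Group.mult_of R"
    interpret M: Group.group ?M by (rule field_mult_group)
    have "x [^]\<^bsub>?M\<^esub> order ?M = \<one>\<^bsub>?M\<^esub>"
      using False assms(2) by (intro M.pow_order_eq_1) (simp add: Multiplicative_Group.carrier_mult_of)
    hence "x [^] (card (carrier R) - 1) = \<one>"
      using Multiplicative_Group.field.order_mult_of[OF field_axioms assms(1)]
      by (simp add: Multiplicative_Group.nat_pow_mult_of Multiplicative_Group.one_mult_of order_def)
    hence "x [^] Suc (card (carrier R) - 1) = x" using assms(2) by simp
    thus ?thesis using c0 by simp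
  qed
qed

lemma (in field) card_roots_le_degree:
  assumes "q \<in> carrier (poly_ring R)" "q \<noteq> []"
  shows "card {x \<in> carrier R. eval q x = \<zero>} \<le> Polynomials.degree q"
proof -
  have "{x \<in> carrier R. eval q x = \<zero>} = set_mset (roots q)"
    using roots_mem_iff_is_root[OF assms(1)] assms(2) unfolding is_root_def by auto
  hence "card {x \<in> carrier R. eval q x = \<zero>} \<le> size (roots q)"
    using sum_mono[of "set_mset (roots q)" "\<lambda>_. 1" "count (roots q)"] by (simp add: size_multiset_overloaded_eq)
  thus ?thesis using size_roots_le_degree[OF assms(1)] by simp
qed

lemma X_power_minus_X:
  assumes "n > 1"
  shows "Polynomial.degree ([:0, 1:] ^ n - [:0, 1:] :: int poly) = n"
    and "Polynomial.lead_coeff ([:0, 1:] ^ n - [:0, 1:] :: int poly) = 1"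
proof -
  have eq: "[:0, 1:] ^ n - [:0, 1:] = Polynomial.monom (1 :: int) n - [:0, 1:]" by (simp add: monom_altdef)
  have c: "poly.coeff (Polynomial.monom (1 :: int) n - [:0, 1:]) n = 1"
    using assms by (simp add: coeff_pCons split: nat.splits)
  moreover have "Polynomial.degree (Polynomial.monom (1 :: int) n - [:0, 1:]) \<le> n"
    using assms by (intro degree_diff_le) (auto simp: degree_monom_eq)
  moreover have "n \<le> Polynomial.degree (Polynomial.monom (1 :: int) n - [:0, 1:])"
    using c by (intro le_degree) simp
  ultimately show "Polynomial.degree ([:0, 1:] ^ n - [:0, 1:] :: int poly) = n" unfolding eq by simp
  thus "Polynomial.lead_coeff ([:0, 1:] ^ n - [:0, 1:] :: int poly) = 1" unfolding eq using c by simp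
qed

text \<open>
  Since \<open>X^q - X\<close> vanishes in \<open>\<int>[X]/(p, h)\<close>, a field with \<open>q = p^f\<close> elements, it is divisible by \<open>h\<close>
  modulo \<open>p\<close>; as all \<open>q\<close> elements of \<open>R\<close> are roots of it, one of them is a root of \<open>h\<close>.  The root
  is simple, the derivative of \<open>X^q - X\<close> being \<open>-1\<close>.
\<close>

lemma (in field) ph_root:
  assumes fin: "finite (carrier R)" and char: "has_char R p"
    and h: "Polynomial.lead_coeff h = 1" "ph_maximal p h" and card: "card (carrier R) = p ^ Polynomial.degree h"
  obtains \<beta> where "\<beta> \<in> carrier R" "peval R (int_img R) \<beta> h = \<zero>" "peval R (int_img R) \<beta> (pderiv h) \<noteq> \<zero>"
proof -
  have p: "Factorial_Ring.prime p" by (rule char_prime[OF fin char])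
  have hd: "Polynomial.degree h > 0" by (rule ph_maximal_degree[OF h(2,1)])
  define n where "n = p ^ Polynomial.degree h"
  have n1: "n > 1" unfolding n_def using hd p prime_gt_1_nat by (metis one_less_power)
  obtain E :: "int set list set ring" and \<psi> where E: "type_ring_hom E \<psi>" "\<psi> ` UNIV = carrier E"
    "\<And>q. \<psi> q = \<zero>\<^bsub>E\<^esub> \<longleftrightarrow> q \<in> ph_ideal p h" "field E \<longleftrightarrow> irreducible_mod p (rev (coeffs h))"
  proof (rule ph_quotient[OF p h(1) hd])
  qed (rule that)
  interpret E: field E using E(4) irreducible_mod_iff[OF p h(1) hd] h(2) by blast
  interpret \<psi>: type_ring_hom E \<psi> by (rule E(1))
  have cE: "card (carrier E) = n" using card_ph_quotient[OF E(1,3) h(1) hd] E(2) p prime_gt_0_nat unfolding n_def by metis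
  hence "finite (carrier E)" using n1 card.infinite by fastforce
  hence "\<psi> [:0, 1:] [^]\<^bsub>E\<^esub> n = \<psi> [:0, 1:]" using E.finite_field_pow_card cE by auto
  hence "\<psi> ([:0, 1:] ^ n) = \<psi> [:0, 1:]" by (simp only: \<psi>.hom_power)
  hence "[:0, 1:] ^ n - [:0, 1:] \<in> ph_ideal p h" by (simp only: \<psi>.hom_eq_iff E(3))
  then obtain s t where st: "[:0, 1:] ^ n - [:0, 1:] = Polynomial.smult (int p) s + h * t"
    unfolding ph_ideal_def by blast
  interpret i: type_ring_hom R "int_img R" by (rule int_img_hom)
  interpret D: domain_type_hom R "int_img R" by unfold_locales
  have 0: "int_img R c = \<zero> \<longleftrightarrow> int p dvd c" for c using char unfolding has_char_def by blast
  have p0: "int_img R (int p) = \<zero>" using 0 by simp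
  have ev: "poly_evaluation R (int_img R) \<beta>" if "\<beta> \<in> carrier R" for \<beta> by unfold_locales (rule that)
  have \<Theta>eval: "eval (D.\<Theta> q) \<beta> = peval R (int_img R) \<beta> q" if "\<beta> \<in> carrier R" for q \<beta>
  proof -
    have "eval (D.\<Theta> q) \<beta> = eval (rev (map (int_img R) (coeffs q))) \<beta>"
      unfolding list_poly_def using that by (intro eval_normalize) auto
    thus ?thesis using i.eval_list_eq_peval[OF that] by simp
  qed
  interpret \<Theta>: type_ring_hom "poly_ring R" D.\<Theta> by (rule D.list_poly_hom)
  have "D.\<Theta> (Polynomial.smult (int p) s) = \<zero>\<^bsub>poly_ring R\<^esub>"
    unfolding D.list_poly_eq_0_iff using 0 by simp
  hence \<Theta>st: "D.\<Theta> ([:0, 1:] ^ n - [:0, 1:]) = D.\<Theta> h \<otimes>\<^bsub>poly_ring R\<^esub> D.\<Theta> t"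
    unfolding st by (simp add: \<Theta>.hom_add \<Theta>.hom_mult)
  note degX = X_power_minus_X[OF n1]
  have "\<exists>\<beta>\<in>carrier R. peval R (int_img R) \<beta> h = \<zero>"
  proof (rule ccontr)
    \<comment> \<open>Without a root of \<open>h\<close>, all \<open>n\<close> elements of the field
      would be roots of \<open>t\<close>, whose degree is \<open>n\<close> minus the degree of
      \<open>h\<close>.\<close>
    assume neg: "\<not> ?thesis"
    have tne: "D.\<Theta> t \<noteq> []"
    proof
      assume "D.\<Theta> t = []"
      hence "D.\<Theta> ([:0, 1:] ^ n - [:0, 1:]) = []"
        using \<Theta>st \<Theta>.r_null[OF \<Theta>.hom_closed] by (simp add: univ_poly_zero)
      thus False using i.list_poly_monic(2)[OF degX(2) one_not_zero] by simp
    qed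
    have hne: "D.\<Theta> h \<noteq> []" by (rule i.list_poly_monic(2)[OF h(1) one_not_zero])
    have "n = Polynomials.degree (D.\<Theta> ([:0, 1:] ^ n - [:0, 1:]))"
      using i.list_poly_monic(3)[OF degX(2) one_not_zero] degX(1) by simp
    also have "\<dots> = Polynomials.degree (D.\<Theta> h) + Polynomials.degree (D.\<Theta> t)"
      unfolding \<Theta>st univ_poly_mult
      using poly_mult_degree_eq[OF carrier_is_subring] i.list_poly_closed hne tne
      by (simp add: univ_poly_carrier)
    also have "Polynomials.degree (D.\<Theta> h) = Polynomial.degree h" by (rule i.list_poly_monic(3)[OF h(1) one_not_zero])
    finally have dt: "Polynomials.degree (D.\<Theta> t) < n" using hd by simp
    have "eval (D.\<Theta> t) \<beta> = \<zero>" if \<beta>: "\<beta> \<in> carrier R" for \<beta>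
    proof -
      interpret poly_evaluation R "int_img R" \<beta> by (rule ev[OF \<beta>])
      interpret e: type_ring_hom R "peval R (int_img R) \<beta>" by (rule peval_hom)
      have ps: "peval R (int_img R) \<beta> (Polynomial.smult (int p) s) = \<zero>"
        unfolding peval_smult p0 using peval_closed by simp
      have "peval R (int_img R) \<beta> ([:0, 1:] ^ n - [:0, 1:]) = \<beta> [^] n \<ominus> \<beta>"
        by (simp only: e.hom_diff e.hom_power peval_X)
      also have "\<dots> = \<zero>" using finite_field_pow_card[OF fin \<beta>] card \<beta> by (simp add: n_def r_right_minus_eq)
      finally have "peval R (int_img R) \<beta> h \<otimes> peval R (int_img R) \<beta> t = \<zero>"
        unfolding st peval_add ps peval_mult using peval_closed by simp
      thus ?thesis using neg \<beta> integral peval_closed \<Theta>eval[OF \<beta>] by auto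
    qed
    hence "{x \<in> carrier R. eval (D.\<Theta> t) x = \<zero>} = carrier R" by blast
    thus False using card_roots_le_degree[OF i.list_poly_closed tne] dt card unfolding n_def by simp
  qed
  then obtain \<beta> where \<beta>: "\<beta> \<in> carrier R" "peval R (int_img R) \<beta> h = \<zero>" by blast
  interpret poly_evaluation R "int_img R" \<beta> by (rule ev[OF \<beta>(1)])
  interpret e: type_ring_hom R "peval R (int_img R) \<beta>" by (rule peval_hom)
  have "pderiv ([:0, 1:] ^ n - [:0, 1:]) = Polynomial.smult (int n) ([:0, 1:] ^ (n - 1)) - (1 :: int poly)"
    by (simp add: pderiv_diff pderiv_power pderiv_pCons one_pCons)
  moreover obtain n' where n': "n = p * n'" unfolding n_def using hd by (metis Suc_pred power_Suc)
  moreover have "pderiv (Polynomial.smult (int p) s + h * t) = Polynomial.smult (int p) (pderiv s) + (h * pderiv t + t * pderiv h)"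
    by (simp add: pderiv_add pderiv_smult pderiv_mult)
  ultimately have eq: "Polynomial.smult (int p) (Polynomial.smult (int n') ([:0, 1:] ^ (n - 1))) - 1
      = Polynomial.smult (int p) (pderiv s) + (h * pderiv t + t * pderiv h)"
    using arg_cong[OF st, of pderiv] unfolding n' by simp
  have z: "peval R (int_img R) \<beta> (Polynomial.smult (int p) q) = \<zero>" for q
    unfolding peval_smult p0 using peval_closed by simp
  have "peval R (int_img R) \<beta> (pderiv h) \<noteq> \<zero>"
  proof
    assume "peval R (int_img R) \<beta> (pderiv h) = \<zero>"
    hence "\<zero> \<ominus> \<one> = \<zero>"
      using arg_cong[OF eq, of "peval R (int_img R) \<beta>"] \<beta>(2) peval_closed
      by (simp add: e.hom_diff e.hom_one e.hom_add e.hom_mult z del: smult_smult)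
    thus False using one_not_zero r_right_minus_eq[of \<zero> \<one>] by simp
  qed
  thus thesis using that \<beta> by blast
qed

text \<open>Serves to replace a polynomial whose coefficient at \<open>m\<close> is 1 modulo
  \<open>p\<close>, and whose higher coefficients vanish modulo \<open>p\<close>, by a monic
  one.\<close>

lemma monom_add_cutoff_monic:
  "Polynomial.lead_coeff (Polynomial.monom 1 m + poly_cutoff m (r :: int poly)) = 1"
  "Polynomial.degree (Polynomial.monom 1 m + poly_cutoff m r) = m"
proof -
  have c: "poly.coeff (Polynomial.monom 1 m + poly_cutoff m r) m = 1" by (simp add: coeff_poly_cutoff)
  moreover have "Polynomial.degree (Polynomial.monom 1 m + poly_cutoff m r) \<le> m"
    by (rule degree_le) (simp add: coeff_poly_cutoff)
  moreover have "m \<le> Polynomial.degree (Polynomial.monom 1 m + poly_cutoff m r)"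
    using c by (intro le_degree) simp
  ultimately show d: "Polynomial.degree (Polynomial.monom 1 m + poly_cutoff m r) = m" by simp
  show "Polynomial.lead_coeff (Polynomial.monom 1 m + poly_cutoff m r) = 1" unfolding d by (rule c)
qed

text \<open>\<open>h\<close> is a lift of the minimal polynomial of a generator of the multiplicative group.\<close>

lemma (in field) exists_ph_maximal:
  assumes fin: "finite (carrier R)" and char: "has_char R p" and card: "card (carrier R) = p ^ f"
  obtains h where "Polynomial.lead_coeff h = 1" "Polynomial.degree h = f" "ph_maximal p h"
proof -
  have p: "Factorial_Ring.prime p" by (rule char_prime[OF fin char])
  obtain \<gamma> where "\<gamma> \<in> carrier (Multiplicative_Group.mult_of R)"
    and gen: "carrier (Multiplicative_Group.mult_of R) = {\<gamma> [^] i | i :: nat. i \<in> UNIV}"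
    using Multiplicative_Group.field.finite_field_mult_group_has_gen[OF field_axioms fin] by blast
  hence \<gamma>: "\<gamma> \<in> carrier R" by (simp add: Multiplicative_Group.carrier_mult_of)
  interpret i: type_ring_hom R "int_img R" by (rule int_img_hom)
  interpret poly_evaluation R "int_img R" \<gamma> by unfold_locales (rule \<gamma>)
  interpret e: type_ring_hom R E by (rule peval_hom)
  have 0: "int_img R c = \<zero> \<longleftrightarrow> int p dvd c" for c using char unfolding has_char_def by blast
  have z: "E (Polynomial.smult (int p) q) = \<zero>" for q
  proof -
    have "int_img R (int p) = \<zero>" using 0 by simp
    thus ?thesis unfolding peval_smult using peval_closed by simp
  qed
  have range: "range E = carrier R"
  proof
    show "carrier R \<subseteq> range E"
    proof
      fix a assume a: "a \<in> carrier R"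
      show "a \<in> range E"
      proof (cases "a = \<zero>")
        case True
        thus ?thesis using peval_0 by (metis rangeI)
      next
        case False
        hence "a \<in> carrier (Multiplicative_Group.mult_of R)" using a by (simp add: Multiplicative_Group.carrier_mult_of)
        then obtain j :: nat where "a = \<gamma> [^] j" using gen by blast
        hence "a = E ([:0, 1:] ^ j)" by (simp only: e.hom_power peval_X)
        thus ?thesis by blast
      qed
    qed
  qed (use peval_closed in auto)
  define n where "n = card (carrier R)"
  have "card {\<zero>, \<one>} \<le> n" unfolding n_def using fin by (intro card_mono) auto
  hence n1: "n > 1" by simp
  have "E ([:0, 1:] ^ n - [:0, 1:]) = \<zero>"
    unfolding e.hom_diff e.hom_power peval_X n_def
    using finite_field_pow_card[OF fin \<gamma>] \<gamma> by (simp add: r_right_minus_eq)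
  hence "Polynomial.lead_coeff ([:0, 1:] ^ n - [:0, 1:] :: int poly) = 1 \<and> E ([:0, 1:] ^ n - [:0, 1:]) = \<zero>"
    using X_power_minus_X(2)[OF n1] by blast
  \<comment> \<open>A monic integer polynomial of least degree vanishing at \<open>\<gamma>\<close>
    is already a lift of the minimal polynomial over the prime field.\<close>
  from ex_has_least_nat[of "\<lambda>q. Polynomial.lead_coeff q = 1 \<and> E q = \<zero>", OF this, of Polynomial.degree]
  obtain h where h: "Polynomial.lead_coeff h = 1" "E h = \<zero>"
    and min: "\<And>q. Polynomial.lead_coeff q = 1 \<Longrightarrow> E q = \<zero> \<Longrightarrow> Polynomial.degree h \<le> Polynomial.degree q"
    by blast
  have hd: "Polynomial.degree h > 0"
  proof (rule ccontr)
    assume "\<not> Polynomial.degree h > 0"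
    hence "h = 1" using h(1) by (metis degree_eq_zeroE gr0I lead_coeff_pCons(2) one_pCons)
    thus False using h(2) e.hom_one by simp
  qed
  \<comment> \<open>Otherwise \<open>r\<close> could be made monic modulo \<open>p\<close> and would
    contradict the minimality of \<open>h\<close>. Here \<open>m\<close> is the degree of
    \<open>r\<close> modulo \<open>p\<close>, and \<open>c\<close> inverts its leading coefficient
    there.\<close>
  have small: "\<exists>s. r = Polynomial.smult (int p) s"
    if r: "E r = \<zero>" "Polynomial.degree r < Polynomial.degree h" for r
  proof (rule ccontr)
    assume neg: "\<not> ?thesis"
    define M where "M = {m. \<not> int p dvd poly.coeff r m}"
    have Mne: "M \<noteq> {}" using neg unfolding smult_iff_coeff_dvd M_def by blast
    have Msub: "M \<subseteq> {..Polynomial.degree r}"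
    proof
      fix m assume "m \<in> M"
      hence "poly.coeff r m \<noteq> 0" unfolding M_def by auto
      thus "m \<in> {..Polynomial.degree r}" using le_degree by auto
    qed
    define m where "m = Max M"
    have m: "m \<in> M" unfolding m_def using Mne finite_subset[OF Msub] by (intro Max_in) auto
    have mdeg: "m \<le> Polynomial.degree r" using m Msub by auto
    have above: "int p dvd poly.coeff r j" if "j > m" for j
      using that Max_ge[OF finite_subset[OF Msub], of j] unfolding m_def M_def by auto
    have "coprime (int p) (poly.coeff r m)" using m p unfolding M_def by (simp add: prime_imp_coprime)
    then obtain u c where uc: "u * int p + c * poly.coeff r m = 1"
      using bezout_int[of "int p" "poly.coeff r m"] by auto
    define r' where "r' = Polynomial.monom 1 m + poly_cutoff m (Polynomial.smult c r)"
    have "int p dvd poly.coeff (Polynomial.smult c r - r') j" for j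
    proof -
      have "c * poly.coeff r m - 1 = int p * (- u)" using uc by (simp add: algebra_simps)
      hence "int p dvd c * poly.coeff r m - 1" by (rule dvdI)
      thus ?thesis using above[of j] unfolding r'_def
        by (cases j m rule: linorder_cases) (auto simp: coeff_poly_cutoff)
    qed
    then obtain s where "Polynomial.smult c r - r' = Polynomial.smult (int p) s"
      using smult_iff_coeff_dvd by blast
    hence "r' = Polynomial.smult c r - Polynomial.smult (int p) s" by (simp add: algebra_simps)
    hence "E r' = E (Polynomial.smult c r) \<ominus> E (Polynomial.smult (int p) s)" by (simp only: e.hom_diff)
    also have "\<dots> = \<zero>" unfolding z peval_smult[of c r] r(1) by simp
    finally have "E r' = \<zero>" .
    hence "Polynomial.degree h \<le> m"
      using min[of r'] monom_add_cutoff_monic[of m "Polynomial.smult c r"] unfolding r'_def by simp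
    thus False using mdeg r(2) by simp
  qed
  have ker: "E q = \<zero> \<longleftrightarrow> q \<in> ph_ideal p h" for q
  proof
    assume q: "E q = \<zero>"
    obtain A r where r: "q = h * A + r" "Polynomial.degree r < Polynomial.degree h"
      using monic_division[OF h(1) hd] by blast
    have "E r = \<zero>" using q peval_closed unfolding r(1) by (simp add: peval_add peval_mult h(2))
    then obtain s where "r = Polynomial.smult (int p) s" using small r(2) by blast
    hence "q = Polynomial.smult (int p) s + h * A" using r(1) by simp
    thus "q \<in> ph_ideal p h" unfolding ph_ideal_def by blast
  next
    assume "q \<in> ph_ideal p h"
    then obtain s t where "q = Polynomial.smult (int p) s + h * t" unfolding ph_ideal_def by blast
    thus "E q = \<zero>" using peval_closed by (simp add: peval_add peval_mult h(2) z)
  qed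
  have "ph_maximal p h"
    unfolding ph_maximal_def
  proof (intro conjI allI impI)
    show "1 \<notin> ph_ideal p h" unfolding ker[symmetric] e.hom_one by simp
    fix q assume "q \<notin> ph_ideal p h"
    hence "E q \<in> Units R" unfolding ker[symmetric] using field_Units peval_closed by simp
    then obtain r where "E q \<otimes> E r = \<one>" using range by (metis Units_inv_closed Units_r_inv imageE)
    hence "E (q * r) = E 1" by (simp only: e.hom_mult e.hom_one)
    thus "\<exists>r. q * r - 1 \<in> ph_ideal p h" unfolding e.hom_eq_iff[of "q * r"] ker by blast
  qed
  \<comment> \<open>The degree is found by counting: the field is Z[X]/(p, h).\<close>
  moreover have "p ^ Polynomial.degree h = p ^ f"
    using card_ph_quotient[OF peval_hom ker h(1) hd] range card p prime_gt_0_nat by simp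
  hence "Polynomial.degree h = f" using p prime_gt_1_nat power_inject_exp by blast
  ultimately show thesis using that h(1) by blast
qed

text \<open>Expansion to second order with an unspecified remainder in the ring, so that nothing has
  to be divided by 2.\<close>

lemma (in cring) peval_taylor:
  assumes b: "b \<in> carrier R" and d: "d \<in> carrier R"
  shows "\<exists>r\<in>carrier R. peval R (int_img R) (b \<oplus> d) q
    = peval R (int_img R) b q \<oplus> d \<otimes> peval R (int_img R) b (pderiv q) \<oplus> (d \<otimes> d) \<otimes> r"
proof -
  interpret i: type_ring_hom R "int_img R" by (rule int_img_hom)
  interpret B: poly_evaluation R "int_img R" b by unfold_locales (rule b)
  interpret BD: poly_evaluation R "int_img R" "b \<oplus> d" by unfold_locales (simp add: b d)
  show ?thesis
  proof (induction q)
    case 0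
    show ?case using b d by (intro bexI[of _ \<zero>]) (simp_all add: B.peval_0 BD.peval_0)
  next
    case (pCons a q)
    then obtain r where r: "r \<in> carrier R"
      "peval R (int_img R) (b \<oplus> d) q = peval R (int_img R) b q \<oplus> d \<otimes> peval R (int_img R) b (pderiv q) \<oplus> (d \<otimes> d) \<otimes> r" by blast
    define r' where "r' = peval R (int_img R) b (pderiv q) \<oplus> b \<otimes> r \<oplus> d \<otimes> r"
    have c: "peval R (int_img R) b q \<in> carrier R" "peval R (int_img R) b (pderiv q) \<in> carrier R" "int_img R a \<in> carrier R"
      by (auto intro: B.peval_closed)
    have "peval R (int_img R) (b \<oplus> d) (pCons a q) = int_img R a \<oplus> (b \<oplus> d) \<otimes> (peval R (int_img R) b q \<oplus> d \<otimes> peval R (int_img R) b (pderiv q) \<oplus> (d \<otimes> d) \<otimes> r)"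
      by (simp only: BD.peval_pCons r(2))
    also have "\<dots> = (int_img R a \<oplus> b \<otimes> peval R (int_img R) b q) \<oplus> d \<otimes> (peval R (int_img R) b q \<oplus> (\<zero> \<oplus> b \<otimes> peval R (int_img R) b (pderiv q))) \<oplus> (d \<otimes> d) \<otimes> r'"
      unfolding r'_def using c b d r(1) by algebra
    also have "peval R (int_img R) b q \<oplus> (\<zero> \<oplus> b \<otimes> peval R (int_img R) b (pderiv q)) = peval R (int_img R) b (pderiv (pCons a q))"
      by (simp add: pderiv_pCons B.peval_add B.peval_pCons i.hom_zero)
    finally have "peval R (int_img R) (b \<oplus> d) (pCons a q)
        = peval R (int_img R) b (pCons a q) \<oplus> d \<otimes> peval R (int_img R) b (pderiv (pCons a q)) \<oplus> (d \<otimes> d) \<otimes> r'"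
      by (simp only: B.peval_pCons)
    moreover have "r' \<in> carrier R" unfolding r'_def using b d r(1) c by simp
    ultimately show ?case by blast
  qed
qed

section \<open>Finite local principal ideal rings\<close>

locale local_PIR = cring R for R :: "('r, 'm) ring_scheme" (structure) +
  fixes \<pi> :: 'r and a e f p :: nat
  assumes PIR: "finite_local_PIR R" and type: "has_type R a e f p" and unif: "uniformizer R \<pi>"
begin

abbreviation "P \<equiv> max_ideal R"
abbreviation "k \<equiv> R Quot P"
abbreviation "pR \<equiv> int_img R (int p)"
abbreviation "\<kappa> \<equiv> \<lambda>x. P +> x"

lemma fin: "finite (carrier R)" using PIR unfolding finite_local_PIR_def by blast

lemma P_max: "maximalideal P R" and P_unique: "maximalideal Q R \<Longrightarrow> Q = P"
proof -
  have ex: "\<exists>!P. maximalideal P R" using PIR unfolding finite_local_PIR_def by blast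
  show "maximalideal P R" unfolding max_ideal_def by (rule theI'[OF ex])
  thus "maximalideal Q R \<Longrightarrow> Q = P" using ex by blast
qed

sublocale P: maximalideal P R by (rule P_max)

lemma \<pi>_carrier: "\<pi> \<in> carrier R" and P_PIdl: "PIdl \<pi> = P"
  using unif unfolding uniformizer_def by auto

lemma P_iff: "x \<in> P \<longleftrightarrow> (\<exists>r\<in>carrier R. x = r \<otimes> \<pi>)"
  unfolding P_PIdl[symmetric] by (rule PIdl_iff)

lemma \<pi>_P: "\<pi> \<in> P"
  unfolding P_iff using \<pi>_carrier by (intro bexI[of _ \<one>]) simp_all

lemma one_notin_P: "\<one> \<notin> P" using P.one_imp_carrier P.I_notcarr by blast

text \<open>A nonunit generates a proper ideal. As there are only finitely many ideals, it lies in a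
  maximal one, and that is \<open>P\<close> by uniqueness.\<close>

lemma unit_iff: "x \<in> carrier R \<Longrightarrow> x \<in> Units R \<longleftrightarrow> x \<notin> P"
proof
  assume x: "x \<in> carrier R"
  {
    assume "x \<in> Units R"
    thus "x \<notin> P" using P.I_l_closed[of x "inv x"] Units_l_inv Units_inv_closed one_notin_P by metis
  next
    assume "x \<notin> P"
    show "x \<in> Units R"
    proof (rule ccontr)
      assume nu: "x \<notin> Units R"
      define \<A> where "\<A> = {I. ideal I R \<and> \<one> \<notin> I}"
      have "\<A> \<subseteq> Pow (carrier R)" unfolding \<A>_def using additive_subgroup.a_subset ideal.axioms(1) by blast
      hence "finite \<A>" using fin finite_subset by blast
      moreover have "\<one> \<notin> PIdl x"
      proof
        assume "\<one> \<in> PIdl x"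
        then obtain r where "r \<in> carrier R" "\<one> = r \<otimes> x" unfolding PIdl_iff by blast
        hence "r \<otimes> x = \<one>" "x \<otimes> r = \<one>" using x m_comm[of x r] by simp_all
        hence "x \<in> Units R" using x \<open>r \<in> carrier R\<close> unfolding Units_def by blast
        thus False using nu by simp
      qed
      hence "PIdl x \<in> \<A>" unfolding \<A>_def using cgenideal_ideal[OF x] by simp
      ultimately obtain M where M: "M \<in> \<A>" "PIdl x \<subseteq> M" "\<And>J. J \<in> \<A> \<Longrightarrow> M \<subseteq> J \<Longrightarrow> M = J"
        using finite_has_maximal2[of \<A> "PIdl x"] by metis
      have "maximalideal M R"
      proof (rule maximalidealI)
        show "ideal M R" "carrier R \<noteq> M" using M(1) unfolding \<A>_def by auto
        fix J assume J: "ideal J R" "M \<subseteq> J" "J \<subseteq> carrier R"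
        thus "J = M \<or> J = carrier R" using M(3)[of J] ideal.one_imp_carrier[OF J(1)] unfolding \<A>_def by blast
      qed
      hence "M = P" by (rule P_unique)
      thus False using M(2) cgenideal_self[OF x] \<open>x \<notin> P\<close> by blast
    qed
  }
qed

text \<open>By finiteness two powers \<open>\<pi> ^ m\<close> and \<open>\<pi> ^ n\<close> with
  \<open>m < n\<close> coincide, and the factor \<open>1 - \<pi> ^ (n - m)\<close> of their
  difference is a unit.\<close>

lemma \<pi>_nilpotent: "\<exists>n>0. \<pi> [^] (n::nat) = \<zero>"
proof -
  have "finite (range (\<lambda>n::nat. \<pi> [^] n))" using \<pi>_carrier by (intro finite_subset[OF _ fin]) auto
  hence "\<not> inj (\<lambda>n::nat. \<pi> [^] n)" using finite_imageD infinite_UNIV_nat by blast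
  then obtain m n :: nat where mn: "\<pi> [^] m = \<pi> [^] n" "m < n" unfolding inj_def by (metis linorder_neqE_nat)
  then obtain j where j: "n = m + Suc j" using less_natE by (metis add_Suc_right)
  have c: "\<pi> [^] m \<in> carrier R" "\<pi> [^] Suc j \<in> carrier R" using \<pi>_carrier by auto
  have "\<pi> [^] Suc j \<in> P" unfolding P_iff using \<pi>_carrier by force
  hence "\<one> \<ominus> \<pi> [^] Suc j \<notin> P"
    using one_notin_P additive_subgroup.a_closed[OF P.is_additive_subgroup, of "\<one> \<ominus> \<pi> [^] Suc j" "\<pi> [^] Suc j"] c
    by (auto simp: a_minus_def a_assoc l_neg)
  hence u: "\<one> \<ominus> \<pi> [^] Suc j \<in> Units R" using unit_iff c by simp
  have "\<pi> [^] n = \<pi> [^] m \<otimes> \<pi> [^] Suc j" unfolding j using nat_pow_mult[OF \<pi>_carrier, of m "Suc j"] by (simp del: nat_pow_Suc)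
  hence "\<pi> [^] m \<otimes> (\<one> \<ominus> \<pi> [^] Suc j) = \<pi> [^] m \<ominus> \<pi> [^] n"
    using c by (simp add: a_minus_def r_distr r_minus del: nat_pow_Suc)
  also have "\<dots> = \<zero>" using mn(1) c by (simp add: r_right_minus_eq)
  finally have "\<pi> [^] m \<otimes> (\<one> \<ominus> \<pi> [^] Suc j) \<otimes> inv (\<one> \<ominus> \<pi> [^] Suc j) = \<zero>" using u by simp
  hence "\<pi> [^] m = \<zero>" using u c by (simp add: m_assoc del: nat_pow_Suc)
  hence "\<pi> [^] Suc m = \<zero>" using \<pi>_carrier by simp
  thus ?thesis by blast
qed

lemma ideal_pow_P: "ideal_pow R P n = PIdl (\<pi> [^] n)"
  using ideal_pow_PIdl[OF \<pi>_carrier] P_PIdl by simp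

lemma PIdl_zero_iff: "x \<in> carrier R \<Longrightarrow> PIdl x = {\<zero>} \<longleftrightarrow> x = \<zero>"
  using cgenideal_self unfolding cgenideal_def by auto

lemma a_pos: "a > 0" and \<pi>_pow_a: "\<pi> [^] a = \<zero>" and \<pi>_pow_less: "n < a \<Longrightarrow> \<pi> [^] (n::nat) \<noteq> \<zero>"
proof -
  have eq: "(n > 0 \<and> ideal_pow R P n = {\<zero>}) \<longleftrightarrow> (n > 0 \<and> \<pi> [^] n = \<zero>)" for n :: nat
    unfolding ideal_pow_P using PIdl_zero_iff \<pi>_carrier by simp
  have a: "a = (LEAST n::nat. n > 0 \<and> \<pi> [^] n = \<zero>)"
    using type unfolding has_type_def nilpotency_index_def eq by simp
  have "a > 0 \<and> \<pi> [^] a = \<zero>" unfolding a using \<pi>_nilpotent by (rule LeastI_ex)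
  thus "a > 0" "\<pi> [^] a = \<zero>" by auto
  assume "n < a"
  hence "\<not> (n > 0 \<and> \<pi> [^] n = \<zero>)" unfolding a by (rule not_less_Least)
  thus "\<pi> [^] n \<noteq> \<zero>" using one_notin_P P.zero_closed by (cases n) auto
qed

text \<open>Divisibility of \<open>x\<close> by powers of \<open>\<pi>\<close> ends below
  \<open>a\<close>, because \<open>\<pi> ^ a\<close> vanishes; for the greatest such power the
  cofactor is outside \<open>P\<close>.\<close>

lemma decompose:
  assumes x: "x \<in> carrier R" "x \<noteq> \<zero>"
  obtains n u where "n < a" "u \<in> Units R" "x = \<pi> [^] (n::nat) \<otimes> u"
proof -
  define Q where "Q = (\<lambda>n::nat. \<exists>u\<in>carrier R. x = \<pi> [^] n \<otimes> u)"
  have Q0: "Q 0" unfolding Q_def using x by auto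
  have lt: "n < a" if "Q n" for n
  proof (rule ccontr)
    assume "\<not> n < a"
    then obtain j where "n = a + j" using le_Suc_ex not_less by blast
    hence "\<pi> [^] n = \<zero>" using \<pi>_pow_a \<pi>_carrier by (simp add: nat_pow_mult[symmetric])
    thus False using that x unfolding Q_def by auto
  qed
  define n where "n = (GREATEST n. Q n)"
  have n: "Q n" unfolding n_def by (rule GreatestI_nat[of Q 0 a, OF Q0]) (use lt in \<open>auto intro: less_imp_le\<close>)
  then obtain u where u: "u \<in> carrier R" "x = \<pi> [^] n \<otimes> u" unfolding Q_def by blast
  have "u \<notin> P"
  proof
    assume "u \<in> P"
    then obtain v where v: "v \<in> carrier R" "u = v \<otimes> \<pi>" unfolding P_iff by blast
    hence "x = \<pi> [^] Suc n \<otimes> v" unfolding u(2) using \<pi>_carrier by (simp add: m_ac)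
    hence "Q (Suc n)" unfolding Q_def using v by blast
    hence "Suc n \<le> n" unfolding n_def by (rule Greatest_le_nat[of Q _ a]) (use lt in \<open>auto intro: less_imp_le\<close>)
    thus False by simp
  qed
  thus thesis using that lt[OF n] u unit_iff by blast
qed

interpretation k: field k
  by (rule maximalideal.quotient_is_field[OF P_max cring_axioms])

lemma k_field: "field k" by (rule k.field_axioms)

lemma \<kappa>_hom: "\<kappa> \<in> ring_hom R k" by (rule P.rcos_ring_hom)

lemma \<kappa>_zero: "x \<in> carrier R \<Longrightarrow> \<kappa> x = \<zero>\<^bsub>k\<^esub> \<longleftrightarrow> x \<in> P" by (rule P.rcos_eq_zero_iff)

lemma k_carrier: "carrier k = \<kappa> ` carrier R" by (rule carrier_FactRing)

lemma k_fin: "finite (carrier k)" unfolding k_carrier using fin by simp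

lemma k_char: "has_char k p" using type unfolding has_type_def by blast

lemma p_prime: "Factorial_Ring.prime p" by (rule k.char_prime[OF k_fin k_char])

lemma k_card: "card (carrier k) = p ^ f"
proof -
  have "ring.dimension k f (prime_subring k) (carrier k)"
    using type unfolding has_type_def has_residue_degree_def by blast
  from k.dimension_card[OF k.prime_subring_subfield(1,2)[OF p_prime k_char] this]
  show ?thesis using k.prime_subring_subfield(3)[OF p_prime k_char] by simp
qed

sublocale i: type_ring_hom R "int_img R" by (rule int_img_hom)

lemma \<kappa>_int: "\<kappa> (int_img R n) = int_img k n"
  by (rule int_hom_eq_int_img[OF type_ring_hom_compose[OF i.type_ring_hom_axioms k.cring_axioms \<kappa>_hom]])

lemma int_P_iff: "int_img R n \<in> P \<longleftrightarrow> int p dvd n"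
  using \<kappa>_zero[of "int_img R n"] k_char \<kappa>_int unfolding has_char_def by simp

text \<open>If \<open>p\<close> vanishes in \<open>R\<close>, the convention for the order of zero
  gives \<open>e = a\<close>, and both sides of the last identity are zero. Otherwise
  \<open>e\<close> is the exponent of \<open>\<pi>\<close> in \<open>p\<close>.\<close>

lemma p_ramified: "e > 0" "e \<le> a" "\<exists>u\<in>Units R. \<pi> [^] e = pR \<otimes> u"
proof -
  have e: "e = ord_max R pR" using type unfolding has_type_def by blast
  have "e > 0 \<and> e \<le> a \<and> (\<exists>u\<in>Units R. \<pi> [^] e = pR \<otimes> u)"
  proof (cases "pR = \<zero>")
    case True
    hence "e = a" using e type unfolding ord_max_def has_type_def by simp
    thus ?thesis using a_pos \<pi>_pow_a True by (auto intro!: bexI[of _ \<one>])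
  next
    case False
    then obtain n u where u: "n < a" "u \<in> Units R" "pR = \<pi> [^] n \<otimes> u" using decompose i.hom_closed by blast
    \<comment> \<open>\<open>p\<close> lies in exactly the powers of \<open>P\<close> up to the
      \<open>n\<close>-th, so the definite description in \<open>ord_max\<close> denotes
      \<open>n\<close>.\<close>
    have mem: "pR \<in> ideal_pow R P m \<longleftrightarrow> m \<le> n" for m
    proof
      assume "pR \<in> ideal_pow R P m"
      then obtain r where r: "r \<in> carrier R" "pR = r \<otimes> \<pi> [^] m" unfolding ideal_pow_P PIdl_iff by blast
      show "m \<le> n"
      proof (rule ccontr)
        assume "\<not> m \<le> n"
        then obtain j where j: "m = n + Suc j" using less_natE by (metis add_Suc_right not_le)
        have c: "\<pi> [^] n \<in> carrier R" "\<pi> [^] Suc j \<in> carrier R" "u \<in> carrier R" using \<pi>_carrier u(2) by auto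
        have "\<pi> [^] m = \<pi> [^] n \<otimes> \<pi> [^] Suc j" unfolding j using nat_pow_mult[OF \<pi>_carrier, of n "Suc j"] by (simp del: nat_pow_Suc)
        hence "\<pi> [^] n \<otimes> (u \<ominus> r \<otimes> \<pi> [^] Suc j) = pR \<ominus> r \<otimes> \<pi> [^] m"
          unfolding u(3) using c r(1) by (simp add: a_minus_def r_distr r_minus m_ac del: nat_pow_Suc)
        also have "\<dots> = \<zero>" unfolding r(2)[symmetric] by (simp add: r_right_minus_eq)
        finally have z: "\<pi> [^] n \<otimes> (u \<ominus> r \<otimes> \<pi> [^] Suc j) = \<zero>" .
        have "r \<otimes> \<pi> [^] Suc j \<in> P" unfolding P_iff using \<pi>_carrier r(1) by (intro bexI[of _ "r \<otimes> \<pi> [^] j"]) (auto simp: m_assoc)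
        hence "u \<ominus> r \<otimes> \<pi> [^] Suc j \<notin> P"
          using additive_subgroup.a_closed[OF P.is_additive_subgroup, of "u \<ominus> r \<otimes> \<pi> [^] Suc j" "r \<otimes> \<pi> [^] Suc j"]
            c r(1) unit_iff[OF c(3)] u(2) by (auto simp: a_minus_def a_assoc l_neg simp del: nat_pow_Suc)
        hence v: "u \<ominus> r \<otimes> \<pi> [^] Suc j \<in> Units R" using unit_iff c r(1) by simp
        have "\<pi> [^] n = \<pi> [^] n \<otimes> (u \<ominus> r \<otimes> \<pi> [^] Suc j) \<otimes> inv (u \<ominus> r \<otimes> \<pi> [^] Suc j)"
          using v c r(1) by (simp add: m_assoc del: nat_pow_Suc)
        also have "\<dots> = \<zero>" unfolding z using v by simp
        finally show False using \<pi>_pow_less[OF u(1)] by simp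
      qed
    next
      assume "m \<le> n"
      then obtain j where j: "n = m + j" using le_Suc_ex by blast
      have "pR = (\<pi> [^] j \<otimes> u) \<otimes> \<pi> [^] m"
        unfolding u(3) j using \<pi>_carrier Units_closed[OF u(2)] by (simp add: nat_pow_mult[symmetric] m_ac)
      thus "pR \<in> ideal_pow R P m" unfolding ideal_pow_P PIdl_iff using \<pi>_carrier u(2) by blast
    qed
    have "e = n"
      unfolding e ord_max_def Diff_iff mem using False
      by (simp only: if_False) (rule the_equality, auto)
    have "n > 0"
    proof (rule ccontr)
      assume "\<not> n > 0"
      hence "pR = u" using u Units_closed[OF u(2)] by simp
      thus False using int_P_iff[of "int p"] unit_iff[OF Units_closed[OF u(2)]] u(2) by simp
    qed
    have "\<pi> [^] n = pR \<otimes> inv u" unfolding u(3) using u(2) Units_closed[OF u(2)] \<pi>_carrier by (simp add: m_assoc)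
    thus ?thesis using \<open>e = n\<close> \<open>n > 0\<close> u by auto
  qed
  thus "e > 0" "e \<le> a" "\<exists>u\<in>Units R. \<pi> [^] e = pR \<otimes> u" by auto
qed

lemma exists_h:
  obtains h where "Polynomial.lead_coeff h = 1" "Polynomial.degree h = f" "ph_maximal p h"
  by (rule k.exists_ph_maximal[OF k_fin k_char k_card]) (rule that)

lemma \<kappa>_peval:
  assumes "b \<in> carrier R"
  shows "\<kappa> (peval R (int_img R) b q) = peval k (int_img k) (\<kappa> b) q"
proof (rule poly_hom_eqI)
  interpret B: poly_evaluation R "int_img R" b by unfold_locales (rule assms)
  have \<kappa>b: "\<kappa> b \<in> carrier k" unfolding k_carrier using assms by blast
  interpret ik: type_ring_hom k "int_img k" by (rule k.int_img_hom)
  interpret C: poly_evaluation k "int_img k" "\<kappa> b" by unfold_locales (rule \<kappa>b)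
  show "type_ring_hom k (\<lambda>q. \<kappa> (peval R (int_img R) b q))"
    by (rule type_ring_hom_compose[OF B.peval_hom k.cring_axioms \<kappa>_hom])
  show "type_ring_hom k (peval k (int_img k) (\<kappa> b))" by (rule C.peval_hom)
  show "\<kappa> (peval R (int_img R) b [:c:]) = peval k (int_img k) (\<kappa> b) [:c:]" for c
    by (simp add: B.peval_const C.peval_const \<kappa>_int)
  show "\<kappa> (peval R (int_img R) b [:0, 1:]) = peval k (int_img k) (\<kappa> b) [:0, 1:]"
    by (simp add: B.peval_X C.peval_X)
qed

text \<open>Newton iteration: for \<open>d = - h(c) / h'(c)\<close> the value at
  \<open>c + d\<close> is a multiple of \<open>d^2\<close>, and the derivative there is still a
  unit. A gain of one power of \<open>\<pi>\<close> per step is enough, since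
  \<open>\<pi> ^ a\<close> vanishes.\<close>

lemma hensel:
  assumes b: "b \<in> carrier R" "peval R (int_img R) b h \<in> P" "peval R (int_img R) b (pderiv h) \<notin> P"
  shows "\<exists>c\<in>carrier R. peval R (int_img R) c h = \<zero>"
proof -
  define ev where "ev = (\<lambda>c. peval R (int_img R) c)"
  have closed: "ev c q \<in> carrier R" if "c \<in> carrier R" for c q
  proof -
    interpret poly_evaluation R "int_img R" c by unfold_locales (rule that)
    show ?thesis unfolding ev_def by (rule peval_closed)
  qed
  have "\<exists>c\<in>carrier R. (\<exists>r\<in>carrier R. ev c h = \<pi> [^] Suc n \<otimes> r) \<and> ev c (pderiv h) \<notin> P" for n
  proof (induction n)
    case 0
    obtain r where "r \<in> carrier R" "ev b h = r \<otimes> \<pi>" using b(2) unfolding P_iff ev_def by blast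
    thus ?case using b(1,3) \<pi>_carrier unfolding ev_def
      by (intro bexI[of _ b] conjI bexI[of _ r]) (auto simp: m_comm)
  next
    case (Suc n)
    then obtain c r where c: "c \<in> carrier R" "r \<in> carrier R" "ev c h = \<pi> [^] Suc n \<otimes> r" "ev c (pderiv h) \<notin> P" by blast
    define u where "u = ev c (pderiv h)"
    have u: "u \<in> Units R" unfolding u_def using c unit_iff closed by blast
    define d where "d = \<ominus> (ev c h \<otimes> inv u)"
    have d: "d \<in> carrier R" "d = \<pi> [^] Suc n \<otimes> (\<ominus> (r \<otimes> inv u))"
      unfolding d_def c(3) using c(1,2) u \<pi>_carrier closed by (simp_all add: r_minus m_assoc)
    obtain s where s: "s \<in> carrier R" "ev (c \<oplus> d) h = ev c h \<oplus> d \<otimes> u \<oplus> (d \<otimes> d) \<otimes> s"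
      using peval_taylor[OF c(1) d(1), of h] unfolding ev_def u_def by blast
    obtain s' where s': "s' \<in> carrier R" "ev (c \<oplus> d) (pderiv h) = u \<oplus> d \<otimes> ev c (pderiv (pderiv h)) \<oplus> (d \<otimes> d) \<otimes> s'"
      using peval_taylor[OF c(1) d(1), of "pderiv h"] unfolding ev_def u_def by blast
    have "d \<otimes> u = \<ominus> ev c h" unfolding d_def using u Units_closed[OF u] closed[OF c(1), of h] by (simp add: l_minus m_assoc)
    hence "ev (c \<oplus> d) h = (d \<otimes> d) \<otimes> s" unfolding s(2) using s(1) d(1) closed[OF c(1)] by (simp add: r_neg)
    also have "\<dots> = \<pi> [^] Suc (Suc n) \<otimes> (\<pi> [^] n \<otimes> ((\<ominus> (r \<otimes> inv u)) \<otimes> (\<ominus> (r \<otimes> inv u)) \<otimes> s))"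
      unfolding d(2) using \<pi>_carrier c(2) u s(1) by (simp add: m_ac)
    finally have eq: "ev (c \<oplus> d) h = \<dots>" .
    have "\<pi> [^] n \<otimes> ((\<ominus> (r \<otimes> inv u)) \<otimes> (\<ominus> (r \<otimes> inv u)) \<otimes> s) \<in> carrier R"
      using \<pi>_carrier c(2) u s(1) by auto
    hence "\<exists>r\<in>carrier R. ev (c \<oplus> d) h = \<pi> [^] Suc (Suc n) \<otimes> r" using eq by blast
    moreover have "ev (c \<oplus> d) (pderiv h) \<notin> P"
    proof
      assume A: "ev (c \<oplus> d) (pderiv h) \<in> P"
      have dP: "d \<in> P" unfolding P_iff d(2) using \<pi>_carrier c(2) u
        by (intro bexI[of _ "\<pi> [^] n \<otimes> (\<ominus> (r \<otimes> inv u))"]) (auto simp: m_ac)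
      have cl: "u \<in> carrier R" "ev c (pderiv (pderiv h)) \<in> carrier R" using u closed c(1) by auto
      have w: "d \<otimes> (ev c (pderiv (pderiv h)) \<oplus> d \<otimes> s') \<in> P"
        using P.I_r_closed[OF dP] cl d(1) s'(1) by simp
      have wc: "d \<otimes> (ev c (pderiv (pderiv h)) \<oplus> d \<otimes> s') \<in> carrier R" using cl d(1) s'(1) by simp
      have "ev (c \<oplus> d) (pderiv h) = u \<oplus> d \<otimes> (ev c (pderiv (pderiv h)) \<oplus> d \<otimes> s')"
        unfolding s'(2) using cl d(1) s'(1) by (simp add: r_distr m_assoc a_assoc)
      hence "u = ev (c \<oplus> d) (pderiv h) \<ominus> d \<otimes> (ev c (pderiv (pderiv h)) \<oplus> d \<otimes> s')"
        using cl(1) wc by (simp add: a_minus_def a_assoc r_neg)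
      also have "\<dots> \<in> P"
        unfolding a_minus_def
        using additive_subgroup.a_closed[OF P.is_additive_subgroup A additive_subgroup.a_inv_closed[OF P.is_additive_subgroup w]] .
      finally show False using u unit_iff[OF cl(1)] by simp
    qed
    ultimately show ?case using c(1) d(1) by (intro bexI[of _ "c \<oplus> d"]) auto
  qed
  from this[of "a - 1"] obtain c r where "c \<in> carrier R" "r \<in> carrier R" "ev c h = \<pi> [^] a \<otimes> r" using a_pos by auto
  thus ?thesis unfolding ev_def \<pi>_pow_a by auto
qed

lemma exists_root:
  assumes h: "Polynomial.lead_coeff h = 1" "Polynomial.degree h = f" "ph_maximal p h"
  shows "\<exists>b\<in>carrier R. peval R (int_img R) b h = \<zero>"
proof -
  obtain \<beta> where \<beta>: "\<beta> \<in> carrier k" "peval k (int_img k) \<beta> h = \<zero>\<^bsub>k\<^esub>" "peval k (int_img k) \<beta> (pderiv h) \<noteq> \<zero>\<^bsub>k\<^esub>"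
    by (rule k.ph_root[OF k_fin k_char h(1,3)]) (use k_card h(2) in auto)
  obtain b where b: "b \<in> carrier R" "\<beta> = \<kappa> b" using \<beta>(1) unfolding k_carrier by blast
  interpret poly_evaluation R "int_img R" b by unfold_locales (rule b(1))
  show ?thesis
    using \<beta>(2,3) unfolding b(2) \<kappa>_peval[OF b(1), symmetric] \<kappa>_zero[OF peval_closed]
    by (rule hensel[OF b(1)])
qed

end

section \<open>The presentation\<close>

lemma eis_poly_coeff:
  assumes "i < e"
  shows "poly.coeff (eis_poly p e U) i = - ([:int p:] * poly.coeff U i)"
  using assms by (simp add: eis_poly_def)

text \<open>Serves both base rings, \<open>\<O> K\<close> and Z[X]/(h). What has to be shown
  separately for each is that \<open>p\<close> times the constant coefficient of \<open>U\<close> is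
  not divisible by \<open>p^2\<close>.\<close>

lemma (in cring) eisenstein_list_poly:
  assumes \<zeta>: "type_ring_hom R \<zeta>" and nt: "\<one> \<noteq> \<zero>" and U: "Polynomial.degree U < e"
    and 0: "\<zeta> ([:int p:] * poly.coeff U 0) \<notin> PIdl (int_img R (int p) [^] (2::nat))"
  shows "eisenstein R p (list_poly R \<zeta> (eis_poly p e U))"
proof -
  interpret z: type_ring_hom R \<zeta> by fact
  interpret i: type_ring_hom R "int_img R" by (rule int_img_hom)
  have const: "\<zeta> [:n:] = int_img R n" for n
    by (rule int_hom_eq_int_img[OF type_ring_hom_comp_type[OF \<zeta>]]) auto
  note g = eis_poly_monic[OF U, of p]
  note m = z.list_poly_monic[OF g(2) nt]
  have coeff: "coeff (list_poly R \<zeta> (eis_poly p e U)) j = \<ominus> \<zeta> ([:int p:] * poly.coeff U j)" if "j < e" for j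
    unfolding z.list_poly_coeff eis_poly_coeff[OF that] z.hom_uminus ..
  show ?thesis
    unfolding eisenstein_def
  proof (intro conjI allI impI)
    show "Defs.monic R (list_poly R \<zeta> (eis_poly p e U))" by (rule m(5))
    fix j assume "j < Polynomials.degree (list_poly R \<zeta> (eis_poly p e U))"
    hence j: "j < e" using m(3) g(1) by simp
    have "\<ominus> \<zeta> ([:int p:] * poly.coeff U j) = (\<ominus> \<zeta> (poly.coeff U j)) \<otimes> int_img R (int p)"
      unfolding z.hom_mult const by (simp add: l_minus r_minus m_comm)
    thus "coeff (list_poly R \<zeta> (eis_poly p e U)) j \<in> PIdl (int_img R (int p))"
      unfolding coeff[OF j] PIdl_iff by blast
  next
    have e: "0 < e" using U by simp
    interpret I: ideal "PIdl (int_img R (int p) [^] (2::nat))" R by (rule cgenideal_ideal) simp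
    show "coeff (list_poly R \<zeta> (eis_poly p e U)) 0 \<notin> PIdl (int_img R (int p) [^] (2::nat))"
      unfolding coeff[OF e]
      using 0 additive_subgroup.a_inv_closed[OF I.is_additive_subgroup, of "\<ominus> \<zeta> ([:int p:] * poly.coeff U 0)"] by auto
  qed
qed

text \<open>Cancels a factor \<open>p\<close> in Z[X]/(h), which has no \<open>p\<close>-torsion
  because \<open>h\<close> is monic.\<close>

lemma ph_ideal_cancel:
  assumes h: "Polynomial.lead_coeff h = 1" and p: "p > 0"
    and eq: "[:int p:] * u - [:int p ^ 2:] * q = h * t"
  shows "u \<in> ph_ideal p h"
proof -
  have "Polynomial.smult (int p) (u - [:int p:] * q) = h * t"
    unfolding eq[symmetric] by (simp add: smult_diff_right power2_eq_square)
  then obtain t' where "t = Polynomial.smult (int p) t'" using smult_eq_monic_multD[OF h] by blast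
  hence "Polynomial.smult (int p) (u - [:int p:] * q) = Polynomial.smult (int p) (h * t')"
    using \<open>Polynomial.smult (int p) (u - [:int p:] * q) = h * t\<close> by simp
  hence "Polynomial.smult (int p) (u - [:int p:] * q - h * t') = 0" by (simp only: smult_diff_right[of _ _ "h * t'"])
  hence "u - [:int p:] * q = h * t'" using p by (simp only: smult_eq_0_iff) simp
  hence "u = Polynomial.smult (int p) q + h * t'" by (simp add: algebra_simps)
  thus ?thesis unfolding ph_ideal_def by blast
qed

section \<open>Integer polynomials in one and two variables, as types and as lists\<close>

interpretation Z\<Theta>: domain_type_hom \<Z> "\<lambda>c. c" by (rule type_ring_id_hom)

lemma Z\<Theta>_surj: "Z\<Theta>.\<Theta> ` UNIV = carrier ZX"
  using Z\<Theta>.list_poly_surj Z\<Theta>.list_poly_closed by (auto simp: image_iff)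

interpretation ZX: domain_type_hom ZX Z\<Theta>.\<Theta>
proof -
  have d: "domain \<Z>" by unfold_locales
  interpret D: domain ZX by (rule domain.univ_poly_is_domain[OF d ring.carrier_is_subring]) unfold_locales
  interpret H: type_ring_hom ZX Z\<Theta>.\<Theta>
    using Z\<Theta>.list_poly_hom by (simp only: partial_object.select_convs)
  show "domain_type_hom ZX Z\<Theta>.\<Theta>" by unfold_locales
qed

interpretation ZXY: type_ring_hom ZXY ZX.\<Theta> by (rule ZX.list_poly_hom)

lemma ZX_surj: "ZX.\<Theta> ` UNIV = carrier ZXY"
  using ZX.list_poly_surj[OF Z\<Theta>_surj] ZX.list_poly_closed by (auto simp: image_iff)

lemma Z\<Theta>_zero: "Z\<Theta>.\<Theta> q = \<zero>\<^bsub>ZX\<^esub> \<longleftrightarrow> q = 0"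
  using Z\<Theta>.list_poly_eq_0_iff[of q] by (simp only: poly_eq_iff coeff_0) simp

lemma ZX_zero: "ZX.\<Theta> F = \<zero>\<^bsub>ZXY\<^esub> \<longleftrightarrow> F = 0"
  by (simp only: ZX.list_poly_eq_0_iff Z\<Theta>_zero poly_eq_iff coeff_0)

lemma ZX_PIdl_iff: "Z\<Theta>.\<Theta> q \<in> PIdl\<^bsub>ZX\<^esub> (Z\<Theta>.\<Theta> h) \<longleftrightarrow> h dvd q"
proof
  assume "Z\<Theta>.\<Theta> q \<in> PIdl\<^bsub>ZX\<^esub> (Z\<Theta>.\<Theta> h)"
  then obtain t where "Z\<Theta>.\<Theta> q = Z\<Theta>.\<Theta> t \<otimes>\<^bsub>ZX\<^esub> Z\<Theta>.\<Theta> h" unfolding ZX.PIdl_iff Z\<Theta>_surj[symmetric] by auto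
  hence "Z\<Theta>.\<Theta> q = Z\<Theta>.\<Theta> (t * h)" by (simp only: ZX.hom_mult)
  hence "Z\<Theta>.\<Theta> (q - t * h) = \<zero>\<^bsub>ZX\<^esub>" by (simp only: ZX.hom_eq_iff)
  hence "q = t * h" by (simp only: Z\<Theta>_zero right_minus_eq)
  thus "h dvd q" by simp
next
  assume "h dvd q"
  then obtain t where "q = t * h" by (metis dvd_def mult.commute)
  thus "Z\<Theta>.\<Theta> q \<in> PIdl\<^bsub>ZX\<^esub> (Z\<Theta>.\<Theta> h)" unfolding ZX.PIdl_iff using ZX.hom_mult ZX.hom_closed by blast
qed

text \<open>If \<open>p\<close> times the constant coefficient of \<open>U\<close> were a multiple
  of \<open>p^2\<close> modulo \<open>h\<close>, cancelling \<open>p\<close> would put that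
  coefficient into (p, h).\<close>

lemma eisenstein_lift_eis_poly:
  assumes h: "Polynomial.lead_coeff h = 1" "ph_maximal p h" and p: "p > 0"
    and U: "Polynomial.degree U < e" "poly.coeff U 0 \<notin> ph_ideal p h"
  shows "eisenstein_lift p e (Z\<Theta>.\<Theta> h) (ZX.\<Theta> (eis_poly p e U))"
proof -
  define I where "I = PIdl\<^bsub>ZX\<^esub> (Z\<Theta>.\<Theta> h)"
  interpret I: ideal I ZX unfolding I_def by (rule ZX.cgenideal_ideal[OF ZX.hom_closed])
  define \<zeta> where "\<zeta> = (\<lambda>q. I +>\<^bsub>ZX\<^esub> Z\<Theta>.\<Theta> q)"
  have A: "cring (ZX Quot I)" by (rule I.quotient_is_cring[OF ZX.cring_axioms])
  have \<zeta>: "type_ring_hom (ZX Quot I) \<zeta>"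
    unfolding \<zeta>_def by (rule type_ring_hom_compose[OF ZX.type_ring_hom_axioms A I.rcos_ring_hom])
  interpret \<zeta>: type_ring_hom "ZX Quot I" \<zeta> by (rule \<zeta>)
  have zero: "\<zeta> q = \<zero>\<^bsub>ZX Quot I\<^esub> \<longleftrightarrow> h dvd q" for q
    unfolding \<zeta>_def I.rcos_eq_zero_iff[OF ZX.hom_closed] unfolding I_def by (rule ZX_PIdl_iff)
  note g = eis_poly_monic[OF U(1), of p]
  note m = ZX.list_poly_monic[OF g(2) ZX.one_not_zero]
  have nt: "\<one>\<^bsub>ZX Quot I\<^esub> \<noteq> \<zero>\<^bsub>ZX Quot I\<^esub>"
  proof
    assume "\<one>\<^bsub>ZX Quot I\<^esub> = \<zero>\<^bsub>ZX Quot I\<^esub>"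
    hence "h dvd 1" using zero[of 1] \<zeta>.hom_one by simp
    then obtain t where "1 = Polynomial.smult (int p) 0 + h * t" by (auto elim: dvdE)
    thus False using h(2) unfolding ph_maximal_def ph_ideal_def by blast
  qed
  have "poly_mod ZX I (ZX.\<Theta> (eis_poly p e U)) = list_poly (ZX Quot I) \<zeta> (eis_poly p e U)"
    unfolding poly_mod_def m(1) unfolding list_poly_def \<zeta>_def by (simp add: rev_map comp_def)
  moreover have "eisenstein (ZX Quot I) p (list_poly (ZX Quot I) \<zeta> (eis_poly p e U))"
  proof (rule \<zeta>.eisenstein_list_poly[OF \<zeta> nt U(1)])
    show "\<zeta> ([:int p:] * poly.coeff U 0) \<notin> PIdl\<^bsub>ZX Quot I\<^esub> (int_img (ZX Quot I) (int p) [^]\<^bsub>ZX Quot I\<^esub> (2::nat))"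
    proof
      assume "\<zeta> ([:int p:] * poly.coeff U 0) \<in> PIdl\<^bsub>ZX Quot I\<^esub> (int_img (ZX Quot I) (int p) [^]\<^bsub>ZX Quot I\<^esub> (2::nat))"
      moreover have "int_img (ZX Quot I) (int p) [^]\<^bsub>ZX Quot I\<^esub> (2::nat) = \<zeta> [:int p ^ 2:]"
      proof -
        have "int_img (ZX Quot I) n = \<zeta> [:n:]" for n
          by (rule int_hom_eq_int_img[OF type_ring_hom_comp_type[OF \<zeta>], symmetric]) auto
        hence "int_img (ZX Quot I) (int p) [^]\<^bsub>ZX Quot I\<^esub> (2::nat) = \<zeta> ([:int p:] ^ 2)" by (simp only: \<zeta>.hom_power)
        thus ?thesis by (simp only: poly_const_pow)
      qed
      moreover have "carrier (ZX Quot I) = range \<zeta>"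
        unfolding carrier_FactRing \<zeta>_def Z\<Theta>_surj[symmetric] by (simp add: image_image)
      ultimately obtain q where "\<zeta> ([:int p:] * poly.coeff U 0) = \<zeta> q \<otimes>\<^bsub>ZX Quot I\<^esub> \<zeta> [:int p ^ 2:]"
        unfolding \<zeta>.PIdl_iff by auto
      hence "\<zeta> ([:int p:] * poly.coeff U 0) = \<zeta> ([:int p ^ 2:] * q)" by (simp only: \<zeta>.hom_mult \<zeta>.m_comm \<zeta>.hom_closed)
      hence "h dvd [:int p:] * poly.coeff U 0 - [:int p ^ 2:] * q" by (simp only: \<zeta>.hom_eq_iff zero)
      then obtain t where "[:int p:] * poly.coeff U 0 - [:int p ^ 2:] * q = h * t" by (rule dvdE)
      from ph_ideal_cancel[OF h(1) p this] show False using U(2) by simp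
    qed
  qed
  ultimately show ?thesis
    unfolding eisenstein_lift_def I_def using m(3,5) g(1) by simp
qed

text \<open>The counterpart of \<open>presentation_ideal\<close> for typed polynomials, given by
  explicit combinations of the generators so that membership can be computed.\<close>

definition pres_ideal :: "nat \<Rightarrow> nat \<Rightarrow> nat \<Rightarrow> int poly poly \<Rightarrow> int poly \<Rightarrow> int poly poly set" where
  "pres_ideal p a0 a g h = {[:[:int p ^ a0:]:] * A + [:0, 1:] ^ a * B + g * C + [:h:] * E | A B C E. True}"

lemma pres_ideal_add:
  assumes "F \<in> pres_ideal p a0 a g h" "G \<in> pres_ideal p a0 a g h"
  shows "F + G \<in> pres_ideal p a0 a g h"
proof -
  obtain A B C E where F: "F = [:[:int p ^ a0:]:] * A + [:0, 1:] ^ a * B + g * C + [:h:] * E"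
    using assms(1) unfolding pres_ideal_def by blast
  obtain A' B' C' E' where G: "G = [:[:int p ^ a0:]:] * A' + [:0, 1:] ^ a * B' + g * C' + [:h:] * E'"
    using assms(2) unfolding pres_ideal_def by blast
  have "F + G = [:[:int p ^ a0:]:] * (A + A') + [:0, 1:] ^ a * (B + B') + g * (C + C') + [:h:] * (E + E')"
    unfolding F G distrib_left by (simp only: add_ac)
  thus ?thesis unfolding pres_ideal_def by blast
qed

lemma pres_ideal_mult:
  assumes "F \<in> pres_ideal p a0 a g h"
  shows "H * F \<in> pres_ideal p a0 a g h"
proof -
  obtain A B C E where F: "F = [:[:int p ^ a0:]:] * A + [:0, 1:] ^ a * B + g * C + [:h:] * E"
    using assms(1) unfolding pres_ideal_def by blast
  have "H * F = [:[:int p ^ a0:]:] * (H * A) + [:0, 1:] ^ a * (H * B) + g * (H * C) + [:h:] * (H * E)"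
    unfolding F distrib_left by (simp only: mult_ac)
  thus ?thesis unfolding pres_ideal_def by blast
qed

lemma pres_ideal_gens:
  "[:[:int p ^ a0:]:] \<in> pres_ideal p a0 a g h" "[:0, 1:] ^ a \<in> pres_ideal p a0 a g h"
  "g \<in> pres_ideal p a0 a g h" "[:h:] \<in> pres_ideal p a0 a g h"
proof -
  have "F \<in> pres_ideal p a0 a g h" if "F = [:[:int p ^ a0:]:] * A + [:0, 1:] ^ a * B + g * C + [:h:] * E" for F A B C E
    using that unfolding pres_ideal_def by blast
  from this[of _ 1 0 0 0] this[of _ 0 1 0 0] this[of _ 0 0 1 0] this[of _ 0 0 0 1]
  show "[:[:int p ^ a0:]:] \<in> pres_ideal p a0 a g h" "[:0, 1:] ^ a \<in> pres_ideal p a0 a g h"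
    "g \<in> pres_ideal p a0 a g h" "[:h:] \<in> pres_ideal p a0 a g h" by simp_all
qed

text \<open>
  Modulo the ideal \<open>Y^e = p U\<close>, where the constant coefficient of \<open>U\<close> has an inverse modulo \<open>(p, h)\<close>.
  Hence \<open>p (1 + p s)\<close> is a multiple of \<open>Y\<close> for some \<open>s\<close>, and \<open>1 + p s\<close> is a unit as \<open>p\<close> is nilpotent.
\<close>

lemma pres_ideal_p:
  assumes qr: "q * r - 1 \<in> ph_ideal p h" and U: "U = pCons q V" and e: "e > 0"
  shows "\<exists>W. [:[:int p:]:] - [:0, 1:] * W \<in> pres_ideal p a0 a (eis_poly p e U) h"
proof -
  define J where "J = pres_ideal p a0 a (eis_poly p e U) h"
  define y where "y = ([:0, 1:] :: int poly poly)"
  define pp where "pp = [:[:int p:]:]"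
  obtain s t where st: "q * r - 1 = Polynomial.smult (int p) s + h * t" using qr unfolding ph_ideal_def by blast
  have "q * r = 1 + [:int p:] * s + h * t" using st by (simp add: diff_eq_eq add_ac)
  hence "[:q * r:] = [:1 + [:int p:] * s + h * t:]" by (rule arg_cong)
  hence qr': "[:q:] * [:r:] = 1 + pp * [:s:] + [:h:] * [:t:]"
    unfolding pp_def by (simp add: one_pCons mult.commute)
  have ye: "y ^ e = y * y ^ (e - 1)" using e by (metis power_eq_if not_gr0)
  have U': "U = [:q:] + y * V" unfolding U y_def by simp
  have g: "eis_poly p e U = y ^ e - pp * U" unfolding eis_poly_def y_def pp_def by (simp add: monom_altdef)
  \<comment> \<open>Modulo the ideal, \<open>p q = Y^e - p Y V\<close> because
    \<open>Y^e = p U\<close> and \<open>U = q + Y V\<close>. Multiplying by \<open>r\<close>, where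
    \<open>q r\<close> is congruent to \<open>1 + p s\<close>, gives
    \<open>p (1 + p s) = Y W0\<close>.\<close>
  define W0 where "W0 = y ^ (e - 1) * [:r:] - pp * [:r:] * V"
  have "pp * (1 + pp * [:s:]) - y * W0 = eis_poly p e U * (- [:r:]) + [:h:] * (- pp * [:t:])"
  proof -
    have "pp * (1 + pp * [:s:]) = pp * ([:q:] * [:r:]) - pp * [:h:] * [:t:]" unfolding qr' by (simp add: algebra_simps)
    also have "pp * ([:q:] * [:r:]) = [:r:] * (pp * U) - pp * [:r:] * (y * V)" unfolding U' by (simp only: algebra_simps)
    also have "pp * U = y ^ e - eis_poly p e U" unfolding g by simp
    finally show ?thesis unfolding W0_def ye by (simp add: algebra_simps)
  qed
  also have "\<dots> = (- [:r:]) * eis_poly p e U + (- pp * [:t:]) * [:h:]" by (simp only: mult_ac)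
  also have "\<dots> \<in> J" unfolding J_def by (intro pres_ideal_add pres_ideal_mult pres_ideal_gens)
  finally have base: "pp * (1 + pp * [:s:]) - y * W0 \<in> J" .
  define G where "G = (\<Sum>i<a0. (- (pp * [:s:])) ^ i)"
  have "(1 + pp * [:s:]) * G = 1 - (- (pp * [:s:])) ^ a0" unfolding G_def by (rule one_plus_mult_geometric)
  also have "(- (pp * [:s:])) ^ a0 = pp ^ a0 * (- [:s:]) ^ a0" by (metis mult_minus_right power_mult_distrib)
  finally have G: "(1 + pp * [:s:]) * G = 1 - pp ^ a0 * (- [:s:]) ^ a0" .
  have "pp - y * (W0 * G) = G * (pp * (1 + pp * [:s:]) - y * W0) + (pp * (- [:s:]) ^ a0) * pp ^ a0"
  proof -
    have "G * (pp * (1 + pp * [:s:]) - y * W0) = pp * ((1 + pp * [:s:]) * G) - y * (W0 * G)" by (simp only: algebra_simps)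
    also have "\<dots> = pp * (1 - pp ^ a0 * (- [:s:]) ^ a0) - y * (W0 * G)" unfolding G ..
    finally have "G * (pp * (1 + pp * [:s:]) - y * W0) = pp * (1 - pp ^ a0 * (- [:s:]) ^ a0) - y * (W0 * G)" .
    thus ?thesis by (simp only: right_diff_distrib) (simp add: mult_ac)
  qed
  also have "\<dots> \<in> J"
  proof -
    have "pp ^ a0 = [:[:int p ^ a0:]:]" unfolding pp_def by (simp add: poly_const_pow)
    hence "pp ^ a0 \<in> J" unfolding J_def by (simp add: pres_ideal_gens)
    thus ?thesis using base unfolding J_def by (intro pres_ideal_add pres_ideal_mult)
  qed
  finally show ?thesis unfolding J_def y_def pp_def by blast
qed

section \<open>The evaluation of integer polynomials in two variables at (b, \<pi>)\<close>

locale local_PIR_root = local_PIR R \<pi> a e f p for R :: "('r, 'm) ring_scheme" (structure) and \<pi> a e f p +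
  fixes h :: "int poly" and b :: 'r
  assumes h: "Polynomial.lead_coeff h = 1" "Polynomial.degree h = f" "ph_maximal p h"
    and b: "b \<in> carrier R" "peval R (int_img R) b h = \<zero>"
begin

abbreviation "ev1 \<equiv> peval R (int_img R) b"
abbreviation "ev2 \<equiv> peval R ev1 \<pi>"

sublocale b: poly_evaluation R "int_img R" b by unfold_locales (rule b(1))
sublocale ev1: type_ring_hom R ev1 by (rule b.peval_hom)
sublocale pe: poly_evaluation R ev1 \<pi> by unfold_locales (rule \<pi>_carrier)
sublocale ev2: type_ring_hom R ev2 by (rule pe.peval_hom)

lemma P_add: "x \<in> P \<Longrightarrow> z \<in> P \<Longrightarrow> x \<oplus> z \<in> P"
  by (rule additive_subgroup.a_closed[OF P.is_additive_subgroup])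

lemma P_diff: "x \<in> P \<Longrightarrow> z \<in> P \<Longrightarrow> x \<ominus> z \<in> P"
  unfolding a_minus_def by (intro P_add additive_subgroup.a_inv_closed[OF P.is_additive_subgroup])

lemma pR_P: "pR \<in> P" using int_P_iff by simp

lemma ev1_ph: "q \<in> ph_ideal p h \<Longrightarrow> ev1 q \<in> P"
proof -
  assume "q \<in> ph_ideal p h"
  then obtain s t where "q = Polynomial.smult (int p) s + h * t" unfolding ph_ideal_def by blast
  hence "ev1 q = pR \<otimes> ev1 s" by (simp add: b.peval_add b.peval_mult b.peval_smult b)
  thus ?thesis using P.I_r_closed[OF pR_P] by simp
qed

text \<open>The preimage of \<open>P\<close> is a proper ideal that contains the maximal ideal (p,
  h).\<close>

lemma ev1_P_iff: "ev1 q \<in> P \<longleftrightarrow> q \<in> ph_ideal p h"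
proof (rule iffI[OF _ ev1_ph], rule ccontr)
  assume q: "ev1 q \<in> P" "q \<notin> ph_ideal p h"
  then obtain r where r: "q * r - 1 \<in> ph_ideal p h" using h(3) unfolding ph_maximal_def by blast
  have "ev1 (q * r) \<ominus> ev1 (q * r - 1) \<in> P"
    using P_diff[OF _ ev1_ph[OF r]] P.I_r_closed[OF q(1), of "ev1 r"] by (simp add: ev1.hom_mult)
  hence "ev1 (q * r - (q * r - 1)) \<in> P" by (simp only: ev1.hom_diff)
  thus False using one_notin_P by (simp add: ev1.hom_one)
qed

text \<open>The image of Z[X] in the residue field is Z[X]/(p, h), which has \<open>p ^ f\<close>
  elements, as many as the whole field.\<close>

lemma ev1_surj_mod_P:
  assumes x: "x \<in> carrier R"
  obtains q r where "r \<in> carrier R" "x = ev1 q \<oplus> \<pi> \<otimes> r"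
proof -
  have hom: "type_ring_hom k (\<lambda>q. \<kappa> (ev1 q))"
    by (rule type_ring_hom_compose[OF ev1.type_ring_hom_axioms field.axioms(1)[OF k_field, THEN domain.axioms(1)] \<kappa>_hom])
  have ker: "\<kappa> (ev1 q) = \<zero>\<^bsub>k\<^esub> \<longleftrightarrow> q \<in> ph_ideal p h" for q
    unfolding \<kappa>_zero[OF ev1.hom_closed] by (rule ev1_P_iff)
  have "card (range (\<lambda>q. \<kappa> (ev1 q))) = p ^ f"
    using card_ph_quotient[OF hom ker h(1) ph_maximal_degree[OF h(3,1)]] p_prime prime_gt_0_nat h(2) by simp
  hence "range (\<lambda>q. \<kappa> (ev1 q)) = carrier k"
    using k_card by (intro card_subset_eq[OF k_fin]) (auto simp: k_carrier)
  then obtain q where "\<kappa> x = \<kappa> (ev1 q)" using x unfolding k_carrier by blast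
  hence "x \<ominus> ev1 q \<in> P" using quotient_eq_iff_same_a_r_cos[OF P.is_ideal x ev1.hom_closed] by simp
  then obtain r where r: "r \<in> carrier R" "x \<ominus> ev1 q = r \<otimes> \<pi>" unfolding P_iff by blast
  have "x = ev1 q \<oplus> (x \<ominus> ev1 q)" using x by (simp add: a_minus_def a_ac r_neg r_neg1 r_neg2)
  thus thesis using that[OF r(1), of q] r \<pi>_carrier by (simp add: m_comm)
qed

lemma ev2_monom: "ev2 (Polynomial.monom q n) = ev1 q \<otimes> \<pi> [^] n"
proof -
  have "Polynomial.monom q n = [:q:] * [:0, 1:] ^ n" by (simp add: monom_altdef)
  thus ?thesis by (simp only: ev2.hom_mult ev2.hom_power pe.peval_const pe.peval_X)
qed

text \<open>The \<open>\<pi>\<close>-adic expansion up to order \<open>n\<close>, with digits in the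
  image of Z[X].\<close>

lemma ev2_approx:
  assumes x: "x \<in> carrier R"
  shows "\<exists>F. \<exists>r\<in>carrier R. x = ev2 F \<oplus> \<pi> [^] n \<otimes> r \<and> (\<forall>i\<ge>n. poly.coeff F i = 0)"
proof (induction n)
  case 0
  show ?case using x by (intro exI[of _ 0] bexI[of _ x]) (auto simp: ev2.hom_zero)
next
  case (Suc n)
  then obtain F r where F: "r \<in> carrier R" "x = ev2 F \<oplus> \<pi> [^] n \<otimes> r" "\<forall>i\<ge>n. poly.coeff F i = 0" by blast
  obtain q r' where r': "r' \<in> carrier R" "r = ev1 q \<oplus> \<pi> \<otimes> r'" by (rule ev1_surj_mod_P[OF F(1)])
  have "x = ev2 (F + Polynomial.monom q n) \<oplus> \<pi> [^] Suc n \<otimes> r'"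
    unfolding F(2) r'(2) ev2.hom_add ev2_monom using \<pi>_carrier r'(1)
    by (simp add: r_distr m_ac a_ac)
  thus ?case using r'(1) F(3) by (intro exI[of _ "F + Polynomial.monom q n"] bexI[of _ r']) auto
qed

lemma pR_nilpotent: "pR [^] a = \<zero>"
proof -
  obtain v where v: "v \<in> carrier R" "pR = v \<otimes> \<pi>" using pR_P unfolding P_iff by blast
  thus ?thesis using \<pi>_pow_a \<pi>_carrier by (simp add: nat_pow_distrib)
qed

text \<open>An expansion in \<open>\<pi>\<close> alone would need powers up to \<open>a\<close>.
  Stopping at \<open>\<pi> ^ e = p u\<close> and carrying on with powers of the nilpotent element
  \<open>p\<close> keeps the degree in \<open>Y\<close> below \<open>e\<close>, as the Eisenstein
  polynomial requires of \<open>U\<close>.\<close>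

lemma ev2_surj:
  assumes x: "x \<in> carrier R"
  obtains F where "x = ev2 F" "Polynomial.degree F < e"
proof -
  obtain u where u: "u \<in> Units R" "\<pi> [^] e = pR \<otimes> u" using p_ramified(3) by blast
  have "\<exists>F. \<exists>r\<in>carrier R. x = ev2 F \<oplus> pR [^] m \<otimes> r \<and> (\<forall>i\<ge>e. poly.coeff F i = 0)" for m :: nat
  proof (induction m)
    case 0
    show ?case using x by (intro exI[of _ 0] bexI[of _ x]) (auto simp: ev2.hom_zero)
  next
    case (Suc m)
    then obtain F r where F: "r \<in> carrier R" "x = ev2 F \<oplus> pR [^] m \<otimes> r" "\<forall>i\<ge>e. poly.coeff F i = 0" by blast
    obtain G r' where G: "r' \<in> carrier R" "r = ev2 G \<oplus> \<pi> [^] e \<otimes> r'" "\<forall>i\<ge>e. poly.coeff G i = 0"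
      using ev2_approx[OF F(1), of e] by blast
    have uc: "u \<in> carrier R" using u(1) by (rule Units_closed)
    have c: "ev2 [:[:int p ^ m:]:] = pR [^] m"
      unfolding pe.peval_const b.peval_const i.hom_power ..
    have "x = ev2 (F + [:[:int p ^ m:]:] * G) \<oplus> pR [^] Suc m \<otimes> (u \<otimes> r')"
      unfolding F(2) G(2) ev2.hom_add ev2.hom_mult c u(2) using uc G(1)
      by (simp add: r_distr m_ac a_ac)
    thus ?case using uc G F(3) by (intro exI[of _ "F + [:[:int p ^ m:]:] * G"] bexI[of _ "u \<otimes> r'"]) auto
  qed
  from this[of a] obtain F r where F: "r \<in> carrier R" "x = ev2 F \<oplus> pR [^] a \<otimes> r" "\<forall>i\<ge>e. poly.coeff F i = 0" by blast
  have "x = ev2 F" using F(1,2) pR_nilpotent by simp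
  moreover have "Polynomial.degree F < e"
    using F(3) p_ramified(1) by (metis degree_0 leading_coeff_0_iff not_le)
  ultimately show thesis using that by blast
qed

lemma exists_U:
  obtains U where "Polynomial.degree U < e" "poly.coeff U 0 \<notin> ph_ideal p h" "ev2 (eis_poly p e U) = \<zero>"
proof -
  obtain u where u: "u \<in> Units R" "\<pi> [^] e = pR \<otimes> u" using p_ramified(3) by blast
  have uc: "u \<in> carrier R" using u(1) by (rule Units_closed)
  obtain U where U: "u = ev2 U" "Polynomial.degree U < e" by (rule ev2_surj[OF uc])
  obtain q V where qV: "U = pCons q V" by (metis pCons_cases)
  have "q \<notin> ph_ideal p h"
  proof
    assume "q \<in> ph_ideal p h"
    hence "ev1 q \<in> P" by (rule ev1_ph)
    hence "u \<in> P" unfolding U(1) qV pe.peval_pCons using P.I_r_closed[OF \<pi>_P, of "ev2 V"] by (intro P_add) auto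
    thus False using unit_iff[OF uc] u(1) by simp
  qed
  moreover have "ev2 (eis_poly p e U) = \<zero>"
    unfolding eis_poly_def ev2.hom_diff ev2.hom_mult ev2_monom pe.peval_const b.peval_const U(1)[symmetric] ev1.hom_one
    using u(2) \<pi>_carrier uc by (simp add: r_right_minus_eq)
  ultimately show thesis using that[of U] U(2) qV by simp
qed

text \<open>
  Modulo the ideal, \<open>p\<close> is a multiple of \<open>Y\<close>, so that a polynomial in the kernel becomes a multiple of
  \<open>Y\<close>, \<open>Y^2\<close>, \<open>\<dots>\<close>, and finally of \<open>Y^a\<close>.
\<close>

lemma ev2_kernel:
  assumes U: "Polynomial.degree U < e" "poly.coeff U 0 \<notin> ph_ideal p h" "ev2 (eis_poly p e U) = \<zero>"
    and a0: "a \<le> e * a0"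
  shows "ev2 F = \<zero> \<longleftrightarrow> F \<in> pres_ideal p a0 a (eis_poly p e U) h"
proof -
  define J where "J = pres_ideal p a0 a (eis_poly p e U) h"
  \<comment> \<open>\<open>p ^ a0\<close> and \<open>\<pi> ^ (e a0)\<close> differ by a unit, and
    the second exponent is at least \<open>a\<close>.\<close>
  have pa0: "pR [^] a0 = \<zero>"
  proof -
    obtain u where u: "u \<in> Units R" "\<pi> [^] e = pR \<otimes> u" using p_ramified(3) by blast
    have uc: "u \<in> carrier R" using u(1) by (rule Units_closed)
    have uu: "u [^] a0 \<in> Units R" using u(1) by (induction a0) auto
    obtain j where j: "e * a0 = a + j" using a0 le_Suc_ex by blast
    have "pR [^] a0 \<otimes> u [^] a0 = (\<pi> [^] e) [^] a0" unfolding u(2) using uc by (simp add: nat_pow_distrib)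
    also have "\<dots> = \<zero>" using \<pi>_carrier \<pi>_pow_a by (simp add: nat_pow_pow j nat_pow_mult[symmetric])
    finally have "pR [^] a0 \<otimes> u [^] a0 \<otimes> inv (u [^] a0) = \<zero>" using uu by simp
    thus ?thesis using uu Units_closed[OF uu] by (simp add: m_assoc)
  qed
  have J0: "ev2 G = \<zero>" if GJ: "G \<in> J" for G
  proof -
    obtain A B C E where G: "G = [:[:int p ^ a0:]:] * A + [:0, 1:] ^ a * B + eis_poly p e U * C + [:h:] * E"
      using GJ unfolding J_def pres_ideal_def by blast
    show ?thesis
      unfolding G ev2.hom_add ev2.hom_mult ev2.hom_power pe.peval_const pe.peval_X b.peval_const i.hom_power
        pa0 \<pi>_pow_a U(3) b(2) by simp
  qed
  obtain q V where qV: "U = pCons q V" by (metis pCons_cases)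
  obtain r where "q * r - 1 \<in> ph_ideal p h" using h(3) U(2) qV unfolding ph_maximal_def by auto
  from pres_ideal_p[OF this qV p_ramified(1)] obtain W where W: "[:[:int p:]:] - [:0, 1:] * W \<in> J"
    unfolding J_def by blast
  have "\<exists>G. F - [:0, 1:] ^ n * G \<in> J" if F: "ev2 F = \<zero>" and n: "n \<le> a" for n
    using n
  proof (induction n)
    case 0
    have "0 * [:h:] \<in> J" unfolding J_def by (intro pres_ideal_mult pres_ideal_gens)
    thus ?case by (intro exI[of _ F]) simp
  next
    case (Suc n)
    then obtain G where G: "F - [:0, 1:] ^ n * G \<in> J" by auto
    have "ev2 F \<ominus> \<pi> [^] n \<otimes> ev2 G = \<zero>"
      using J0[OF G] by (simp only: ev2.hom_diff ev2.hom_mult ev2.hom_power pe.peval_X)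
    hence z: "\<pi> [^] n \<otimes> ev2 G = \<zero>" unfolding F using \<pi>_carrier by (simp add: a_minus_def)
    \<comment> \<open>For \<open>n < a\<close> the power \<open>\<pi> ^ n\<close> is not zero, so it
      cannot be killed by a unit.\<close>
    have GP: "ev2 G \<in> P"
    proof (rule ccontr)
      assume "ev2 G \<notin> P"
      hence u: "ev2 G \<in> Units R" using unit_iff by simp
      have "\<pi> [^] n = \<pi> [^] n \<otimes> ev2 G \<otimes> inv (ev2 G)" using u \<pi>_carrier by (simp add: m_assoc)
      also have "\<dots> = \<zero>" unfolding z using u by simp
      finally show False using \<pi>_pow_less[of n] Suc.prems by simp
    qed
    obtain q0 V0 where qV0: "G = pCons q0 V0" by (metis pCons_cases)
    have "ev1 q0 = ev2 G \<ominus> \<pi> \<otimes> ev2 V0"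
      unfolding qV0 pe.peval_pCons using \<pi>_carrier by (simp add: a_minus_def a_assoc r_neg)
    also have "\<dots> \<in> P" by (intro P_diff GP P.I_r_closed[OF \<pi>_P]) simp
    finally have "q0 \<in> ph_ideal p h" unfolding ev1_P_iff .
    then obtain s t where st: "q0 = Polynomial.smult (int p) s + h * t" unfolding ph_ideal_def by blast
    have "G = [:[:int p:]:] * [:s:] + [:h:] * [:t:] + [:0, 1:] * V0" unfolding qV0 st by simp
    hence "F - [:0, 1:] ^ Suc n * (W * [:s:] + V0)
        = (F - [:0, 1:] ^ n * G) + ([:0, 1:] ^ n * [:s:]) * ([:[:int p:]:] - [:0, 1:] * W) + ([:0, 1:] ^ n * [:t:]) * [:h:]"
      by (simp only: power_Suc2 algebra_simps)
    also have "\<dots> \<in> J"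
      using G W unfolding J_def by (intro pres_ideal_add pres_ideal_mult pres_ideal_gens)
    finally show ?case by blast
  qed
  moreover have "F \<in> J" if "F - [:0, 1:] ^ a * G \<in> J" for G
  proof -
    have "(F - [:0, 1:] ^ a * G) + G * [:0, 1:] ^ a \<in> J"
      using that unfolding J_def by (intro pres_ideal_add pres_ideal_mult pres_ideal_gens)
    thus ?thesis by (simp add: mult.commute)
  qed
  ultimately show ?thesis using J0 unfolding J_def[symmetric] by blast
qed

text \<open>The first isomorphism theorem for the evaluation at \<open>(b, \<pi>)\<close>.
  Surjectivity and kernel are known for typed polynomials and are transported to lists.\<close>

lemma presentation:
  assumes U: "Polynomial.degree U < e" "poly.coeff U 0 \<notin> ph_ideal p h" "ev2 (eis_poly p e U) = \<zero>"
    and a0: "a \<le> e * a0"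
  defines "J \<equiv> presentation_ideal p a0 a (ZX.\<Theta> (eis_poly p e U)) (Z\<Theta>.\<Theta> h)"
  shows "\<exists>\<phi>\<in>ring_iso (ZXY Quot J) R. \<phi> (J +>\<^bsub>ZXY\<^esub> ZX_to_ZXY X\<^bsub>\<Z>\<^esub>) = b \<and> \<phi> (J +>\<^bsub>ZXY\<^esub> X\<^bsub>ZX\<^esub>) = \<pi>"
proof -
  obtain \<chi> where \<chi>: "\<chi> \<in> ring_hom ZXY R" "\<And>F. \<chi> (ZX.\<Theta> F) = ev2 F"
  proof (rule type_ring_hom_factor[OF ZXY.type_ring_hom_axioms ZX_surj ev2.type_ring_hom_axioms])
    fix q assume "ZX.\<Theta> q = \<zero>\<^bsub>ZXY\<^esub>"
    thus "ev2 q = \<zero>" by (simp only: ZX_zero ev2.hom_zero)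
  qed (rule that)
  interpret \<chi>: ring_hom_ring ZXY R \<chi>
    by (rule ring_hom_ringI2[OF ZXY.ring_axioms ring_axioms \<chi>(1)])
  have surj: "\<chi> ` carrier ZXY = carrier R"
  proof
    show "carrier R \<subseteq> \<chi> ` carrier ZXY"
    proof
      fix x assume "x \<in> carrier R"
      then obtain F where "x = ev2 F" by (rule ev2_surj)
      thus "x \<in> \<chi> ` carrier ZXY" using \<chi>(2)[of F, symmetric] ZXY.hom_closed[of F] by (simp only: image_eqI)
    qed
  qed (use ring_hom_closed[OF \<chi>(1)] in blast)
  define Sg where "Sg = {int_img ZXY (int (p ^ a0)), X\<^bsub>ZX\<^esub> [^]\<^bsub>ZXY\<^esub> a, ZX.\<Theta> (eis_poly p e U), ZX_to_ZXY (Z\<Theta>.\<Theta> h)}"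
  have int: "int_img ZXY n = ZX.\<Theta> [:[:n:]:]" for n
    by (rule int_hom_eq_int_img[OF type_ring_hom_comp_type[OF ZXY.type_ring_hom_axioms], symmetric]) (auto simp: one_pCons)
  have gens: "Sg = ZX.\<Theta> ` {[:[:int p ^ a0:]:], [:0, 1:] ^ a, eis_poly p e U, [:h:]}"
    unfolding Sg_def int by (simp only: ZXY.hom_power ZX.list_poly_X ZX.list_poly_const image_insert image_empty of_nat_power)
  have Sg: "Sg \<subseteq> carrier ZXY" unfolding gens by (blast intro: ZXY.hom_closed)
  have J: "J = Idl\<^bsub>ZXY\<^esub> Sg" unfolding J_def presentation_ideal_def Sg_def ..
  interpret J: ideal J ZXY unfolding J by (rule ZXY.genideal_ideal[OF Sg])
  have "a_kernel ZXY R \<chi> = J"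
  proof
    have "ZX.\<Theta> F \<in> a_kernel ZXY R \<chi>"
      if "F \<in> {[:[:int p ^ a0:]:], [:0, 1:] ^ a, eis_poly p e U, [:h:]}" for F
    proof -
      have "F \<in> pres_ideal p a0 a (eis_poly p e U) h" using that pres_ideal_gens by blast
      hence "\<chi> (ZX.\<Theta> F) = \<zero>" by (simp only: \<chi>(2) ev2_kernel[OF U a0])
      thus ?thesis unfolding a_kernel_def' using ZXY.hom_closed by blast
    qed
    hence "Sg \<subseteq> a_kernel ZXY R \<chi>" unfolding gens by blast
    thus "J \<subseteq> a_kernel ZXY R \<chi>" unfolding J by (rule ZXY.genideal_minimal[OF \<chi>.kernel_is_ideal])
    show "a_kernel ZXY R \<chi> \<subseteq> J"
    proof
      fix l assume "l \<in> a_kernel ZXY R \<chi>"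
      hence l: "l \<in> carrier ZXY" "\<chi> l = \<zero>" unfolding a_kernel_def' by blast+
      then obtain F where F: "l = ZX.\<Theta> F" using ZX_surj by blast
      hence "F \<in> pres_ideal p a0 a (eis_poly p e U) h" using l(2) by (simp only: \<chi>(2) ev2_kernel[OF U a0])
      then obtain A B C E where "F = A * [:[:int p ^ a0:]:] + B * [:0, 1:] ^ a + C * eis_poly p e U + E * [:h:]"
        unfolding pres_ideal_def by (auto simp: mult.commute)
      moreover have "ZX.\<Theta> (A * G) \<in> J" if "G \<in> {[:[:int p ^ a0:]:], [:0, 1:] ^ a, eis_poly p e U, [:h:]}" for A G
      proof -
        have "ZX.\<Theta> G \<in> Sg" using that unfolding gens by blast
        hence "ZX.\<Theta> G \<in> J" using ZXY.genideal_self[OF Sg] unfolding J by blast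
        thus ?thesis unfolding ZXY.hom_mult by (rule J.I_l_closed[OF _ ZXY.hom_closed])
      qed
      ultimately show "l \<in> J"
        unfolding F by (simp only: ZXY.hom_add) (intro additive_subgroup.a_closed[OF J.is_additive_subgroup]; blast)
    qed
  qed
  with \<chi>.FactRing_iso_set[OF surj] have iso: "(\<lambda>C. the_elem (\<chi> ` C)) \<in> ring_iso (ZXY Quot J) R" by simp
  have val: "the_elem (\<chi> ` (J +>\<^bsub>ZXY\<^esub> ZX.\<Theta> F)) = ev2 F" for F
    using \<chi>.the_elem_simp[OF ZXY.hom_closed[of F]] unfolding \<open>a_kernel ZXY R \<chi> = J\<close> \<chi>(2) .
  have X1: "ZX_to_ZXY X\<^bsub>\<Z>\<^esub> = ZX.\<Theta> [:[:0, 1:]:]" by (simp only: ZX.list_poly_const Z\<Theta>.list_poly_X)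
  have X2: "X\<^bsub>ZX\<^esub> = ZX.\<Theta> [:0, 1:]" by (simp only: ZX.list_poly_X)
  show ?thesis
    unfolding X1 X2 using iso val[of "[:[:0, 1:]:]"] val[of "[:0, 1:]"]
    by (intro bexI[OF _ iso]) (simp only: pe.peval_const b.peval_X pe.peval_X)
qed

end

section \<open>Subfields of the complex numbers\<close>

lemma (in cring) mem_ring_of_integers_iff:
  "l \<in> carrier (\<O> R) \<longleftrightarrow> l \<in> carrier R \<and> (\<exists>q. Polynomial.lead_coeff q = 1 \<and> peval R (int_img R) l q = \<zero>)"
proof -
  have monic: "Defs.monic \<Z> (rev (coeffs q))" if "Polynomial.lead_coeff q = 1" for q :: "int poly"
    using Z\<Theta>.list_poly_monic(5)[OF that] by (simp add: type_ring_list_poly)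
  have "(\<exists>q. Defs.monic \<Z> q \<and> int_eval R q l = \<zero>) \<longleftrightarrow> (\<exists>q. Polynomial.lead_coeff q = 1 \<and> int_eval R (rev (coeffs q)) l = \<zero>)"
  proof
    assume "\<exists>q. Defs.monic \<Z> q \<and> int_eval R q l = \<zero>"
    then obtain k where k: "Defs.monic \<Z> k" "int_eval R k l = \<zero>" by blast
    obtain q where "k = rev (coeffs q)" "Polynomial.lead_coeff q = 1" by (rule monic_int_list[OF k(1)])
    thus "\<exists>q. Polynomial.lead_coeff q = 1 \<and> int_eval R (rev (coeffs q)) l = \<zero>" using k(2) by blast
  qed (use monic in blast)
  thus ?thesis using int_eval_eq_peval unfolding ring_of_integers_def by auto
qed

text \<open>A field record \<open>M\<close> that the embedding \<open>j\<close> identifies with the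
  ring Q[x, y] inside the complex numbers. The quotient fields of the statement are studied through
  such embeddings.\<close>

locale eis_model = eis_data p h U e x y + M: field M
  for p h U e x y and M :: "('a, 'm) ring_scheme" (structure) +
  fixes j :: "'a \<Rightarrow> complex" and yM :: 'a
  assumes p_prime: "Factorial_Ring.prime p"
    and j: "j \<in> ring_hom M type_ring" and j_range: "j ` carrier M = range evq"
    and yM: "yM \<in> carrier M" "j yM = y"
begin

lemma j_add: "a \<in> carrier M \<Longrightarrow> b \<in> carrier M \<Longrightarrow> j (a \<oplus> b) = j a + j b"
  using ring_hom_add[OF j] by simp

lemma j_mult: "a \<in> carrier M \<Longrightarrow> b \<in> carrier M \<Longrightarrow> j (a \<otimes> b) = j a * j b"
  using ring_hom_mult[OF j] by simp

lemma j_one: "j \<one> = 1" using ring_hom_one[OF j] by simp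

lemma j_zero: "j \<zero> = 0" using j_add[of \<zero> \<zero>] by simp

lemma j_uminus: "a \<in> carrier M \<Longrightarrow> j (\<ominus> a) = - j a"
  using j_add[of a "\<ominus> a"] j_zero by (simp add: M.r_neg eq_neg_iff_add_eq_0 add.commute)

lemma j_power: "a \<in> carrier M \<Longrightarrow> j (a [^] (n::nat)) = j a ^ n"
  by (induction n) (simp_all add: j_one j_mult)

lemma j_eq_0_iff: "a \<in> carrier M \<Longrightarrow> j a = 0 \<longleftrightarrow> a = \<zero>"
proof
  assume a: "a \<in> carrier M" "j a = 0"
  show "a = \<zero>"
  proof (rule ccontr)
    assume "a \<noteq> \<zero>"
    hence "j (a \<otimes> inv a) = 1" "inv a \<in> carrier M" using a M.field_Units j_one by auto
    thus False using j_mult[OF a(1)] a(2) by simp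
  qed
qed (simp add: j_zero)

lemma j_eq_iff: "a \<in> carrier M \<Longrightarrow> b \<in> carrier M \<Longrightarrow> j a = j b \<longleftrightarrow> a = b"
proof -
  assume ab: "a \<in> carrier M" "b \<in> carrier M"
  have "j (a \<ominus> b) = j a - j b" using ab by (simp add: a_minus_def j_add j_uminus)
  thus ?thesis using j_eq_0_iff[of "a \<ominus> b"] ab by simp
qed

lemma j_inv: "a \<in> carrier M \<Longrightarrow> a \<noteq> \<zero> \<Longrightarrow> j (inv a) = inverse (j a)"
  using j_mult[of a "inv a"] M.field_Units j_one by (simp add: inverse_unique)

lemma j_int: "j (int_img M n) = of_int n"
proof -
  have "type_ring_hom type_ring (\<lambda>n. j (int_img M n))"
    by (rule type_ring_hom_compose[OF M.int_img_hom type_ring_cring j])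
  moreover have "type_ring_hom (type_ring :: complex ring) (of_int :: int \<Rightarrow> complex)"
    by (intro type_ring_hom.intro type_ring_hom_axioms.intro type_ring_cring) simp_all
  ultimately show ?thesis by (rule int_hom_unique)
qed

lemma int_img_closed: "int_img M n \<in> carrier M"
  using type_ring_hom.hom_closed[OF M.int_img_hom] .

lemma B_evq: "b \<in> B \<Longrightarrow> b \<in> range evq"
  unfolding B_def by (auto simp flip: ev_int_poly_poly)

lemma lift_B:
  assumes "b \<in> B"
  obtains l where "l \<in> carrier M" "j l = b"
  using B_evq[OF assms] unfolding j_range[symmetric] by blast

lemma j_peval:
  assumes l: "l \<in> carrier M"
  shows "j (peval M (int_img M) l q) = poly (of_int_poly q) (j l)"
proof -
  interpret i: type_ring_hom M "int_img M" by (rule M.int_img_hom)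
  interpret poly_evaluation M "int_img M" l by unfold_locales (rule l)
  show ?thesis
    by (induction q) (simp_all add: peval_0 peval_pCons j_zero j_add j_mult j_int l peval_closed)
qed

lemma integral_iff: "l \<in> carrier (\<O> M) \<longleftrightarrow> l \<in> carrier M \<and> algebraic_int (j l)"
proof -
  interpret i: type_ring_hom M "int_img M" by (rule M.int_img_hom)
  have "peval M (int_img M) l q = \<zero> \<longleftrightarrow> poly (of_int_poly q) (j l) = 0" if l: "l \<in> carrier M" for q
  proof -
    interpret poly_evaluation M "int_img M" l by unfold_locales (rule l)
    show ?thesis unfolding j_peval[OF l, symmetric] by (simp only: j_eq_0_iff peval_closed)
  qed
  thus ?thesis unfolding M.mem_ring_of_integers_iff algebraic_int_iff_monic_root by blast
qed

lemma preimage_subring: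
  assumes "1 \<in> A" "\<And>a. a \<in> A \<Longrightarrow> - a \<in> A" "\<And>a b. a \<in> A \<Longrightarrow> b \<in> A \<Longrightarrow> a * b \<in> A"
    "\<And>a b. a \<in> A \<Longrightarrow> b \<in> A \<Longrightarrow> a + b \<in> A"
  shows "subring {l \<in> carrier M. j l \<in> A} M"
  using assms by (intro M.subringI) (auto simp: j_one j_uminus j_mult j_add)

abbreviation "BM \<equiv> {l \<in> carrier M. j l \<in> B}"
abbreviation "DM \<equiv> {l \<in> carrier M. j l \<in> D}"

lemma yDM_iff:
  assumes l: "l \<in> carrier M"
  shows "l \<in> (\<otimes>) yM ` DM \<longleftrightarrow> (\<exists>d\<in>D. j l = y * d)"
proof
  assume "l \<in> (\<otimes>) yM ` DM"
  thus "\<exists>d\<in>D. j l = y * d" using yM j_mult by auto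
next
  assume "\<exists>d\<in>D. j l = y * d"
  then obtain d where d: "d \<in> D" "j l = y * d" by blast
  have y0: "yM \<noteq> \<zero>" using yM(2) y_nonzero j_zero by auto
  define m where "m = inv yM \<otimes> l"
  have c: "inv yM \<in> carrier M" "m \<in> carrier M" unfolding m_def using y0 yM(1) l M.field_Units by auto
  have "j m = d" unfolding m_def using c l yM y0 d(2) y_nonzero by (simp add: j_mult j_inv)
  moreover have "l = yM \<otimes> m"
    using c l yM d(2) \<open>j m = d\<close> by (subst j_eq_iff[symmetric]) (simp_all add: j_mult)
  ultimately show "l \<in> (\<otimes>) yM ` DM" using c d(1) by blast
qed

text \<open>Every condition is pulled back along \<open>j\<close> from the facts on
  \<open>B\<close>, \<open>D\<close>, \<open>S\<close> and \<open>W\<close> in the complex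
  numbers.\<close>

lemma valued_field: "valued_field M p e yM BM DM"
proof (intro valued_field.intro valued_field_axioms.intro)
  show "field M" by (rule M.field_axioms)
  show "Factorial_Ring.prime p" "e > 0" by (fact p_prime, fact e)
  have "carrier (\<O> M) = {l \<in> carrier M. j l \<in> Collect algebraic_int}" using integral_iff by auto
  moreover have "subring \<dots> M"
    by (rule preimage_subring) (auto intro: algebraic_int_add_mult algebraic_int_minus)
  ultimately show "subring (carrier (\<O> M)) M" by simp
  show "subring DM M" by (rule preimage_subring) (auto intro: B_D B_1 D_uminus D_mult D_add)
  show "subring BM M" by (rule preimage_subring) (auto intro: B_intros)
  show "BM \<subseteq> carrier (\<O> M)" using B_algebraic_int integral_iff by auto
  show "carrier (\<O> M) \<subseteq> DM"
  proof
    fix l assume "l \<in> carrier (\<O> M)"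
    hence "l \<in> carrier M" "algebraic_int (j l)" using integral_iff by blast+
    thus "l \<in> DM" using algebraic_int_D[of "j l"] j_range by blast
  qed
  show "yM \<in> BM" using yM B_y by simp
  show "yM \<noteq> \<zero>" using yM(2) y_nonzero j_zero by auto
next
  fix d assume d: "d \<in> DM"
  show "yM \<otimes> d \<noteq> \<one>"
  proof
    assume "yM \<otimes> d = \<one>"
    hence "j (yM \<otimes> d) = 1" by (simp only: j_one)
    hence "y * j d = 1" using d yM by (simp add: j_mult)
    thus False using y_mult_notin_W[of "j d"] d S_W[OF one_S] by simp
  qed
next
  fix l assume l: "l \<in> carrier M" "l \<noteq> \<zero>"
  have "j l \<in> range evq" "j l \<noteq> 0" using l j_range j_eq_0_iff by auto
  then obtain n w where w: "w \<in> W" "j l = y ^ n * w \<or> j l * y ^ n = w" using nonzero_decompose by blast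
  have yn: "yM [^] n \<in> carrier M" "j (yM [^] n) = y ^ n" "yM [^] n \<noteq> \<zero>"
    using yM j_power[OF yM(1), of n] y_nonzero j_zero by auto
  have "\<exists>v\<in>carrier M. j v = w \<and> (l = yM [^] n \<otimes> v \<or> l \<otimes> yM [^] n = v)"
  proof (cases "j l * y ^ n = w")
    case True
    thus ?thesis using l yn by (intro bexI[of _ "l \<otimes> yM [^] n"]) (auto simp: j_mult)
  next
    case False
    hence eq: "j l = y ^ n * w" using w(2) by simp
    define v where "v = inv (yM [^] n) \<otimes> l"
    have v: "v \<in> carrier M" "j v = w"
      unfolding v_def using l yn eq M.field_Units y_nonzero by (auto simp: j_mult j_inv)
    hence "l = yM [^] n \<otimes> v" using l yn eq by (subst j_eq_iff[symmetric]) (simp_all add: j_mult)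
    thus ?thesis using v by blast
  qed
  then obtain v where v: "v \<in> carrier M" "j v = w" "l = yM [^] n \<otimes> v \<or> l \<otimes> yM [^] n = v" by blast
  have v0: "v \<noteq> \<zero>" using v(2) W_nonzero[OF w(1)] j_zero by auto
  have "inv v \<in> DM" using v v0 M.field_Units W_D[OF W_inverse[OF w(1)]] by (simp add: j_inv)
  moreover have "v \<in> DM" using v W_D[OF w(1)] by simp
  ultimately show "\<exists>n::nat. \<exists>w\<in>DM. w \<noteq> \<zero> \<and> inv w \<in> DM \<and> (l = yM [^] n \<otimes> w \<or> l \<otimes> yM [^] n = w)"
    using v(3) v0 by blast
next
  fix d assume d: "d \<in> DM"
  then obtain s where s: "s \<in> S" "s * j d \<in> B" unfolding D_def by blast
  obtain t where t: "t \<in> carrier M" "j t = s" by (rule lift_B[OF S_B[OF s(1)]])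
  have "t \<notin> (\<otimes>) yM ` DM" using s(1) S_iff[of s] t yDM_iff by simp
  moreover have "t \<otimes> d \<in> BM" using t d s by (simp add: j_mult)
  ultimately show "\<exists>s\<in>BM. s \<notin> (\<otimes>) yM ` DM \<and> s \<otimes> d \<in> BM" using t S_B[OF s(1)] by blast
next
  fix s assume s: "s \<in> DM" "s \<notin> (\<otimes>) yM ` DM"
  have "j s \<in> range evq" "j s \<in> D" "\<not> (\<exists>d\<in>D. j s = y * d)" using s j_range yDM_iff[of s] by auto
  from unit_mod_p[OF this] obtain t z where tz: "t \<in> B" "z \<in> B" "j s * t = 1 + pc * z" by blast
  obtain t' where t': "t' \<in> carrier M" "j t' = t" by (rule lift_B[OF tz(1)])
  obtain z' where z': "z' \<in> carrier M" "j z' = z" by (rule lift_B[OF tz(2)])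
  have "s \<otimes> t' = \<one> \<oplus> int_img M (int p) \<otimes> z'"
    using s t' z' tz int_img_closed
    by (subst j_eq_iff[symmetric]) (simp_all add: j_mult j_add j_one j_int)
  thus "\<exists>t\<in>BM. \<exists>z\<in>BM. s \<otimes> t = \<one> \<oplus> int_img M (int p) \<otimes> z" using t' z' tz by blast
next
  obtain u where u: "u \<in> carrier M" "j u = ev U" by (rule lift_B[OF B_ev])
  have "u \<notin> (\<otimes>) yM ` DM" using ev_U_S S_iff[of "ev U"] u yDM_iff by simp
  moreover have "int_img M (int p) \<otimes> u = yM [^] e"
    using u yM int_img_closed y by (subst j_eq_iff[symmetric]) (simp_all add: j_mult j_power j_int)
  moreover have "u \<in> BM" using u B_ev by simp
  ultimately show "\<exists>u\<in>BM. u \<notin> (\<otimes>) yM ` DM \<and> int_img M (int p) \<otimes> u = yM [^] e" by blast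
qed

sublocale V: valued_field M p e yM BM DM by (rule valued_field)

end

text \<open>Equality of the two kernels makes the induced map to the complex numbers injective, so
  \<open>L\<close> is a domain.\<close>

lemma type_ring_hom_embed:
  assumes \<psi>: "type_ring_hom L \<psi>" and surj: "\<psi> ` UNIV = carrier L"
    and \<chi>: "type_ring_hom (type_ring :: complex ring) \<chi>"
    and ker: "\<And>q. \<psi> q = \<zero>\<^bsub>L\<^esub> \<longleftrightarrow> \<chi> q = 0"
  obtains j where "j \<in> ring_hom L (type_ring :: complex ring)" "\<And>q. j (\<psi> q) = \<chi> q" "domain L"
proof -
  interpret a: type_ring_hom L \<psi> by fact
  interpret b: type_ring_hom "type_ring :: complex ring" \<chi> by fact
  obtain j where j: "j \<in> ring_hom L (type_ring :: complex ring)" "\<And>q. j (\<psi> q) = \<chi> q"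
  proof (rule type_ring_hom_factor[OF \<psi> surj \<chi>])
    fix q assume "\<psi> q = \<zero>\<^bsub>L\<^esub>"
    thus "\<chi> q = \<zero>\<^bsub>type_ring\<^esub>" by (simp add: ker)
  qed (rule that)
  have "inj_on j (carrier L)"
  proof (rule inj_onI)
    fix l m assume "l \<in> carrier L" "m \<in> carrier L" "j l = j m"
    then obtain q r where qr: "l = \<psi> q" "m = \<psi> r" "\<chi> q = \<chi> r" unfolding surj[symmetric] using j(2) by auto
    have "\<chi> (q - r) = 0" using qr(3) b.hom_add[of "q - r" r] by simp
    hence "\<psi> (q - r) = \<zero>\<^bsub>L\<^esub>" by (simp only: ker)
    thus "l = m" unfolding qr by (simp only: a.hom_eq_iff)
  qed
  moreover have "domain (type_ring :: complex ring)" using type_ring_field field.axioms(1) by blast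
  ultimately show thesis using that[OF j] a.inj_hom_domain j(1) by blast
qed

lemma map_poly_monic:
  assumes "\<And>c. c \<noteq> 0 \<Longrightarrow> \<iota> c \<noteq> 0" "\<iota> 0 = 0" "\<iota> 1 = 1" "Polynomial.lead_coeff q = 1"
  shows "Polynomial.degree (map_poly \<iota> q) = Polynomial.degree q" "Polynomial.lead_coeff (map_poly \<iota> q) = 1"
proof -
  show "Polynomial.degree (map_poly \<iota> q) = Polynomial.degree q" by (rule Polynomial.degree_map_poly) (rule assms(1))
  thus "Polynomial.lead_coeff (map_poly \<iota> q) = 1" using assms by (simp add: coeff_map_poly)
qed

section \<open>The tower of number fields\<close>

locale eis_tower = eis_data p h U e x y for p h U e x y +
  assumes p_prime: "Factorial_Ring.prime p"
begin

definition hQ :: "rat poly" where "hQ = of_int_poly h"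
definition gQ :: "rat poly poly" where "gQ = map_poly of_int_poly (eis_poly p e U)"

lemma hQ: "Polynomial.lead_coeff hQ = 1" "Polynomial.degree hQ = Polynomial.degree h" "Polynomial.degree hQ > 0"
  unfolding hQ_def using map_poly_monic[of "of_int :: int \<Rightarrow> rat" h] h h_degree by simp_all

lemma gQ: "Polynomial.lead_coeff gQ = 1" "Polynomial.degree gQ = e" "Polynomial.degree gQ > 0"
proof -
  have inj: "of_int_poly c \<noteq> (0 :: rat poly)" if "c \<noteq> 0" for c :: "int poly" using that by simp
  note g = eis_poly_monic[OF U(1), of p]
  show "Polynomial.lead_coeff gQ = 1"
    unfolding gQ_def by (rule map_poly_monic(2)[OF inj _ _ g(2)]) simp_all
  show *: "Polynomial.degree gQ = e"
    unfolding gQ_def using map_poly_monic(1)[OF inj _ _ g(2)] g(1) by simp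
  show "Polynomial.degree gQ > 0" unfolding * by (rule e)
qed

sublocale Q: monic_quotient "type_ring :: rat ring" "\<lambda>c. c" hQ
proof -
  interpret field "type_ring :: rat ring" by (rule type_ring_field)
  interpret domain_type_hom "type_ring :: rat ring" "\<lambda>c. c" by (rule type_ring_id_hom)
  show "monic_quotient (type_ring :: rat ring) (\<lambda>c. c) hQ"
    by unfold_locales (use hQ in simp_all)
qed

abbreviation "K \<equiv> Q.L"
abbreviation "\<chi>K \<equiv> \<lambda>q. poly (map_poly of_rat q) x"

lemma \<chi>K_hom: "type_ring_hom (type_ring :: complex ring) \<chi>K"
proof (intro type_ring_hom.intro type_ring_hom_axioms.intro type_ring_cring)
  interpret of_rat: comm_ring_hom "of_rat :: rat \<Rightarrow> complex" by unfold_locales (simp_all add: of_rat_add of_rat_mult)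
  interpret map_poly_comm_ring_hom "of_rat :: rat \<Rightarrow> complex" ..
  fix q r :: "rat poly"
  show "\<chi>K (q + r) = \<chi>K q \<oplus>\<^bsub>type_ring\<^esub> \<chi>K r" "\<chi>K (q * r) = \<chi>K q \<otimes>\<^bsub>type_ring\<^esub> \<chi>K r" "\<chi>K 1 = \<one>\<^bsub>type_ring\<^esub>"
    by (simp_all add: hom_distribs)
qed simp

lemma \<chi>K_evq: "\<chi>K q = evq [:q:]" by (simp only: evq_const)

lemma \<chi>K_mult: "\<chi>K (q * r) = \<chi>K q * \<chi>K r"
  using type_ring_hom.hom_mult[OF \<chi>K_hom] by simp

lemma \<chi>K_add: "\<chi>K (q + r) = \<chi>K q + \<chi>K r"
  using type_ring_hom.hom_add[OF \<chi>K_hom] by simp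

lemma \<chi>K_hQ: "\<chi>K hQ = 0"
proof -
  have "evq (map_poly of_int_poly [:h:]) = 0" using x by (simp only: ev_int_poly_poly ev_const)
  moreover have "map_poly of_int_poly [:h:] = [:hQ:]" unfolding hQ_def by (cases "h = 0") (simp_all add: Polynomial.map_poly_pCons)
  ultimately show ?thesis by (simp only: \<chi>K_evq)
qed

lemma K_ker_dvd: "Q.\<psi> q = \<zero>\<^bsub>K\<^esub> \<longleftrightarrow> hQ dvd q"
  unfolding Q.\<psi>_eq_0_iff by (auto simp: dvd_def poly_eq_iff)

text \<open>The remainder modulo \<open>hQ\<close> is a combination of the powers \<open>x^i\<close>
  with \<open>i\<close> below the degree of \<open>h\<close>, and these are independent over the
  rationals.\<close>

lemma K_ker: "Q.\<psi> q = \<zero>\<^bsub>K\<^esub> \<longleftrightarrow> \<chi>K q = 0"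
proof
  assume "Q.\<psi> q = \<zero>\<^bsub>K\<^esub>"
  then obtain r where "q = hQ * r" unfolding K_ker_dvd by (elim dvdE)
  thus "\<chi>K q = 0" by (simp only: \<chi>K_mult \<chi>K_hQ mult_zero_left)
next
  assume 0: "\<chi>K q = 0"
  obtain A r where r: "q = hQ * A + r" "Polynomial.degree r < Polynomial.degree hQ"
    using monic_division[OF hQ(1,3)] by blast
  have "\<chi>K r = 0" using 0 unfolding r(1) by (simp only: \<chi>K_add \<chi>K_mult \<chi>K_hQ mult_zero_left add_0)
  moreover have "reduced (Polynomial.degree h) e [:r:]"
    using e r(2) h_degree unfolding reduced_def hQ(2) by (auto simp: coeff_pCons split: nat.splits)
  ultimately have "[:r:] = 0" using reduced_root_rat \<chi>K_evq by metis
  thus "Q.\<psi> q = \<zero>\<^bsub>K\<^esub>" unfolding K_ker_dvd using r(1) by simp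
qed

lemma K_embed: "\<exists>j. j \<in> ring_hom K (type_ring :: complex ring) \<and> (\<forall>q. j (Q.\<psi> q) = \<chi>K q)"
  and K_field: "field K"
proof -
  obtain j where j: "j \<in> ring_hom K (type_ring :: complex ring)" "\<And>q. j (Q.\<psi> q) = \<chi>K q" "domain K"
    by (rule type_ring_hom_embed[OF Q.\<psi>_hom Q.\<psi>_surj \<chi>K_hom K_ker]) (rule that)
  show "\<exists>j. j \<in> ring_hom K (type_ring :: complex ring) \<and> (\<forall>q. j (Q.\<psi> q) = \<chi>K q)" using j by blast
  show "field K" by (rule Q.L_field[OF j(3)])
qed

definition jK where "jK = (SOME j. j \<in> ring_hom K (type_ring :: complex ring) \<and> (\<forall>q. j (Q.\<psi> q) = \<chi>K q))"

lemma jK: "jK \<in> ring_hom K (type_ring :: complex ring)" "jK (Q.\<psi> q) = \<chi>K q"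
  using someI_ex[OF K_embed] unfolding jK_def by blast+

text \<open>The lower field as a degenerate instance with \<open>U = 1\<close>, \<open>e = 1\<close>
  and \<open>y = p\<close>: the order is Z[x], and its maximal ideal is generated by
  \<open>p\<close>.\<close>

lemma EK: "eis_data p h 1 1 x pc"
  using p h ph1 ph2 x by unfold_locales (auto simp: eval2_def)

interpretation EK: eis_data p h 1 1 x pc by (rule EK)

text \<open>With the rational number \<open>p\<close> in place of \<open>y\<close>, values of
  polynomials in two variables are already values of polynomials in \<open>X\<close> alone.\<close>

lemma jK_range: "jK ` carrier K = range (eval2 of_rat x pc)"
proof
  show "jK ` carrier K \<subseteq> range (eval2 of_rat x pc)"
    unfolding Q.\<psi>_surj[symmetric] by (auto simp: jK(2) simp flip: EK.evq_const)
  have "\<exists>q. EK.evq F = \<chi>K q" for F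
  proof (induction F)
    case 0
    show ?case using EK.evq_const[of 0] by (intro exI[of _ 0]) simp
  next
    case (pCons c F)
    then obtain q where "EK.evq F = \<chi>K q" by blast
    hence "EK.evq (pCons c F) = \<chi>K (c + [:of_nat p:] * q)"
      by (simp only: EK.evq_pCons \<chi>K_add \<chi>K_mult) (simp add: Polynomial.map_poly_pCons)
    thus ?case by blast
  qed
  thus "range (eval2 of_rat x pc) \<subseteq> jK ` carrier K"
    unfolding Q.\<psi>_surj[symmetric] by (force simp: jK(2) image_image)
qed

sublocale NK: eis_model p h 1 1 x pc K jK "Q.\<psi> [:of_nat p:]"
proof -
  interpret type_ring_hom K Q.\<psi> by (rule Q.\<psi>_hom)
  interpret field K by (rule K_field)
  show "eis_model p h 1 1 x pc K jK (Q.\<psi> [:of_nat p:])"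
    by (intro eis_model.intro eis_model_axioms.intro EK K_field p_prime jK jK_range hom_closed)
      (simp add: jK(2) Polynomial.map_poly_pCons)
qed

sublocale T: monic_quotient K Q.\<psi> gQ
proof -
  interpret type_ring_hom K Q.\<psi> by (rule Q.\<psi>_hom)
  interpret field K by (rule K_field)
  show "monic_quotient K Q.\<psi> gQ"
    by unfold_locales (use gQ Q.\<psi>_surj in simp_all)
qed

abbreviation "L \<equiv> T.L"

lemma evq_hom: "type_ring_hom (type_ring :: complex ring) evq"
  by (intro type_ring_hom.intro type_ring_hom_axioms.intro type_ring_cring)
    (simp_all only: evq.hom_add evq.hom_mult evq.hom_one monoid.simps ring_record_simps partial_object.simps UNIV_I)

lemma evq_gQ: "evq gQ = 0"
  unfolding gQ_def ev_int_poly_poly by (rule ev_eis_poly)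

lemma evq_coeffs: "(\<And>i. \<chi>K (poly.coeff F i) = 0) \<Longrightarrow> evq F = 0"
proof (induction F)
  case (pCons c F)
  have "\<chi>K c = 0" using pCons.prems[of 0] by simp
  moreover have "\<chi>K (poly.coeff F i) = 0" for i using pCons.prems[of "Suc i"] by simp
  ultimately show ?case using pCons.IH by (simp add: evq_pCons)
qed (simp add: eval2_0)

lemma L_ker: "T.\<psi> F = \<zero>\<^bsub>L\<^esub> \<longleftrightarrow> evq F = 0"
proof
  assume "T.\<psi> F = \<zero>\<^bsub>L\<^esub>"
  then obtain A where "\<forall>i. Q.\<psi> (poly.coeff (F - gQ * A) i) = \<zero>\<^bsub>K\<^esub>" unfolding T.\<psi>_eq_0_iff by blast
  hence "evq (F - gQ * A) = 0" by (intro evq_coeffs) (simp only: K_ker)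
  thus "evq F = 0" by (simp only: evq.hom_minus evq.hom_mult evq_gQ mult_zero_left diff_zero)
next
  assume 0: "evq F = 0"
  obtain A C r where r: "F = gQ * A + [:hQ:] * C + r" "reduced (Polynomial.degree h) e r"
    using reduced_division[OF gQ(1,2) e hQ(1,2) h_degree] by blast
  have "evq r = 0"
    using 0 unfolding r(1)
    by (simp only: evq.hom_add evq.hom_mult evq_gQ \<chi>K_evq[symmetric] \<chi>K_hQ mult_zero_left add_0)
  hence "r = 0" using reduced_root_rat r(2) by blast
  hence "F - gQ * A = [:hQ:] * C" using r(1) by simp
  hence "\<forall>i. Q.\<psi> (poly.coeff (F - gQ * A) i) = \<zero>\<^bsub>K\<^esub>" unfolding K_ker_dvd by simp
  thus "T.\<psi> F = \<zero>\<^bsub>L\<^esub>" unfolding T.\<psi>_eq_0_iff by blast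
qed

lemma L_embed: "\<exists>j. j \<in> ring_hom L (type_ring :: complex ring) \<and> (\<forall>F. j (T.\<psi> F) = evq F)"
  and L_field: "field L"
proof -
  obtain j where j: "j \<in> ring_hom L (type_ring :: complex ring)" "\<And>F. j (T.\<psi> F) = evq F" "domain L"
    by (rule type_ring_hom_embed[OF T.\<psi>_hom T.\<psi>_surj evq_hom L_ker]) (rule that)
  show "\<exists>j. j \<in> ring_hom L (type_ring :: complex ring) \<and> (\<forall>F. j (T.\<psi> F) = evq F)" using j by blast
  show "field L" by (rule T.L_field[OF j(3)])
qed

definition jL where "jL = (SOME j. j \<in> ring_hom L (type_ring :: complex ring) \<and> (\<forall>F. j (T.\<psi> F) = evq F))"

lemma jL: "jL \<in> ring_hom L (type_ring :: complex ring)" "jL (T.\<psi> F) = evq F"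
  using someI_ex[OF L_embed] unfolding jL_def by blast+

lemma jL_range: "jL ` carrier L = range evq"
  unfolding T.\<psi>_surj[symmetric] by (simp only: image_image jL(2))

sublocale NL: eis_model p h U e x y L jL "T.\<psi> [:0, 1:]"
proof -
  interpret type_ring_hom L T.\<psi> by (rule T.\<psi>_hom)
  interpret field L by (rule L_field)
  show "eis_model p h U e x y L jL (T.\<psi> [:0, 1:])"
    by (intro eis_model.intro eis_model_axioms.intro eis_data_axioms L_field p_prime jL jL_range hom_closed)
      (simp only: jL(2) evq_pCons eval2_0, simp)
qed

end

lemma type_ring_hom_restrict:
  assumes "type_ring_hom A \<phi>" "cring (A\<lparr>carrier := S\<rparr>)" "\<And>q. \<phi> q \<in> S"
  shows "type_ring_hom (A\<lparr>carrier := S\<rparr>) \<phi>"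
proof -
  interpret type_ring_hom A \<phi> by fact
  show ?thesis
    by (intro type_ring_hom.intro type_ring_hom_axioms.intro assms(2))
      (simp_all add: assms(3) hom_add hom_mult hom_one)
qed

section \<open>Eisenstein property, degrees and ramification in the tower, and the order inside
  L\<close>

context eis_tower
begin

abbreviation "g \<equiv> T.\<Theta> gQ"
abbreviation "\<zeta> \<equiv> \<lambda>q. Q.\<psi> (of_int_poly q)"

lemma hQ_list: "Q.\<Theta> hQ = map rat_of_int (rev (coeffs h))"
  unfolding type_ring_list_poly hQ_def by (subst coeffs_map_poly) (auto simp: rev_map)

lemma g_list: "g = rev (map \<zeta> (coeffs (eis_poly p e U)))"
proof -
  have "coeffs gQ = map of_int_poly (coeffs (eis_poly p e U))"
    unfolding gQ_def by (subst coeffs_map_poly) auto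
  thus ?thesis using T.list_poly_monic(1)[OF gQ(1)] NK.M.one_not_zero by simp
qed

lemma jK_\<zeta>: "jK (\<zeta> q) = ev [:q:]"
proof -
  have "map_poly of_int_poly [:q:] = [:of_int_poly q :: rat poly:]"
    by (cases "q = 0") (simp_all add: Polynomial.map_poly_pCons)
  hence "evq [:of_int_poly q:] = ev [:q:]" using ev_int_poly_poly[of "[:q:]"] by simp
  thus ?thesis by (simp only: jK(2) \<chi>K_evq)
qed

lemma \<zeta>_hom: "type_ring_hom (\<O> K) \<zeta>"
proof -
  have "algebraic_int (jK (\<zeta> q))" for q unfolding jK_\<zeta> by (rule B_algebraic_int[OF B_ev])
  thus ?thesis
    by (intro type_ring_hom.intro type_ring_hom_axioms.intro NK.V.OR_cring)
      (simp_all only: NK.integral_iff T.hom_closed NK.V.OR_simps of_int_poly_hom.hom_add of_int_poly_hom.hom_mult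
        of_int_poly_hom.hom_one T.hom_add T.hom_mult T.hom_one)
qed

text \<open>Let \<open>U_0\<close> be the constant coefficient of \<open>U\<close>. If
  \<open>p U_0(x) = r p^2\<close> with \<open>r\<close> integral, then \<open>U_0(x) = p r\<close>
  with \<open>r\<close> in the localization belonging to \<open>K\<close>. There \<open>p\<close> is
  the uniformizer, whereas \<open>U_0(x)\<close> is a unit.\<close>

lemma eisenstein_g: "eisenstein (\<O> K) p g"
proof -
  have nt: "\<one>\<^bsub>\<O> K\<^esub> \<noteq> \<zero>\<^bsub>\<O> K\<^esub>" unfolding NK.V.OR_simps by (rule NK.M.one_not_zero)
  interpret \<zeta>: type_ring_hom "\<O> K" \<zeta> by (rule \<zeta>_hom)
  have "g = list_poly (\<O> K) \<zeta> (eis_poly p e U)"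
    using \<zeta>.list_poly_monic(1)[OF eis_poly_monic(2)[OF U(1)] nt] g_list by simp
  moreover have "\<zeta> ([:int p:] * poly.coeff U 0) \<notin> PIdl\<^bsub>\<O> K\<^esub> (int_img (\<O> K) (int p) [^]\<^bsub>\<O> K\<^esub> (2::nat))"
  proof
    assume "\<zeta> ([:int p:] * poly.coeff U 0) \<in> PIdl\<^bsub>\<O> K\<^esub> (int_img (\<O> K) (int p) [^]\<^bsub>\<O> K\<^esub> (2::nat))"
    then obtain r where r: "r \<in> carrier (\<O> K)"
      "\<zeta> ([:int p:] * poly.coeff U 0) = r \<otimes>\<^bsub>K\<^esub> (int_img K (int p) [^]\<^bsub>K\<^esub> (2::nat))"
      unfolding NK.V.OR.PIdl_iff NK.V.OR_int_img NK.V.OR_pow NK.V.OR_simps by blast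
    have rK: "r \<in> carrier K" "algebraic_int (jK r)" using r(1) NK.integral_iff by blast+
    have mult_p: "ev [:[:int p:] * poly.coeff U 0:] = pc * ev [:poly.coeff U 0:]"
    proof -
      have "[:[:int p:] * poly.coeff U 0:] = [:[:int p:]:] * [:poly.coeff U 0:]" by simp
      thus ?thesis by (simp only: ev.hom_mult ev_of_int of_int_of_nat_eq)
    qed
    have "ev [:[:int p:] * poly.coeff U 0:] = jK r * pc ^ 2"
      unfolding jK_\<zeta>[symmetric] r(2)
      by (simp only: NK.j_mult[OF rK(1) NK.M.nat_pow_closed[OF NK.int_img_closed]] NK.j_power[OF NK.int_img_closed]
          NK.j_int of_int_of_nat_eq)
    hence "pc * ev [:poly.coeff U 0:] = jK r * pc ^ 2"
      unfolding mult_p .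
    hence "pc * (ev [:poly.coeff U 0:] - pc * jK r) = 0" by (simp add: power2_eq_square algebra_simps)
    hence "ev [:poly.coeff U 0:] = pc * jK r" using p by simp
    moreover have "jK r \<in> NK.D" using NK.algebraic_int_D rK NK.j_range by blast
    moreover have "ev [:poly.coeff U 0:] \<in> NK.S" using NK.coprime_S[OF U(2)] by (simp only: ev_const)
    ultimately show False using NK.S_iff by blast
  qed
  ultimately show ?thesis using NK.V.OR.eisenstein_list_poly[OF \<zeta>_hom nt U(1)] by simp
qed

lemma g_degree: "Polynomials.degree g = e"
  using T.list_poly_monic(3)[OF gQ(1) NK.M.one_not_zero] gQ(2) by simp

lemma K_dimension:
  "ring.dimension K (Polynomial.degree h) (const_class type_ring (Q.\<Theta> hQ) ` carrier type_ring) (carrier K)"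
  using Q.L_dimension unfolding hQ(2) .

lemma L_dimension: "ring.dimension L e (const_class K g ` carrier K) (carrier L)"
  using T.L_dimension unfolding gQ(2) .

lemma const_class_jL: "c \<in> carrier K \<Longrightarrow> jL (const_class K g c) = jK c"
proof -
  assume "c \<in> carrier K"
  then obtain q where q: "c = Q.\<psi> q" unfolding Q.\<psi>_surj[symmetric] by blast
  show ?thesis unfolding q T.const_class_eq by (simp only: jL(2) jK(2) \<chi>K_evq)
qed

lemma totally_ramified:
  "totally_ramified K L (const_class K g) (PIdl\<^bsub>\<O> K\<^esub> (int_img (\<O> K) (int p)))"
proof (rule NL.V.total_ramification[OF NK.M.cring_axioms NK.V.OR_cring NK.V.O_subring T.const_class_hom])
  show "const_class K g ` carrier (\<O> K) \<subseteq> carrier (\<O> L)"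
  proof
    fix l assume "l \<in> const_class K g ` carrier (\<O> K)"
    then obtain c where c: "c \<in> carrier (\<O> K)" "l = const_class K g c" by blast
    hence cK: "c \<in> carrier K" "algebraic_int (jK c)" using NK.integral_iff by blast+
    thus "l \<in> carrier (\<O> L)"
      unfolding c(2) NL.integral_iff using ring_hom_closed[OF T.const_class_hom cK(1)] const_class_jL[OF cK(1)] by simp
  qed
  have "subfield (const_class K g ` carrier K) L"
    using ring_hom_ring.img_is_subfield(2)[OF ring_hom_ringI2[OF NK.M.ring_axioms NL.M.ring_axioms T.const_class_hom]
        NK.M.carrier_is_subfield NL.M.one_not_zero] .
  thus "ring.dim L (const_class K g ` carrier K) (carrier L) = e"
    using NL.M.dimI[OF _ L_dimension] unfolding over_def by blast
qed

lemma inert_K: "inert (\<O> K) p" by (rule NK.V.inert_if_unramified(2)[OF refl])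

abbreviation "\<psi>B \<equiv> \<lambda>G. T.\<psi> (map_poly of_int_poly G)"

lemma jL_\<psi>B: "jL (\<psi>B G) = ev G" by (simp only: jL(2) ev_int_poly_poly)

lemma \<psi>B_range: "\<psi>B ` UNIV = NL.BM"
proof
  interpret \<psi>: type_ring_hom L T.\<psi> by (rule T.\<psi>_hom)
  show "\<psi>B ` UNIV \<subseteq> NL.BM" using B_ev \<psi>.hom_closed by (auto simp only: jL_\<psi>B mem_Collect_eq image_iff)
  show "NL.BM \<subseteq> \<psi>B ` UNIV"
  proof
    fix l assume l: "l \<in> NL.BM"
    then obtain G where "jL l = ev G" unfolding B_def by blast
    hence "jL l = jL (\<psi>B G)" by (simp only: jL_\<psi>B)
    hence "l = \<psi>B G" using l \<psi>.hom_closed by (simp only: NL.j_eq_iff mem_Collect_eq)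
    thus "l \<in> \<psi>B ` UNIV" by blast
  qed
qed

lemma \<psi>B_hom_L: "type_ring_hom L \<psi>B"
proof -
  interpret of_int_poly: map_poly_inj_comm_ring_hom "of_int_poly :: int poly \<Rightarrow> rat poly" ..
  show ?thesis
    by (rule type_ring_hom_comp_type[OF T.\<psi>_hom]) (simp_all only: of_int_poly.hom_add of_int_poly.hom_mult of_int_poly.hom_one)
qed

lemma \<psi>B_hom: "type_ring_hom (L\<lparr>carrier := NL.BM\<rparr>) \<psi>B"
  by (rule type_ring_hom_restrict[OF \<psi>B_hom_L NL.M.subring_cring[OF NL.V.B_subring]]) (use \<psi>B_range in blast)

lemma \<psi>B_int: "\<psi>B [:[:n:]:] = int_img L n"
  by (rule int_hom_eq_int_img[OF type_ring_hom_comp_type[OF \<psi>B_hom_L]]) (simp_all add: one_pCons)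

text \<open>A normal form that vanishes at \<open>(x, y)\<close> is zero, so
  \<open>eis_poly p e U\<close> and \<open>h\<close> generate all relations in the order.\<close>

lemma \<psi>B_kernel:
  assumes "\<psi>B G = \<zero>\<^bsub>L\<^esub>"
  obtains A C where "G = eis_poly p e U * A + [:h:] * C"
proof -
  have 0: "ev G = 0" using assms NL.j_zero jL_\<psi>B by metis
  obtain A C r where r: "G = eis_poly p e U * A + [:h:] * C + r" "reduced (Polynomial.degree h) e r"
    using reduced_division[OF eis_poly_monic(2,1)[OF U(1)] e h refl h_degree] by blast
  have "ev [:h:] = 0" using x by (simp only: ev_const)
  hence "ev r = 0"
    using 0 unfolding r(1) by (simp only: ev.hom_add ev.hom_mult ev_eis_poly mult_zero_left add_0)
  hence "r = 0" using reduced_root_int r(2) by blast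
  thus thesis using that r(1) by simp
qed

lemma Y_class: "poly_class K g X\<^bsub>K\<^esub> = T.\<psi> [:0, 1:]" by (rule T.X_class_eq)

lemma \<psi>B_X: "\<psi>B [:0, 1:] = T.\<psi> [:0, 1:]" by (simp add: Polynomial.map_poly_pCons)

end

section \<open>The map from the localization onto R\<close>

lemma residue_degree_iso:
  assumes k: "field k" "Factorial_Ring.prime p" "has_char k p" "ring.dimension k n (prime_subring k) (carrier k)"
    and A: "cring A" "\<gamma> \<in> ring_iso k A"
  shows "ring.dimension A n (prime_subring A) (carrier A)"
proof -
  interpret k: field k by fact
  interpret A: cring A by fact
  have hom: "\<gamma> \<in> ring_hom k A" and bij: "bij_betw \<gamma> (carrier k) (carrier A)"
    using A(2) unfolding ring_iso_def by auto
  interpret h: ring_hom_ring k A \<gamma> by (rule ring_hom_ringI2[OF k.ring_axioms A.ring_axioms hom])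
  have "\<gamma> \<one>\<^bsub>k\<^esub> \<noteq> \<gamma> \<zero>\<^bsub>k\<^esub>"
    using bij_betw_imp_inj_on[OF bij] inj_on_eq_iff[of \<gamma> "carrier k" "\<one>\<^bsub>k\<^esub>" "\<zero>\<^bsub>k\<^esub>"] by simp
  hence nt: "\<one>\<^bsub>A\<^esub> \<noteq> \<zero>\<^bsub>A\<^esub>" by simp
  have "\<gamma> (int_img k n) = int_img A n" for n
    by (rule int_hom_eq_int_img[OF type_ring_hom_compose[OF k.int_img_hom A.cring_axioms hom]])
  hence prime: "\<gamma> ` prime_subring k = prime_subring A" unfolding prime_subring_def by (simp add: image_image)
  have "ring.dimension A n (\<gamma> ` prime_subring k) (\<gamma> ` carrier k)"
    by (rule h.inj_hom_dimension[OF k.prime_subring_subfield(1)[OF k(2,3)] nt bij_betw_imp_inj_on[OF bij] k(4)])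
  thus ?thesis unfolding prime bij_betw_imp_surj_on[OF bij] .
qed

lemma (in local_PIR) f_pos: "f > 0"
proof -
  obtain h where "Polynomial.lead_coeff h = 1" "Polynomial.degree h = f" "ph_maximal p h" by (rule exists_h)
  thus ?thesis using ph_maximal_degree by blast
qed

text \<open>Ties the two sides together: the same \<open>h\<close> and \<open>U\<close> define the
  number fields and the relations satisfied by \<open>b\<close> and \<open>\<pi>\<close> in
  \<open>R\<close>.\<close>

locale local_PIR_tower = local_PIR_root R \<pi> a e f p h b + N: eis_tower p h U e x y
  for R :: "('r, 'm) ring_scheme" (structure) and \<pi> a e f p h b U x y +
  assumes U_root: "ev2 (eis_poly p e U) = \<zero>"
begin

abbreviation "BR \<equiv> N.L\<lparr>carrier := N.NL.BM\<rparr>"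

text \<open>Both generators of the relations in the order vanish at \<open>(b, \<pi>)\<close>, so
  evaluation in \<open>R\<close> factors through the order.\<close>

lemma hom_B: obtains \<phi> where "\<phi> \<in> ring_hom BR R" "\<And>G. \<phi> (N.\<psi>B G) = ev2 G"
proof (rule type_ring_hom_factor[OF N.\<psi>B_hom _ ev2.type_ring_hom_axioms])
  show "range N.\<psi>B = carrier BR" using N.\<psi>B_range by simp
  fix G assume "N.\<psi>B G = \<zero>\<^bsub>BR\<^esub>"
  hence "N.\<psi>B G = \<zero>\<^bsub>N.L\<^esub>" by simp
  then obtain A C where "G = eis_poly p e U * A + [:h:] * C" by (rule N.\<psi>B_kernel)
  thus "ev2 G = \<zero>"
    by (simp only: ev2.hom_add ev2.hom_mult U_root pe.peval_const b(2) l_null ev2.hom_closed r_zero zero_closed)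
qed (rule that)

text \<open>The identity \<open>s t = 1 + p z\<close> in the order is mapped to \<open>R\<close>,
  where \<open>p\<close> lies in the maximal ideal.\<close>

lemma ev2_unit:
  assumes s: "N.\<psi>B G \<notin> (\<otimes>\<^bsub>N.L\<^esub>) (N.T.\<psi> [:0, 1:]) ` N.NL.DM"
  shows "ev2 G \<in> Units R"
proof -
  interpret \<psi>B: type_ring_hom N.L N.\<psi>B by (rule N.\<psi>B_hom_L)
  obtain \<phi> where \<phi>: "\<And>G. \<phi> (N.\<psi>B G) = ev2 G" by (rule hom_B) (rule that)
  have "N.\<psi>B G \<in> N.NL.BM" using N.\<psi>B_range by blast
  from N.NL.V.inverse_mod_p[OF N.NL.V.B_D[OF this] s]
  obtain t z where "t \<in> N.NL.BM" "z \<in> N.NL.BM"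
    "N.\<psi>B G \<otimes>\<^bsub>N.L\<^esub> t = \<one>\<^bsub>N.L\<^esub> \<oplus>\<^bsub>N.L\<^esub> int_img N.L (int p) \<otimes>\<^bsub>N.L\<^esub> z" by blast
  then obtain T Z where "N.\<psi>B G \<otimes>\<^bsub>N.L\<^esub> N.\<psi>B T
      = \<one>\<^bsub>N.L\<^esub> \<oplus>\<^bsub>N.L\<^esub> int_img N.L (int p) \<otimes>\<^bsub>N.L\<^esub> N.\<psi>B Z"
    unfolding N.\<psi>B_range[symmetric] by blast
  hence "N.\<psi>B (G * T) = N.\<psi>B (1 + [:[:int p:]:] * Z)"
    by (simp only: \<psi>B.hom_add \<psi>B.hom_mult \<psi>B.hom_one N.\<psi>B_int)
  hence "ev2 (G * T) = ev2 (1 + [:[:int p:]:] * Z)" by (metis \<phi>)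
  hence eq: "ev2 G \<otimes> ev2 T = \<one> \<oplus> pR \<otimes> ev2 Z"
    by (simp only: ev2.hom_add ev2.hom_mult ev2.hom_one pe.peval_const b.peval_const)
  have "ev2 G \<notin> P"
  proof
    assume "ev2 G \<in> P"
    hence "\<one> \<oplus> pR \<otimes> ev2 Z \<in> P" unfolding eq[symmetric] by (rule P.I_r_closed[OF _ ev2.hom_closed])
    moreover have "pR \<otimes> ev2 Z \<in> P" by (rule P.I_r_closed[OF pR_P ev2.hom_closed])
    ultimately have "(\<one> \<oplus> pR \<otimes> ev2 Z) \<ominus> pR \<otimes> ev2 Z \<in> P" by (rule P_diff)
    moreover have "(\<one> \<oplus> pR \<otimes> ev2 Z) \<ominus> pR \<otimes> ev2 Z = \<one>" by (simp add: a_minus_def a_assoc r_neg)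
    ultimately show False using one_notin_P by simp
  qed
  thus ?thesis using unit_iff ev2.hom_closed by blast
qed

lemma hom_D: obtains \<Phi> where "\<Phi> \<in> ring_hom N.NL.V.DR R" "\<And>G. \<Phi> (N.\<psi>B G) = ev2 G"
proof -
  obtain \<phi> where \<phi>: "\<phi> \<in> ring_hom BR R" "\<And>G. \<phi> (N.\<psi>B G) = ev2 G" by (rule hom_B) (rule that)
  obtain \<Phi> where \<Phi>: "\<Phi> \<in> ring_hom N.NL.V.DR R" "\<And>b. b \<in> N.NL.BM \<Longrightarrow> \<Phi> b = \<phi> b"
  proof (rule N.NL.V.extend_hom[OF cring_axioms \<phi>(1)])
    fix s assume s: "s \<in> N.NL.BM" "s \<notin> (\<otimes>\<^bsub>N.L\<^esub>) (N.T.\<psi> [:0, 1:]) ` N.NL.DM"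
    then obtain G where "s = N.\<psi>B G" unfolding N.\<psi>B_range[symmetric] by blast
    thus "\<phi> s \<in> Units R" using ev2_unit s(2) by (simp only: \<phi>(2))
  qed (rule that)
  show thesis
  proof (rule that[OF \<Phi>(1)])
    fix G
    have "N.\<psi>B G \<in> N.NL.BM" using N.\<psi>B_range by blast
    thus "\<Phi> (N.\<psi>B G) = ev2 G" by (simp only: \<Phi>(2) \<phi>(2))
  qed
qed

lemma quotient_iso:
  defines "D \<equiv> N.NL.V.DR"
  shows "\<exists>\<phi>\<in>ring_hom D R. \<phi> ` carrier D = carrier R"
    and "R \<simeq> D Quot PIdl\<^bsub>D\<^esub> (N.T.\<psi> [:0, 1:] [^]\<^bsub>D\<^esub> a)"
    and "has_residue_degree (\<O> N.L) N.NL.V.PL f"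
proof -
  let ?y = "N.T.\<psi> [:0, 1:]"
  obtain \<Phi> where \<Phi>: "\<Phi> \<in> ring_hom N.NL.V.DR R" "\<And>G. \<Phi> (N.\<psi>B G) = ev2 G" by (rule hom_D) (rule that)
  have \<Phi>y: "\<Phi> ?y = \<pi>" using \<Phi>(2)[of "[:0, 1:]"] by (simp only: N.\<psi>B_X pe.peval_X)
  have B_D: "N.\<psi>B G \<in> N.NL.DM" for G using N.\<psi>B_range N.NL.V.B_D by blast
  have surj: "\<Phi> ` carrier N.NL.V.DR = carrier R"
  proof
    show "carrier R \<subseteq> \<Phi> ` carrier N.NL.V.DR"
    proof
      fix r assume "r \<in> carrier R"
      then obtain G where "r = ev2 G" by (rule ev2_surj)
      hence "r = \<Phi> (N.\<psi>B G)" by (simp only: \<Phi>(2))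
      moreover have "N.\<psi>B G \<in> carrier N.NL.V.DR" unfolding N.NL.V.DR_simps by (rule B_D)
      ultimately show "r \<in> \<Phi> ` carrier N.NL.V.DR" by blast
    qed
  qed (use ring_hom_closed[OF \<Phi>(1)] in blast)
  show "\<exists>\<phi>\<in>ring_hom D R. \<phi> ` carrier D = carrier R" unfolding D_def using \<Phi>(1) surj by blast
  interpret \<Phi>: ring_hom_ring N.NL.V.DR R \<Phi>
    by (rule ring_hom_ringI2[OF cring.axioms(1)[OF N.NL.V.DR_cring] ring_axioms \<Phi>(1)])
  have "a_kernel N.NL.V.DR R \<Phi> = PIdl\<^bsub>N.NL.V.DR\<^esub> (?y [^]\<^bsub>N.L\<^esub> a)"
    by (rule N.NL.V.hom_kernel[OF cring_axioms \<Phi>(1)]) (simp_all only: \<Phi>y \<pi>_pow_a \<pi>_pow_less not_False_eq_True)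
  hence ker: "a_kernel N.NL.V.DR R \<Phi> = PIdl\<^bsub>D\<^esub> (?y [^]\<^bsub>D\<^esub> a)" unfolding D_def N.NL.V.DR_pow .
  have "D Quot PIdl\<^bsub>D\<^esub> (?y [^]\<^bsub>D\<^esub> a) \<simeq> R" using \<Phi>.FactRing_iso[OF surj] unfolding ker unfolding D_def .
  moreover have "ring (D Quot PIdl\<^bsub>D\<^esub> (?y [^]\<^bsub>D\<^esub> a))"
    unfolding ker[symmetric] unfolding D_def by (rule ideal.quotient_is_ring[OF \<Phi>.kernel_is_ideal])
  ultimately show "R \<simeq> D Quot PIdl\<^bsub>D\<^esub> (?y [^]\<^bsub>D\<^esub> a)" using ring_iso_sym by blast

  \<comment> \<open>The residue field of \<open>\<O> L\<close> at the prime is compared with that of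
    \<open>R\<close>: the composite \<open>\<rho>\<close> is onto already on the order, and its
    kernel is \<open>PL\<close>, because units of \<open>D\<close> go to units of
    \<open>R\<close>.\<close>
  define \<rho> where "\<rho> = (\<lambda>l. \<kappa> (\<Phi> l))"
  note DR = N.NL.V.DR_simps and OR = N.NL.V.OR_simps
  have OD: "l \<in> carrier N.NL.V.DR" if "l \<in> carrier (\<O> N.L)" for l unfolding DR using that N.NL.V.O_D by blast
  have \<rho>: "\<rho> \<in> ring_hom (\<O> N.L) k"
  proof (rule ring_hom_memI)
    fix l m assume lm: "l \<in> carrier (\<O> N.L)" "m \<in> carrier (\<O> N.L)"
    note c = OD[OF lm(1)] OD[OF lm(2)] \<Phi>.hom_closed[OF OD[OF lm(1)]] \<Phi>.hom_closed[OF OD[OF lm(2)]]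
    show "\<rho> l \<in> carrier k" unfolding \<rho>_def by (rule ring_hom_closed[OF \<kappa>_hom c(3)])
    show "\<rho> (l \<otimes>\<^bsub>\<O> N.L\<^esub> m) = \<rho> l \<otimes>\<^bsub>k\<^esub> \<rho> m"
      using \<Phi>.hom_mult[OF c(1,2)] ring_hom_mult[OF \<kappa>_hom c(3,4)] unfolding \<rho>_def OR DR by simp
    show "\<rho> (l \<oplus>\<^bsub>\<O> N.L\<^esub> m) = \<rho> l \<oplus>\<^bsub>k\<^esub> \<rho> m"
      using \<Phi>.hom_add[OF c(1,2)] ring_hom_add[OF \<kappa>_hom c(3,4)] unfolding \<rho>_def OR DR by simp
  next
    show "\<rho> \<one>\<^bsub>\<O> N.L\<^esub> = \<one>\<^bsub>k\<^esub>"
      using \<Phi>.hom_one ring_hom_one[OF \<kappa>_hom] unfolding \<rho>_def OR DR by simp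
  qed
  have k: "cring k" using k_field by (simp add: field_def domain_def)
  interpret \<rho>: ring_hom_ring "\<O> N.L" k \<rho>
    by (rule ring_hom_ringI2[OF N.NL.V.OR.ring_axioms cring.axioms(1)[OF k] \<rho>])
  have \<rho>_surj: "\<rho> ` carrier (\<O> N.L) = carrier k"
  proof
    show "carrier k \<subseteq> \<rho> ` carrier (\<O> N.L)"
    proof
      fix c assume "c \<in> carrier k"
      then obtain r where r: "r \<in> carrier R" "c = \<kappa> r" unfolding k_carrier by blast
      obtain G where "r = ev2 G" by (rule ev2_surj[OF r(1)])
      hence "c = \<rho> (N.\<psi>B G)" unfolding \<rho>_def r(2) by (simp only: \<Phi>(2))
      moreover have "N.\<psi>B G \<in> carrier (\<O> N.L)" using N.\<psi>B_range N.NL.V.B_O by blast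
      ultimately show "c \<in> \<rho> ` carrier (\<O> N.L)" by blast
    qed
  qed (use ring_hom_closed[OF \<rho>] in blast)
  have \<Phi>P: "\<Phi> l \<in> P \<longleftrightarrow> l \<in> (\<otimes>\<^bsub>N.L\<^esub>) ?y ` N.NL.DM" if l: "l \<in> N.NL.DM" for l
  proof
    assume "l \<in> (\<otimes>\<^bsub>N.L\<^esub>) ?y ` N.NL.DM"
    then obtain d where d: "d \<in> N.NL.DM" "l = ?y \<otimes>\<^bsub>N.L\<^esub> d" by blast
    have "\<Phi> (?y \<otimes>\<^bsub>N.NL.V.DR\<^esub> d) = \<pi> \<otimes> \<Phi> d"
      using \<Phi>.hom_mult[of ?y d] d(1) N.NL.V.y_D unfolding \<Phi>y DR by blast
    moreover have "\<Phi> d \<in> carrier R" using \<Phi>.hom_closed[of d] d(1) unfolding DR by blast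
    ultimately show "\<Phi> l \<in> P" unfolding d(2) DR using P.I_r_closed[OF \<pi>_P] by simp
  next
    assume P: "\<Phi> l \<in> P"
    show "l \<in> (\<otimes>\<^bsub>N.L\<^esub>) ?y ` N.NL.DM"
    proof (rule ccontr)
      assume "l \<notin> (\<otimes>\<^bsub>N.L\<^esub>) ?y ` N.NL.DM"
      note u = N.NL.V.not_multiple_unit[OF l this]
      have lL: "l \<in> carrier N.L" using l by blast
      have "l \<otimes>\<^bsub>N.L\<^esub> inv\<^bsub>N.L\<^esub> l = \<one>\<^bsub>N.L\<^esub>"
        using u(1) lL N.NL.M.field_Units by (intro N.NL.M.Units_r_inv) blast
      hence "\<Phi> l \<otimes> \<Phi> (inv\<^bsub>N.L\<^esub> l) = \<one>"
        using \<Phi>.hom_mult[of l "inv\<^bsub>N.L\<^esub> l"] \<Phi>.hom_one l u(2) unfolding DR by metis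
      moreover have "\<Phi> (inv\<^bsub>N.L\<^esub> l) \<in> carrier R" using \<Phi>.hom_closed[of "inv\<^bsub>N.L\<^esub> l"] u(2) unfolding DR by blast
      ultimately show False using P.I_r_closed[OF P, of "\<Phi> (inv\<^bsub>N.L\<^esub> l)"] one_notin_P by simp
    qed
  qed
  have "a_kernel (\<O> N.L) k \<rho> = N.NL.V.PL"
  proof -
    have "\<rho> l = \<zero>\<^bsub>k\<^esub> \<longleftrightarrow> l \<in> (\<otimes>\<^bsub>N.L\<^esub>) ?y ` N.NL.DM" if "l \<in> carrier (\<O> N.L)" for l
      unfolding \<rho>_def \<kappa>_zero[OF \<Phi>.hom_closed[OF OD[OF that]]]
      by (rule \<Phi>P) (use OD[OF that] in \<open>simp only: DR\<close>)
    thus ?thesis unfolding a_kernel_def' N.NL.V.PL_def by blast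
  qed
  with \<rho>.FactRing_iso_set[OF \<rho>_surj]
  have iso: "(\<lambda>C. the_elem (\<rho> ` C)) \<in> ring_iso (\<O> N.L Quot N.NL.V.PL) k" by simp
  have A: "cring (\<O> N.L Quot N.NL.V.PL)"
    by (rule ideal.quotient_is_cring[OF N.NL.V.PL_ideal N.NL.V.OR.cring_axioms])
  show "has_residue_degree (\<O> N.L) N.NL.V.PL f"
    unfolding has_residue_degree_def
    by (rule residue_degree_iso[OF k_field p_prime k_char _ A ring_iso_set_sym[OF cring.axioms(1)[OF A] iso]])
      (use type in \<open>simp add: has_type_def has_residue_degree_def\<close>)
qed

end

text \<open>The fundamental theorem of algebra for \<open>h\<close> and for
  \<open>Y^e - p U(x, Y)\<close>; the bound on the degree of \<open>U\<close> keeps the latter from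
  being constant.\<close>

lemma exists_eis_root:
  assumes h: "Polynomial.degree (h :: int poly) > 0" and U: "Polynomial.degree U < e"
  obtains x y where "poly (of_int_poly h) (x :: complex) = 0" "y ^ e = of_nat p * eval2 of_int x y U"
proof -
  have root: "\<exists>z. poly q z = 0" if "Polynomial.degree q > 0" for q :: "complex poly"
    using fundamental_theorem_of_algebra[of q] that unfolding constant_degree by simp
  obtain x :: complex where x: "poly (of_int_poly h) x = 0" using root[of "of_int_poly h"] h by auto
  define V where "V = Polynomial.smult (of_nat p) (map_poly (\<lambda>q. poly (of_int_poly q) x) U)"
  have "Polynomial.degree V \<le> Polynomial.degree U"
    unfolding V_def using degree_smult_le degree_map_poly_le order_trans by blast
  hence "poly.coeff (Polynomial.monom 1 e - V) e = 1" using U by (simp add: coeff_eq_0)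
  hence "Polynomial.degree (Polynomial.monom 1 e - V) > 0" using U le_degree[of "Polynomial.monom 1 e - V" e] by simp
  then obtain y where "poly (Polynomial.monom 1 e - V) y = 0" using root by blast
  hence "y ^ e = of_nat p * eval2 of_int x y U" unfolding V_def eval2_def by (simp add: poly_monom)
  with x show thesis by (rule that)
qed

theorem theorem1:
  fixes R :: "('r, 'm) ring_scheme" and \<pi> :: 'r and a e f p :: nat
  assumes "finite_local_PIR R"
    and "has_type R a e f p"
    and "uniformizer R \<pi>"
  shows
    "(\<exists>h g PL.
        monic \<Z> h \<and> degree h = f \<and> irreducible_mod p h \<and>
        (let hQ = map rat_of_int h;
             K = Rupt\<^bsub>rat_ring\<^esub> (carrier rat_ring) hQ;
             L = Rupt\<^bsub>K\<^esub> (carrier K) g;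
             \<iota>K = const_class rat_ring hQ;
             \<iota>L = const_class K g;
             Y = poly_class K g X\<^bsub>K\<^esub>;
             D = localization_at L PL;
             PD = Idl\<^bsub>D\<^esub> (ideal_pow (\<O> L) PL a)
         in monic (\<O> K) g \<and> degree g = e \<and> eisenstein (\<O> K) p g \<and>
            field K \<and> field L \<and>
            ring.dimension K f (\<iota>K ` carrier rat_ring) (carrier K) \<and>
            inert (\<O> K) p \<and>
            ring.dimension L e (\<iota>L ` carrier K) (carrier L) \<and>
            totally_ramified K L \<iota>L (PIdl\<^bsub>\<O> K\<^esub> (int_img (\<O> K) (int p))) \<and>
            lies_over (\<O> L) PL p \<and> (\<forall>Q. lies_over (\<O> L) Q p \<longrightarrow> Q = PL) \<and>
            discrete_valuation_ring D \<and>
            (\<exists>\<phi> \<in> ring_hom D R. \<phi> ` carrier D = carrier R) \<and>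
            R \<simeq> D Quot PD \<and>
            Y \<in> carrier D \<and> PD = PIdl\<^bsub>D\<^esub> (Y [^]\<^bsub>D\<^esub> a) \<and>
            ramification_index (\<O> L) PL p = e \<and>
            has_residue_degree (\<O> L) PL f))
     \<and>
     (let a0 = nat \<lceil>real a / real e\<rceil> in
      \<forall>h. monic \<Z> h \<and> degree h = f \<and> irreducible_mod p h \<longrightarrow>
        (\<exists>g. eisenstein_lift p e h g \<and>
           ZXY Quot presentation_ideal p a0 a g h \<simeq> R) \<and>
        (\<forall>b \<in> carrier R. int_eval R h b = \<zero>\<^bsub>R\<^esub> \<longrightarrow>
           (\<exists>g. eisenstein_lift p e h g \<and>
              (let J = presentation_ideal p a0 a g h in
               \<exists>\<phi> \<in> ring_iso (ZXY Quot J) R.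
                 \<phi> (J +>\<^bsub>ZXY\<^esub> ZX_to_ZXY X\<^bsub>\<Z>\<^esub>) = b \<and>
                 \<phi> (J +>\<^bsub>ZXY\<^esub> X\<^bsub>ZX\<^esub>) = \<pi>))))"
proof -
  interpret cring R using assms(1) unfolding finite_local_PIR_def by blast
  interpret local_PIR R \<pi> a e f p by unfold_locales (fact assms)+
  show ?thesis
  proof (rule conjI, goal_cases)
    case 1
    obtain h where h: "Polynomial.lead_coeff h = 1" "Polynomial.degree h = f" "ph_maximal p h" by (rule exists_h)
    obtain b where b: "b \<in> carrier R" "peval R (int_img R) b h = \<zero>\<^bsub>R\<^esub>" using exists_root[OF h] by blast
    interpret root: local_PIR_root R \<pi> a e f p h b by unfold_locales (fact h b)+
    obtain U where U: "Polynomial.degree U < e" "poly.coeff U 0 \<notin> ph_ideal p h" "root.ev2 (eis_poly p e U) = \<zero>\<^bsub>R\<^esub>"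
      by (rule root.exists_U)
    obtain x y where xy: "poly (of_int_poly h) (x :: complex) = 0" "y ^ e = of_nat p * eval2 of_int x y U"
      using exists_eis_root[OF _ U(1)] f_pos h(2) by blast
    interpret tower: local_PIR_tower R \<pi> a e f p h b U x y
    proof unfold_locales
      show "1 < p" by (rule prime_gt_1_nat[OF p_prime])
      show "\<exists>r. q * r - 1 \<in> ph_ideal p h" if "q \<notin> ph_ideal p h" for q
        using h(3) that unfolding ph_maximal_def by blast
      show "1 \<notin> ph_ideal p h" using h(3) unfolding ph_maximal_def by blast
    qed (fact h p_ramified U xy p_prime)+
    have "Defs.monic \<Z> (rev (coeffs h))" "Polynomials.degree (rev (coeffs h)) = f"
      using Z\<Theta>.list_poly_monic(3,5)[OF h(1)] h(2) by (simp_all add: type_ring_list_poly)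
    moreover have "irreducible_mod p (rev (coeffs h))"
      using irreducible_mod_iff[OF p_prime h(1)] f_pos h(2,3) by simp
    moreover have "\<forall>Q. lies_over (\<O> tower.N.L) Q p \<longrightarrow> Q = tower.N.NL.V.PL"
      using tower.N.NL.V.lies_over_unique by blast
    moreover have "Defs.monic (\<O> tower.N.K) tower.N.g"
      using tower.N.eisenstein_g unfolding eisenstein_def by blast
    moreover have "tower.N.T.\<psi> [:0, 1:] \<in> carrier tower.N.NL.V.DR"
      unfolding tower.N.NL.V.DR_simps by (rule tower.N.NL.V.y_D)
    ultimately show ?case
      by (rule_tac exI[of _ "rev (coeffs h)"], rule_tac exI[of _ tower.N.g], rule_tac exI[of _ tower.N.NL.V.PL])
        (unfold Let_def tower.N.hQ_list[symmetric] tower.N.Y_class tower.N.NL.V.localization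
           tower.N.NL.V.PL_pow_extension tower.N.NL.V.DR_pow,
         intro conjI tower.N.g_degree tower.N.eisenstein_g tower.N.K_field tower.N.L_field
           tower.N.K_dimension[unfolded h(2)] tower.N.inert_K tower.N.L_dimension tower.N.totally_ramified
           tower.N.NL.V.PL_lies_over tower.N.NL.V.DR_discrete_valuation_ring tower.quotient_iso(1)
           tower.quotient_iso(2)[unfolded tower.N.NL.V.DR_pow] refl tower.N.NL.V.ramification_index
           tower.quotient_iso(3))
  next
    case 2
    \<comment> \<open>The ceiling yields \<open>a \<le> e * a0\<close>, which makes
      \<open>p ^ a0\<close> vanish in \<open>R\<close>.\<close>
    define a0 where "a0 = nat \<lceil>real a / real e\<rceil>"
    have "real a / real e \<le> real a0" unfolding a0_def by linarith
    hence "real a \<le> real (e * a0)" using p_ramified(1) by (simp add: field_simps)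
    hence a0: "a \<le> e * a0" by (simp only: of_nat_le_iff)
    \<comment> \<open>One statement for both claims: the root \<open>b\<close> is either prescribed
      or supplied by Hensel's lemma.\<close>
    have main: "\<exists>g. eisenstein_lift p e l g \<and>
        (\<exists>\<phi>\<in>ring_iso (ZXY Quot presentation_ideal p a0 a g l) R.
          \<phi> (presentation_ideal p a0 a g l +>\<^bsub>ZXY\<^esub> ZX_to_ZXY X\<^bsub>\<Z>\<^esub>) = b \<and>
          \<phi> (presentation_ideal p a0 a g l +>\<^bsub>ZXY\<^esub> X\<^bsub>ZX\<^esub>) = \<pi>)"
      if l: "l = rev (coeffs h)" and h: "Polynomial.lead_coeff h = 1" "Polynomial.degree h = f" "ph_maximal p h"
        and b: "b \<in> carrier R" "peval R (int_img R) b h = \<zero>\<^bsub>R\<^esub>" for l h b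
    proof -
      interpret root: local_PIR_root R \<pi> a e f p h b by unfold_locales (fact h b)+
      obtain U where U: "Polynomial.degree U < e" "poly.coeff U 0 \<notin> ph_ideal p h" "root.ev2 (eis_poly p e U) = \<zero>\<^bsub>R\<^esub>"
        by (rule root.exists_U)
      have l: "l = Z\<Theta>.\<Theta> h" unfolding l type_ring_list_poly ..
      show ?thesis
        unfolding l using eisenstein_lift_eis_poly[OF h(1,3) prime_gt_0_nat[OF p_prime] U(1,2)] root.presentation[OF U a0]
        by blast
    qed
    show ?case
      unfolding Let_def a0_def[symmetric]
    proof (intro allI impI)
      fix l assume l: "Defs.monic \<Z> l \<and> Polynomials.degree l = f \<and> irreducible_mod p l"
      then obtain h where h: "l = rev (coeffs h)" "Polynomial.lead_coeff h = 1" "Polynomials.degree l = Polynomial.degree h"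
        using monic_int_list by blast
      hence d: "Polynomial.degree h = f" using l by simp
      hence m: "ph_maximal p h" using irreducible_mod_iff[OF p_prime h(2)] f_pos l h(1) by simp
      obtain b where b: "b \<in> carrier R" "peval R (int_img R) b h = \<zero>\<^bsub>R\<^esub>" using exists_root[OF h(2) d m] by blast
      show "(\<exists>g. eisenstein_lift p e l g \<and> ZXY Quot presentation_ideal p a0 a g l \<simeq> R) \<and>
        (\<forall>b\<in>carrier R. int_eval R l b = \<zero>\<^bsub>R\<^esub> \<longrightarrow>
          (\<exists>g. eisenstein_lift p e l g \<and>
            (\<exists>\<phi>\<in>ring_iso (ZXY Quot presentation_ideal p a0 a g l) R.
              \<phi> (presentation_ideal p a0 a g l +>\<^bsub>ZXY\<^esub> ZX_to_ZXY X\<^bsub>\<Z>\<^esub>) = b \<and>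
              \<phi> (presentation_ideal p a0 a g l +>\<^bsub>ZXY\<^esub> X\<^bsub>ZX\<^esub>) = \<pi>)))"
      proof (intro conjI ballI impI)
        show "\<exists>g. eisenstein_lift p e l g \<and> ZXY Quot presentation_ideal p a0 a g l \<simeq> R"
          using main[OF h(1,2) d m b] unfolding is_ring_iso_def by blast
        fix b assume b: "b \<in> carrier R" "int_eval R l b = \<zero>\<^bsub>R\<^esub>"
        have "peval R (int_img R) b h = \<zero>\<^bsub>R\<^esub>" using b(2) unfolding h(1) int_eval_eq_peval[OF b(1)] .
        from main[OF h(1,2) d m b(1) this]
        show "\<exists>g. eisenstein_lift p e l g \<and>
            (\<exists>\<phi>\<in>ring_iso (ZXY Quot presentation_ideal p a0 a g l) R.
              \<phi> (presentation_ideal p a0 a g l +>\<^bsub>ZXY\<^esub> ZX_to_ZXY X\<^bsub>\<Z>\<^esub>) = b \<and>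
              \<phi> (presentation_ideal p a0 a g l +>\<^bsub>ZXY\<^esub> X\<^bsub>ZX\<^esub>) = \<pi>)" .
      qed
    qed
  qed
qed

end
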